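(* Let $\mu\in\mathscr K(X)$ be a $G$-Kato measure with fine support $F$, and assume that $F$ is closed. Then: (1) The space $P_F(C_0(X))$ is $\check R_\alpha$-invariant for all $\alpha>0$ and $\lim_{\alpha\to\infty}\|\alpha\check R_\alpha u-u\|_\infty=0$ for all $u\in P_F(C_0(X))$. (2) The space $P_F(C_0(X))$ is $\check{\bf P}_t$-invariant for all $t>0$ and $\lim_{t\to0}\|\check{\bf P}_tu-u\|_\infty=0$ for all $u\in P_F(C_0(X))$. (3) For all $t\ge0$ the operator $\check{\bf P}_t$ maps $C_0(X)$ continuously into itself. Moreover, for all $u\in C_0(X)$ the map $[0,\infty)\to C_0(X)$, $t\mapsto\check{\bf P}_tu$, is continuous.
   Context: $X$ is a locally compact separable metric space, $m$ a positive Radon measure on the Borel sets of $X$ with full support, $X_\partial=X\cup\{\partial\}$ the one-point compactification; every function $u$ on $X$ is extended by $u(\partial)=0$. $\mathscr B_b(X)$ denotes the bounded Borel functions on $X$ with the sup norm $\|\cdot\|_\infty$, and $C_0(X)$ the continuous functions vanishing at infinity. $\mathbb X=(\Omega,\mathscr M,\mathscr M_t,(\mathbb P_x)_{x\in X_\partial},(\mathbb X_t)_{0\le t\le\infty},(\theta_t),\zeta)$ is a standard process in the sense of Blumenthal–Getoor (not necessarily symmetric) with state space $X$ and cemetery $\partial$ (with $\mathbb X_\infty=\partial$). It is transient and has a dual standard process $\hat{\mathbb X}$ (duality with respect to $m$) with the same properties. Its transition semigroup ${\bf P}_tu(x)=\mathbb E_x[u(\mathbb X_t)]$ has a jointly measurable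 density $p_t(x,y)$ with respect to $m$, with $p_t(x,y)>0$ for all $t>0$, $x,y\in X$. For $\alpha\ge0$, $G_\alpha(x,y)=\int_0^\infty e^{-\alpha t}p_t(x,y)\,dt$, $G:=G_0\not\equiv\infty$, and $G:X\times X\to(0,\infty]$ is lower semicontinuous. A positive Radon measure $\mu$ on $X$ is $G$-Kato if $G^\mu1:=\int_XG(\cdot,y)\,d\mu(y)\in C_0(X)$; $\mathscr K(X)$ is the set of $G$-Kato measures. Each $\mu\in\mathscr K(X)$ has a unique (up to equivalence) positive continuous additive functional (PCAF) ${\bf A}$ of $\mathbb X$ with Revuz measure $\mu$; it satisfies $\mathbb E_x[\int_0^\infty e^{-\alpha t}u(\mathbb X_t)\,d{\bf A}_t]=\int_XG_\alpha(x,y)u(y)\,d\mu(y)$ for $u\in\mathscr B_b(X)$, $\alpha\ge0$, $x\in X$. Put $\tau_t=\inf\{s\ge0:{\bf A}_s>t\}$ and, for $u\in\mathscr B_b(X)$, $x\in X$, $$\check{\bf P}_tu(x)=\mathbb E_x[u(\mathbb X_{\tau_t})],\qquad \check R_\alpha u(x)=\mathbb E_x\Big[\int_0^\infty e^{-\alpha t}u(\mathbb X_{\tau_t})\,dt\Big],$$ the semigroup and resolvent of the time-changed process $\check{\mathbb X}=(\mathbb X_{\tau_t})_{t\ge0}$ on $X$. The fine support $F$ of $\mu$ is the smallest nearly Borel finely closed set $B\subset X$ with $\mu(B^c)=0$; it equals $\{x\in X:\mathbb P_x(\tau_0=0)=1\}$. With $\sigma_F=\inf\{t>0:\mathbb X_t\in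 F\}$, the hitting operator is $P_Fu(x)=\mathbb E_x[u(\mathbb X_{\sigma_F})]$. *)

theory Defs
  imports "HOL-Probability.Probability"
begin

section \<open>Function spaces and measures\<close>

text \<open>Borel measures finite on compact sets; on the locally compact separable metric spaces
  considered here these are automatically regular.\<close>

definition radon_measure :: "'a::topological_space measure \<Rightarrow> bool" where
  "radon_measure \<mu> \<longleftrightarrow> sets \<mu> = sets borel \<and> (\<forall>K. compact K \<longrightarrow> emeasure \<mu> K < \<infinity>)"

definition full_support :: "'a::topological_space measure \<Rightarrow> bool" where
  "full_support m \<longleftrightarrow> (\<forall>U. open U \<and> U \<noteq> {} \<longrightarrow> emeasure m U > 0)"

definition lower_semicont :: "('b::topological_space \<Rightarrow> ennreal) \<Rightarrow> bool" where
  "lower_semicont f \<longleftrightarrow> (\<forall>c. open {x. c < f x})"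

definition C0 :: "('a::topological_space \<Rightarrow> real) set" where
  "C0 = {u. continuous_on UNIV u \<and> (\<forall>e>0. \<exists>K. compact K \<and> (\<forall>x. x \<notin> K \<longrightarrow> \<bar>u x\<bar> < e))}"

text \<open>The sup norm takes the value \<open>\<infinity>\<close> on unbounded functions.\<close>

definition sup_norm :: "('a \<Rightarrow> real) \<Rightarrow> ennreal" where
  "sup_norm u = (SUP x. ennreal \<bar>u x\<bar>)"

definition sup_dist :: "('a \<Rightarrow> real) \<Rightarrow> ('a \<Rightarrow> real) \<Rightarrow> real" where
  "sup_dist u v = enn2real (sup_norm (\<lambda>x. u x - v x))"

definition C0_topology :: "('a::topological_space \<Rightarrow> real) topology" where
  "C0_topology = Metric_space.mtopology C0 sup_dist"

lemma C0_bounded: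
  assumes "u \<in> C0" shows "\<exists>B. \<forall>x. \<bar>u x\<bar> \<le> B"
proof -
  have "\<forall>e>0. \<exists>K. compact K \<and> (\<forall>x. x \<notin> K \<longrightarrow> \<bar>u x\<bar> < e)"
    using assms by (simp add: C0_def)
  from this[rule_format, OF zero_less_one]
  obtain K where K: "compact K" "\<And>x. x \<notin> K \<Longrightarrow> \<bar>u x\<bar> < 1" by auto
  have "continuous_on UNIV u" using assms by (simp add: C0_def)
  then have "continuous_on K u" by (rule continuous_on_subset) simp
  then have "bounded (u ` K)" by (intro compact_imp_bounded compact_continuous_image K(1))
  then obtain B where B: "\<And>x. x \<in> K \<Longrightarrow> \<bar>u x\<bar> \<le> B" by (auto simp: bounded_iff)
  have "\<bar>u x\<bar> \<le> max 1 B" for x using K(2)[of x] B[of x] by (cases "x \<in> K") auto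
  then show ?thesis by blast
qed

lemma sup_norm_C0_diff_finite:
  assumes "u \<in> C0" "v \<in> C0" shows "sup_norm (\<lambda>x. u x - v x) < \<infinity>"
proof -
  from C0_bounded[OF assms(1)] obtain B1 where B1: "\<forall>x. \<bar>u x\<bar> \<le> B1" ..
  from C0_bounded[OF assms(2)] obtain B2 where B2: "\<forall>x. \<bar>v x\<bar> \<le> B2" ..
  have "\<bar>u x - v x\<bar> \<le> B1 + B2" for x using B1[rule_format, of x] B2[rule_format, of x] by linarith
  then have "sup_norm (\<lambda>x. u x - v x) \<le> ennreal (B1 + B2)"
    unfolding sup_norm_def by (intro SUP_least ennreal_leI)
  also have "\<dots> < \<infinity>" by simp
  finally show ?thesis .
qed

lemma Metric_space_C0: "Metric_space C0 sup_dist"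
proof
  fix u v w :: "'a::topological_space \<Rightarrow> real"
  show "0 \<le> sup_dist u v" by (simp add: sup_dist_def)
  show "sup_dist u v = sup_dist v u"
    by (simp add: sup_dist_def sup_norm_def abs_minus_commute)
  assume uv: "u \<in> C0" "v \<in> C0"
  have le: "ennreal \<bar>u x - v x\<bar> \<le> sup_norm (\<lambda>x. u x - v x)" for x
    unfolding sup_norm_def by (rule SUP_upper) simp
  show "sup_dist u v = 0 \<longleftrightarrow> u = v"
  proof
    assume "sup_dist u v = 0"
    then have "sup_norm (\<lambda>x. u x - v x) = 0"
      using sup_norm_C0_diff_finite[OF uv] by (auto simp: sup_dist_def enn2real_eq_0_iff)
    then have "\<bar>u x - v x\<bar> = 0" for x
      using le[of x] by (simp add: ennreal_eq_0_iff)
    then show "u = v" by (intro ext) simp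
  qed (simp add: sup_dist_def sup_norm_def)
  assume w: "w \<in> C0"
  have "sup_norm (\<lambda>x. u x - w x) \<le> sup_norm (\<lambda>x. u x - v x) + sup_norm (\<lambda>x. v x - w x)"
    unfolding sup_norm_def[of "\<lambda>x. u x - w x"]
  proof (rule SUP_least)
    fix x
    have "ennreal \<bar>u x - w x\<bar> \<le> ennreal \<bar>u x - v x\<bar> + ennreal \<bar>v x - w x\<bar>"
      using ennreal_leI[OF abs_triangle_ineq[of "u x - v x" "v x - w x"]] by simp
    also have "\<dots> \<le> sup_norm (\<lambda>x. u x - v x) + sup_norm (\<lambda>x. v x - w x)"
      unfolding sup_norm_def by (intro add_mono SUP_upper) auto
    finally show "ennreal \<bar>u x - w x\<bar> \<le> \<dots>" .
  qed
  then have "enn2real (sup_norm (\<lambda>x. u x - w x)) \<le>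
      enn2real (sup_norm (\<lambda>x. u x - v x) + sup_norm (\<lambda>x. v x - w x))"
    using sup_norm_C0_diff_finite[OF uv] sup_norm_C0_diff_finite[OF uv(2) w]
    by (intro enn2real_mono) (simp_all add: ennreal_add_less_top)
  also have "\<dots> = enn2real (sup_norm (\<lambda>x. u x - v x)) + enn2real (sup_norm (\<lambda>x. v x - w x))"
    using sup_norm_C0_diff_finite[OF uv] sup_norm_C0_diff_finite[OF uv(2) w]
    by (intro enn2real_plus) simp_all
  finally show "sup_dist u w \<le> sup_dist u v + sup_dist v w"
    unfolding sup_dist_def .
qed


section \<open>Standard processes\<close>

text \<open>The one-point compactification lives on \<^typ>\<open>'a option\<close>, with \<^const>\<open>None\<close> as the
  cemetery; this point is isolated when the space is compact.\<close>

definition comp_top :: "'a::topological_space option topology" where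
  "comp_top = Alexandroff_compactification euclidean"

definition comp_borel :: "'a::topological_space option measure" where
  "comp_borel = sigma UNIV {U. openin comp_top U}"

definition ext0 :: "('a \<Rightarrow> 'b::zero) \<Rightarrow> 'a option \<Rightarrow> 'b" where
  "ext0 u z = (case z of None \<Rightarrow> 0 | Some x \<Rightarrow> u x)"

text \<open>Time runs through \<^typ>\<open>ennreal\<close>, that is \<open>[0,\<infinity>]\<close>. \<open>Path\<close> is the sample space, \<open>Law z\<close> the
  measure started at \<open>z\<close> (all laws have the same events), \<open>Filt\<close> the filtration, \<open>Pos\<close> the
  coordinate process, \<open>Shift\<close> the family of shift operators.\<close>

record ('w, 'a) process =
  Path :: "'w set"
  Law :: "'a option \<Rightarrow> 'w measure"
  Filt :: "ennreal \<Rightarrow> 'w measure"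
  Pos :: "ennreal \<Rightarrow> 'w \<Rightarrow> 'a option"
  Shift :: "ennreal \<Rightarrow> 'w \<Rightarrow> 'w"

definition lifetime :: "('w, 'a) process \<Rightarrow> 'w \<Rightarrow> ennreal" where
  "lifetime X \<omega> = Inf {t. Pos X t \<omega> = None}"

definition natural_filt :: "('w, 'a::topological_space) process \<Rightarrow> ennreal \<Rightarrow> 'w measure" where
  "natural_filt X t =
     sigma (Path X) {Pos X s -` B \<inter> Path X | s B. s \<le> t \<and> B \<in> sets comp_borel}"

text \<open>Sets of paths that are null for the law with initial distribution \<open>\<nu>\<close>.\<close>

definition null_from :: "('w, 'a::topological_space) process \<Rightarrow> 'a option measure \<Rightarrow> 'w set \<Rightarrow> bool" where
  "null_from X \<nu> S \<longleftrightarrow>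
     (\<exists>N\<in>sets (natural_filt X \<infinity>). S \<subseteq> N \<and> (\<integral>\<^sup>+ z. emeasure (Law X z) N \<partial>\<nu>) = 0)"

definition initial_law :: "'a::topological_space option measure \<Rightarrow> bool" where
  "initial_law \<nu> \<longleftrightarrow> prob_space \<nu> \<and> sets \<nu> = sets comp_borel"

text \<open>The usual augmentation of the natural filtration: complete with the null sets of each initial
  law, then intersect over all initial laws.\<close>

definition aug_filt :: "('w, 'a::topological_space) process \<Rightarrow> ennreal \<Rightarrow> 'w measure" where
  "aug_filt X t = sigma (Path X)
     {A. A \<subseteq> Path X \<and> (\<forall>\<nu>. initial_law \<nu> \<longrightarrow>
        (\<exists>B\<in>sets (natural_filt X t). null_from X \<nu> ((A - B) \<union> (B - A))))}"

text \<open>Path properties hold only almost surely, so functionals such as hitting times may be measurable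
  only modulo null sets; hence expectations are taken with respect to the completed laws.\<close>

definition expect :: "('w, 'a) process \<Rightarrow> 'a \<Rightarrow> ('w \<Rightarrow> real) \<Rightarrow> real" where
  "expect X x Z = (\<integral>\<omega>. Z \<omega> \<partial>completion (Law X (Some x)))"

definition markov_process :: "('w, 'a::topological_space) process \<Rightarrow> bool" where
  "markov_process X \<longleftrightarrow>
     \<comment> \<open>measurable structure\<close>
     (\<forall>z. prob_space (Law X z) \<and> space (Law X z) = Path X \<and> sets (Law X z) = sets (Law X None)) \<and>
     filtration (Path X) (Filt X) \<and>
     (\<forall>t. sets (Filt X t) \<subseteq> sets (Law X None)) \<and>
     (\<forall>t. Pos X t \<in> Filt X t \<rightarrow>\<^sub>M comp_borel) \<and>
     \<comment> \<open>cemetery and shifts\<close>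
     (\<forall>\<omega>\<in>Path X. Pos X \<infinity> \<omega> = None) \<and>
     (\<forall>\<omega>\<in>Path X. \<forall>s t. s \<le> t \<and> Pos X s \<omega> = None \<longrightarrow> Pos X t \<omega> = None) \<and>
     (\<forall>\<omega>\<in>Path X. \<forall>s. Shift X s \<omega> \<in> Path X \<and> (\<forall>t. Pos X t (Shift X s \<omega>) = Pos X (s + t) \<omega>)) \<and>
     \<comment> \<open>normality, measurability in the starting point, Markov property\<close>
     (\<forall>z. AE \<omega> in Law X z. Pos X 0 \<omega> = z) \<and>
     (\<forall>t. \<forall>B\<in>sets comp_borel.
        (\<lambda>z. emeasure (Law X z) {\<omega>\<in>Path X. Pos X t \<omega> \<in> B}) \<in> borel_measurable comp_borel) \<and>
     (\<forall>z s t. \<forall>A\<in>sets (Filt X s). \<forall>B\<in>sets comp_borel.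
        emeasure (Law X z) {\<omega>\<in>A. Pos X (s + t) \<omega> \<in> B} =
        (\<integral>\<^sup>+ \<omega>\<in>A. emeasure (Law X (Pos X s \<omega>)) {\<omega>'\<in>Path X. Pos X t \<omega>' \<in> B} \<partial>Law X z))"

definition strong_markov :: "('w, 'a::topological_space) process \<Rightarrow> bool" where
  "strong_markov X \<longleftrightarrow> (\<forall>T. stopping_time (Filt X) T \<longrightarrow>
     (\<lambda>\<omega>. Pos X (T \<omega>) \<omega>) \<in> filtration.pre_sigma (Path X) (Filt X) T \<rightarrow>\<^sub>M comp_borel \<and>
     (\<forall>z t. \<forall>A\<in>sets (filtration.pre_sigma (Path X) (Filt X) T). \<forall>B\<in>sets comp_borel.
        emeasure (Law X z) {\<omega>\<in>A. Pos X (T \<omega> + t) \<omega> \<in> B} =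
        (\<integral>\<^sup>+ \<omega>\<in>A. emeasure (Law X (Pos X (T \<omega>) \<omega>)) {\<omega>'\<in>Path X. Pos X t \<omega>' \<in> B} \<partial>Law X z)))"

definition quasi_left_continuous :: "('w, 'a::topological_space) process \<Rightarrow> bool" where
  "quasi_left_continuous X \<longleftrightarrow> (\<forall>T :: nat \<Rightarrow> 'w \<Rightarrow> ennreal.
     (\<forall>n. stopping_time (Filt X) (T n)) \<and> (\<forall>\<omega>\<in>Path X. incseq (\<lambda>n. T n \<omega>)) \<longrightarrow>
     (\<forall>z. AE \<omega> in Law X z. (SUP n. T n \<omega>) < lifetime X \<omega> \<longrightarrow>
        limitin comp_top (\<lambda>n. Pos X (T n \<omega>) \<omega>) (Pos X (SUP n. T n \<omega>) \<omega>) sequentially))"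

text \<open>The last conjunct but one gives right continuity of the paths and left limits on \<open>[0, \<zeta>)\<close>.\<close>

definition standard_process :: "('w, 'a::topological_space) process \<Rightarrow> bool" where
  "standard_process X \<longleftrightarrow>
     markov_process X \<and>
     (\<forall>t. sets (aug_filt X t) \<subseteq> sets (Filt X t)) \<and>
     (\<forall>t<\<infinity>. sets (Filt X t) = (\<Inter>s\<in>{t<..}. sets (Filt X s))) \<and>
     strong_markov X \<and>
     (\<forall>z. AE \<omega> in Law X z.
        (\<forall>t<\<infinity>. limitin comp_top (\<lambda>s. Pos X s \<omega>) (Pos X t \<omega>) (at_right t)) \<and>
        (\<forall>t. 0 < t \<and> t < lifetime X \<omega> \<longrightarrow>
           (\<exists>l. limitin comp_top (\<lambda>s. Pos X s \<omega>) l (at_left t)))) \<and>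
     quasi_left_continuous X"


section \<open>Transition densities, Green functions, transience and duality\<close>

definition transition :: "('w, 'a) process \<Rightarrow> real \<Rightarrow> ('a \<Rightarrow> ennreal) \<Rightarrow> 'a \<Rightarrow> ennreal" where
  "transition X t f x = (\<integral>\<^sup>+ \<omega>. ext0 f (Pos X (ennreal t) \<omega>) \<partial>Law X (Some x))"

text \<open>Transience: the potential of some strictly positive function is finite.\<close>

definition transient :: "('w, 'a::topological_space) process \<Rightarrow> bool" where
  "transient X \<longleftrightarrow> (\<exists>g\<in>borel_measurable borel. (\<forall>x. 0 < g x) \<and>
     (\<forall>x. (\<integral>\<^sup>+ t\<in>{0..}. transition X t g x \<partial>lborel) < \<infinity>))"

definition transition_density ::
  "('w, 'a::topological_space) process \<Rightarrow> 'a measure \<Rightarrow> (real \<Rightarrow> 'a \<Rightarrow> 'a \<Rightarrow> ennreal) \<Rightarrow> bool" where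
  "transition_density X m p \<longleftrightarrow>
     (\<lambda>(t, x, y). p t x y) \<in> borel_measurable
        (restrict_space borel {0<..} \<Otimes>\<^sub>M borel \<Otimes>\<^sub>M borel) \<and>
     (\<forall>t>0. \<forall>x. \<forall>f\<in>borel_measurable borel. transition X t f x = (\<integral>\<^sup>+ y. p t x y * f y \<partial>m))"

definition green :: "(real \<Rightarrow> 'a \<Rightarrow> 'a \<Rightarrow> ennreal) \<Rightarrow> real \<Rightarrow> 'a \<Rightarrow> 'a \<Rightarrow> ennreal" where
  "green p \<alpha> x y = (\<integral>\<^sup>+ t\<in>{0<..}. ennreal (exp (- \<alpha> * t)) * p t x y \<partial>lborel)"

definition transient_green_process ::
  "('w, 'a::topological_space) process \<Rightarrow> 'a measure \<Rightarrow> (real \<Rightarrow> 'a \<Rightarrow> 'a \<Rightarrow> ennreal) \<Rightarrow> bool" where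
  "transient_green_process X m p \<longleftrightarrow>
     standard_process X \<and> transient X \<and>
     transition_density X m p \<and> (\<forall>t>0. \<forall>x y. 0 < p t x y) \<and>
     (\<exists>x y. green p 0 x y < \<infinity>) \<and> lower_semicont (\<lambda>(x, y). green p 0 x y)"

definition in_duality ::
  "'a::topological_space measure \<Rightarrow> ('w, 'a) process \<Rightarrow> ('v, 'a) process \<Rightarrow> bool" where
  "in_duality m X Y \<longleftrightarrow> (\<forall>t>0. \<forall>f\<in>borel_measurable borel. \<forall>g\<in>borel_measurable borel.
     (\<integral>\<^sup>+ x. transition X t f x * g x \<partial>m) = (\<integral>\<^sup>+ x. f x * transition Y t g x \<partial>m))"

definition G_Kato :: "(real \<Rightarrow> 'a::topological_space \<Rightarrow> 'a \<Rightarrow> ennreal) \<Rightarrow> 'a measure \<Rightarrow> bool" where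
  "G_Kato p \<mu> \<longleftrightarrow> radon_measure \<mu> \<and>
     (\<forall>x. (\<integral>\<^sup>+ y. green p 0 x y \<partial>\<mu>) < \<infinity>) \<and>
     (\<lambda>x. enn2real (\<integral>\<^sup>+ y. green p 0 x y \<partial>\<mu>)) \<in> C0"


section \<open>Fine topology\<close>

definition hitting_time :: "('w, 'a) process \<Rightarrow> 'a set \<Rightarrow> 'w \<Rightarrow> ennreal" where
  "hitting_time X D \<omega> = Inf {t. 0 < t \<and> Pos X t \<omega> \<in> Some ` D}"

definition hitting_op :: "('w, 'a) process \<Rightarrow> 'a set \<Rightarrow> ('a \<Rightarrow> real) \<Rightarrow> 'a \<Rightarrow> real" where
  "hitting_op X D u x = expect X x (\<lambda>\<omega>. ext0 u (Pos X (hitting_time X D \<omega>) \<omega>))"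

definition nearly_borel :: "('w, 'a::topological_space) process \<Rightarrow> 'a set \<Rightarrow> bool" where
  "nearly_borel X D \<longleftrightarrow> (\<forall>\<nu>. initial_law \<nu> \<longrightarrow>
     (\<exists>D1\<in>sets borel. \<exists>D2\<in>sets borel. D1 \<subseteq> D \<and> D \<subseteq> D2 \<and>
        null_from X \<nu> {\<omega>\<in>Path X. \<exists>t. Pos X t \<omega> \<in> Some ` (D2 - D1)}))"

text \<open>A set is finely open iff each of its points is irregular for some nearly Borel superset of
  the complement.\<close>

definition finely_open :: "('w, 'a::topological_space) process \<Rightarrow> 'a set \<Rightarrow> bool" where
  "finely_open X U \<longleftrightarrow> (\<forall>x\<in>U. \<exists>D. nearly_borel X D \<and> - U \<subseteq> D \<and>
     (AE \<omega> in Law X (Some x). hitting_time X D \<omega> \<noteq> 0))"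

text \<open>Nearly Borel sets are universally measurable, hence the completion.\<close>

definition is_fine_support :: "('w, 'a::topological_space) process \<Rightarrow> 'a measure \<Rightarrow> 'a set \<Rightarrow> bool" where
  "is_fine_support X \<mu> F \<longleftrightarrow>
     (let carries = (\<lambda>B. nearly_borel X B \<and> finely_open X (- B) \<and> - B \<in> null_sets (completion \<mu>))
      in carries F \<and> (\<forall>B. carries B \<longrightarrow> F \<subseteq> B))"


section \<open>Positive continuous additive functionals and time change\<close>

text \<open>Positive continuous additive functionals in the strict sense, with a defining set \<open>L\<close> that has
  full measure for every starting point. They are finite valued: an additive functional whose Revuz
  measure is \<open>G\<close>-Kato has a total mass of finite expectation.\<close>

definition pcaf :: "('w, 'a::topological_space) process \<Rightarrow> (real \<Rightarrow> 'w \<Rightarrow> real) \<Rightarrow> bool" where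
  "pcaf X A \<longleftrightarrow>
     (\<forall>t\<ge>0. A t \<in> borel_measurable (aug_filt X (ennreal t))) \<and>
     (\<exists>L\<in>sets (aug_filt X \<infinity>).
        (\<forall>x. AE \<omega> in Law X (Some x). \<omega> \<in> L) \<and>
        (\<forall>\<omega>\<in>L. \<forall>t\<ge>0. Shift X (ennreal t) \<omega> \<in> L) \<and>
        (\<forall>\<omega>\<in>L. A 0 \<omega> = 0 \<and> (\<forall>t\<ge>0. 0 \<le> A t \<omega>) \<and> continuous_on {0..} (\<lambda>t. A t \<omega>) \<and>
           (\<forall>s\<ge>0. \<forall>t\<ge>s. lifetime X \<omega> \<le> ennreal s \<longrightarrow> A t \<omega> = A s \<omega>) \<and>
           (\<forall>s\<ge>0. \<forall>t\<ge>0. A (s + t) \<omega> = A s \<omega> + A t (Shift X (ennreal s) \<omega>))))"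

text \<open>The Lebesgue--Stieltjes measure \<open>dA(\<omega>)\<close>; it does not charge \<open>(-\<infinity>, 0]\<close>.\<close>

definition stieltjes :: "(real \<Rightarrow> 'w \<Rightarrow> real) \<Rightarrow> 'w \<Rightarrow> real measure" where
  "stieltjes A \<omega> = interval_measure (\<lambda>t. A (max 0 t) \<omega>)"

definition revuz_measure ::
  "('w, 'a::topological_space) process \<Rightarrow> 'a measure \<Rightarrow> (real \<Rightarrow> 'w \<Rightarrow> real) \<Rightarrow> 'a measure \<Rightarrow> bool" where
  "revuz_measure X m A \<mu> \<longleftrightarrow> sets \<mu> = sets borel \<and> (\<forall>f\<in>borel_measurable borel.
     ((\<lambda>t. ennreal (1 / t) * (\<integral>\<^sup>+ x. (\<integral>\<^sup>+ \<omega>. (\<integral>\<^sup>+ s\<in>{0..t}. ext0 f (Pos X (ennreal s) \<omega>)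
         \<partial>stieltjes A \<omega>) \<partial>Law X (Some x)) \<partial>m)) \<longlongrightarrow> (\<integral>\<^sup>+ x. f x \<partial>\<mu>)) (at_right 0))"

definition inverse_pcaf :: "(real \<Rightarrow> 'w \<Rightarrow> real) \<Rightarrow> real \<Rightarrow> 'w \<Rightarrow> ennreal" where
  "inverse_pcaf A t \<omega> = Inf {ennreal s | s. 0 \<le> s \<and> t < A s \<omega>}"

definition tc_semigroup ::
  "('w, 'a) process \<Rightarrow> (real \<Rightarrow> 'w \<Rightarrow> real) \<Rightarrow> real \<Rightarrow> ('a \<Rightarrow> real) \<Rightarrow> 'a \<Rightarrow> real" where
  "tc_semigroup X A t u x = expect X x (\<lambda>\<omega>. ext0 u (Pos X (inverse_pcaf A t \<omega>) \<omega>))"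

definition tc_resolvent ::
  "('w, 'a) process \<Rightarrow> (real \<Rightarrow> 'w \<Rightarrow> real) \<Rightarrow> real \<Rightarrow> ('a \<Rightarrow> real) \<Rightarrow> 'a \<Rightarrow> real" where
  "tc_resolvent X A \<alpha> u x =
     expect X x (\<lambda>\<omega>. LINT t:{0..}|lborel. exp (- \<alpha> * t) * ext0 u (Pos X (inverse_pcaf A t \<omega>) \<omega>))"

end

theory Submission
  imports Defs "HOL-Real_Asymp.Real_Asymp"
begin

text \<open>Write \<open>P\<^sub>t\<close> for the time-changed semigroup, \<open>K\<^sub>s f = \<integral>\<^sub>0\<^sup>s P\<^sub>r f dr\<close>, and \<open>V h = G(h \<mu>) = \<integral>\<^sub>0\<^sup>\<infinity> P\<^sub>r h dr\<close>.
  Lower semicontinuity of \<open>G\<close> and the Kato condition make \<open>V h\<close> continuous and vanishing at infinity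
  for every bounded Borel function \<open>h\<close>, hence so is \<open>K\<^sub>s f = V (f - P\<^sub>s f)\<close>. For \<open>f\<close> in \<open>C\<^sub>0\<close> the averages \<open>K\<^sub>s f / s\<close> are
  bounded and tend to \<open>f\<close> pointwise on \<open>F\<close> as \<open>s \<rightarrow> 0\<close>; as \<open>F\<close> is closed, suitable convex combinations converge
  uniformly on \<open>F\<close>. The time-changed process lives on \<open>F\<close> and \<open>\<tau>\<^sub>0 = \<sigma>\<^sub>F\<close> almost surely, so \<open>P\<^sub>0 = P\<^sub>F\<close> carries
  this over to uniform convergence on \<open>X\<close>: every \<open>P\<^sub>F f\<close> is a uniform limit of functions on which the semigroup
  is strongly continuous.\<close>

section \<open>Continuous functions vanishing at infinity\<close>

text \<open>Bounded pointwise convergence on \<open>F\<close> of functions in \<open>C0\<close>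
  amounts to weak convergence, so Mazur's theorem predicts uniformly convergent convex combinations.
  The elementary argument used for this needs only that |z| attains its supremum over
  \<open>F\<close>. Closedness of \<open>F\<close> enters there and in the identification of tau 0
  with the hitting time. The obstacle is that P_t f, for f in \<open>C0\<close>, is neither known to
  be continuous nor even Borel: it is the expectation of a functional measurable for the augmented
  filtration only. Continuity has a single source, the potential operator V, so continuous functions
  are manufactured from time integrals; and iterated operators are computed through the strong
  Markov property of whole path functionals, not through measurability of the inner function. The
  statements about the range of P_F are proved for \<open>cont_space\<close>, the functions in
  \<open>C0\<close> on which the semigroup is strongly continuous. It is a closed linear space on
  which P_0 is the identity and into which P_0 maps \<open>C0\<close>; hence it is that
  range.\<close>

lemma C0_D:
  assumes "u \<in> C0" "e > 0"
  shows "\<exists>K. compact K \<and> (\<forall>x. x \<notin> K \<longrightarrow> \<bar>u x\<bar> < e)"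
  using assms by (simp add: C0_def)

lemma C0_continuous: "u \<in> C0 \<Longrightarrow> continuous_on UNIV u"
  by (simp add: C0_def)

lemma C0_measurable: "u \<in> C0 \<Longrightarrow> u \<in> borel_measurable borel"
  by (intro borel_measurable_continuous_onI C0_continuous)

lemma C0_dominated:
  assumes "continuous_on UNIV f" "g \<in> C0" "\<And>x. \<bar>f x\<bar> \<le> \<bar>g x\<bar>"
  shows "f \<in> C0"
  unfolding C0_def
proof safe
  fix e :: real assume "e > 0"
  then obtain K where "compact K" "\<And>x. x \<notin> K \<Longrightarrow> \<bar>g x\<bar> < e"
    using C0_D[OF assms(2)] by blast
  then show "\<exists>K. compact K \<and> (\<forall>x. x \<notin> K \<longrightarrow> \<bar>f x\<bar> < e)"
    using assms(3) le_less_trans by blast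
qed fact

lemma C0_abs: "u \<in> C0 \<Longrightarrow> (\<lambda>x. \<bar>u x\<bar>) \<in> C0"
  by (rule C0_dominated[of _ u]) (auto intro: continuous_on_rabs C0_continuous)

lemma C0_zero: "(\<lambda>x. 0) \<in> C0"
  unfolding C0_def by (auto intro!: exI[of _ "{}"])

lemma C0_lincomb:
  assumes u: "u \<in> C0" and v: "v \<in> C0"
  shows "(\<lambda>x. a * u x + b * v x) \<in> C0"
  unfolding C0_def
proof safe
  show "continuous_on UNIV (\<lambda>x. a * u x + b * v x)"
    by (intro continuous_intros C0_continuous assms)
next
  fix e :: real assume e: "e > 0"
  \<comment> \<open>The summand 1 keeps the denominator positive for a = b = 0 and makes the final
    inequality strict.\<close>
  define d where "d = e / (\<bar>a\<bar> + \<bar>b\<bar> + 1)"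
  have d: "d > 0" using e by (auto simp: d_def intro!: divide_pos_pos add_nonneg_pos)
  obtain K1 K2 where K: "compact K1" "\<And>x. x \<notin> K1 \<Longrightarrow> \<bar>u x\<bar> < d"
      "compact K2" "\<And>x. x \<notin> K2 \<Longrightarrow> \<bar>v x\<bar> < d"
    using C0_D[OF u d] C0_D[OF v d] by blast
  have "\<bar>a * u x + b * v x\<bar> < e" if "x \<notin> K1 \<union> K2" for x
  proof -
    have "\<bar>a * u x + b * v x\<bar> \<le> \<bar>a\<bar> * \<bar>u x\<bar> + \<bar>b\<bar> * \<bar>v x\<bar>"
      by (metis abs_mult abs_triangle_ineq)
    also have "\<dots> \<le> \<bar>a\<bar> * d + \<bar>b\<bar> * d"
      using K(2)[of x] K(4)[of x] that by (intro add_mono mult_left_mono) auto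
    also have "\<dots> = (\<bar>a\<bar> + \<bar>b\<bar>) * d" by (simp add: algebra_simps)
    also have "\<dots> < (\<bar>a\<bar> + \<bar>b\<bar> + 1) * d" using d by (intro mult_strict_right_mono) auto
    also have "\<dots> = e" unfolding d_def by (simp add: field_simps add_nonneg_eq_0_iff)
    finally show ?thesis .
  qed
  then show "\<exists>K. compact K \<and> (\<forall>x. x \<notin> K \<longrightarrow> \<bar>a * u x + b * v x\<bar> < e)"
    using K(1,3) compact_Un by blast
qed

lemma C0_diff: "u \<in> C0 \<Longrightarrow> v \<in> C0 \<Longrightarrow> (\<lambda>x. u x - v x) \<in> C0"
  using C0_lincomb[of u v 1 "-1"] by simp

lemma C0_scale: "u \<in> C0 \<Longrightarrow> (\<lambda>x. a * u x) \<in> C0"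
  using C0_lincomb[of u u a 0] by simp

lemma C0_uniform_limit:
  assumes "\<And>e. e > 0 \<Longrightarrow> \<exists>g\<in>C0. \<forall>x. \<bar>g x - f x\<bar> \<le> e"
  shows "f \<in> C0"
  unfolding C0_def
proof safe
  have "\<exists>g. \<forall>n::nat. g n \<in> C0 \<and> (\<forall>x. \<bar>g n x - f x\<bar> \<le> inverse (real (Suc n)))"
    using assms[of "inverse (real (Suc _))"] by (intro choice) fastforce
  then obtain g where g: "\<And>n. g n \<in> C0" "\<And>n x. \<bar>g n x - f x\<bar> \<le> inverse (real (Suc n))" by blast
  have "uniform_limit UNIV g f sequentially"
  proof (rule uniform_limitI)
    fix e :: real assume "e > 0"
    then have "\<forall>\<^sub>F n in sequentially. inverse (real (Suc n)) < e"
      using LIMSEQ_inverse_real_of_nat order_tendstoD(2) by blast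
    then show "\<forall>\<^sub>F n in sequentially. \<forall>x\<in>UNIV. dist (g n x) (f x) < e"
      by eventually_elim (auto simp: dist_real_def intro: le_less_trans[OF g(2)])
  qed
  then show "continuous_on UNIV f"
    by (rule uniform_limit_theorem[rotated]) (auto intro!: always_eventually C0_continuous g)
next
  fix e :: real assume e: "e > 0"
  obtain g where g: "g \<in> C0" "\<And>x. \<bar>g x - f x\<bar> \<le> e / 2" using assms[of "e/2"] e by auto
  obtain K where K: "compact K" "\<And>x. x \<notin> K \<Longrightarrow> \<bar>g x\<bar> < e / 2" using C0_D[OF g(1), of "e/2"] e by auto
  have "\<bar>f x\<bar> < e" if "x \<notin> K" for x using g(2)[of x] K(2)[OF that] by linarith
  then show "\<exists>K. compact K \<and> (\<forall>x. x \<notin> K \<longrightarrow> \<bar>f x\<bar> < e)" using K(1) by blast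
qed

text \<open>A nonzero value on \<open>F\<close> confines the competitors: off a compact set |z| is
  below |z x0|, so the supremum over \<open>F\<close> is one over \<open>F \<inter> K\<close>, which
  is compact because \<open>F\<close> is closed.\<close>

lemma C0_attains_sup:
  assumes z: "z \<in> C0" and F: "closed F" and x0: "x0 \<in> F" "z x0 \<noteq> (0::real)"
  shows "\<exists>b\<in>F. \<forall>x\<in>F. \<bar>z x\<bar> \<le> \<bar>z b\<bar>"
proof -
  obtain K where K: "compact K" "\<And>x. x \<notin> K \<Longrightarrow> \<bar>z x\<bar> < \<bar>z x0\<bar>" using C0_D[OF z, of "\<bar>z x0\<bar>"] x0 by auto
  have "compact (F \<inter> K)" using F K(1) by (simp add: closed_Int_compact)
  moreover have "F \<inter> K \<noteq> {}" using x0 K(2)[of x0] by auto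
  moreover have "continuous_on (F \<inter> K) (\<lambda>x. \<bar>z x\<bar>)"
    using C0_continuous[OF z] by (intro continuous_intros) (auto elim: continuous_on_subset)
  ultimately obtain b where b: "b \<in> F \<inter> K" "\<And>x. x \<in> F \<inter> K \<Longrightarrow> \<bar>z x\<bar> \<le> \<bar>z b\<bar>"
    using continuous_attains_sup by metis
  have "x0 \<in> K" using K(2)[of x0] by auto
  then have "\<bar>z x0\<bar> \<le> \<bar>z b\<bar>" using b(2) x0(1) by auto
  then have "\<bar>z x\<bar> \<le> \<bar>z b\<bar>" if "x \<in> F" for x
    using b(2)[of x] K(2)[of x] that by (cases "x \<in> K") auto
  then show ?thesis using b(1) by blast
qed

section \<open>Uniform approximation on a closed set by convex combinations\<close>

lemma sums_half: "(\<lambda>i. (1/2::real) ^ Suc i) sums 1"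
  using power_half_series by simp

text \<open>The argument of Simons' inequality. If no element of \<open>D\<close> is uniformly close to \<open>f\<close> on \<open>F\<close>, greedily chosen
  \<open>G k\<close> from the tails \<open>C k\<close> give \<open>z = \<Sum>k. 2\<^sup>-\<^sup>k\<^sup>-\<^sup>1 (G k - f)\<close>, and at a point \<open>b\<close> where \<open>\<bar>z\<bar>\<close> attains its
  supremum over \<open>F\<close> all tails of the series stay away from \<open>0\<close>, contradicting the convergence at \<open>b\<close>.\<close>

lemma convex_combination_uniform_approx:
  fixes D :: "('a::topological_space \<Rightarrow> real) set" and f :: "'a \<Rightarrow> real" and h :: "nat \<Rightarrow> 'a \<Rightarrow> real"
  assumes lin: "\<And>g h a b. g \<in> D \<Longrightarrow> h \<in> D \<Longrightarrow> (\<lambda>x. a * g x + b * h x) \<in> D"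
    and lim: "\<And>f. (\<And>e. e > 0 \<Longrightarrow> \<exists>g\<in>D. \<forall>x. \<bar>g x - f x\<bar> \<le> e) \<Longrightarrow> f \<in> D"
    and D: "D \<subseteq> C0" and f: "f \<in> C0" and F: "closed F"
    and hD: "\<And>n. h n \<in> D" and hc: "\<And>n x. \<bar>h n x\<bar> \<le> c"
    and conv: "\<And>x. x \<in> F \<Longrightarrow> (\<lambda>n. h n x) \<longlonglongrightarrow> f x"
    and e: "e > 0"
  shows "\<exists>g\<in>D. \<forall>x\<in>F. \<bar>g x - f x\<bar> \<le> e"
proof (rule ccontr)
  assume neg: "\<not> ?thesis"
  then have far: "\<exists>x\<in>F. \<bar>g x - f x\<bar> > e" if "g \<in> D" for g using that by (auto simp: not_le)
  then have Fne: "F \<noteq> {}" using hD by blast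
  define N :: "('a \<Rightarrow> real) \<Rightarrow> real" where "N u = (SUP x\<in>F. \<bar>u x\<bar>)" for u
  have N_le: "N u \<le> B" if "\<And>x. x \<in> F \<Longrightarrow> \<bar>u x\<bar> \<le> B" for u B
    unfolding N_def using Fne that by (intro cSUP_least) auto
  have le_N: "\<bar>u x\<bar> \<le> N u" if "x \<in> F" "\<And>x. \<bar>u x\<bar> \<le> B" for u x B
    unfolding N_def using that by (intro cSUP_upper bdd_aboveI[of _ B]) auto
  \<comment> \<open>\<open>C k\<close> stands in for the closed convex hull of the functions
    \<open>h n\<close> with n >= k. Instead of a hull it records two inequalities that survive
    countable convex combinations: the uniform bound \<open>c\<close>, and that at points of
    \<open>F\<close> no member is farther from \<open>f\<close> than the tail allows.\<close>
  define C where "C k = {g \<in> D. (\<forall>x. \<bar>g x\<bar> \<le> c) \<and>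
    (\<forall>x\<in>F. \<forall>r. (\<forall>n\<ge>k. \<bar>h n x - f x\<bar> \<le> r) \<longrightarrow> \<bar>g x - f x\<bar> \<le> r)}" for k :: nat
  have hC: "h k \<in> C k" for k using hD hc by (auto simp: C_def)
  have C_mono: "C l \<subseteq> C k" if "k \<le> l" for k l using that by (force simp: C_def)
  obtain cf where cf: "\<And>x. \<bar>f x\<bar> \<le> cf" using C0_bounded[OF f] by blast
  have C_bound: "\<bar>g x - f x\<bar> \<le> c + cf" if "g \<in> C k" for g k x
  proof -
    have "\<bar>g x\<bar> \<le> c" using that by (simp add: C_def)
    then show ?thesis using cf[of x] by linarith
  qed
  \<comment> \<open>The slack is exactly what the induction on the gap \<open>N z - N (Z k)\<close>
    can absorb: each stage halves the correction term (e/2) 2^-k, and the released amount is e/8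
    4^-k.\<close>
  define \<delta> where "\<delta> k = e / 8 / 4 ^ k" for k :: nat
  have \<delta>: "\<delta> k > 0" for k using e by (simp add: \<delta>_def)
  define step where "step k z g = (\<lambda>x. z x + (1/2)^Suc k * (g x - f x))" for k z and g :: "'a \<Rightarrow> real"
  \<comment> \<open>The infimum over \<open>C k\<close> need not be attained, so minimality is asked
    for only up to \<open>\<delta> k\<close>.\<close>
  define good where "good k z g \<longleftrightarrow> g \<in> C k \<and> (\<forall>g'\<in>C k. N (step k z g) \<le> N (step k z g') + \<delta> k)" for k z g
  have good_ex: "\<exists>g. good k z g" if z: "\<And>x. \<bar>z x\<bar> \<le> B" for k z B
  proof -
    let ?S = "(\<lambda>g. N (step k z g)) ` C k"
    obtain xF where xF: "xF \<in> F" using Fne by blast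
    have nn: "0 \<le> N (step k z g)" if "g \<in> C k" for g
    proof -
      have "\<bar>step k z g x\<bar> \<le> B + (1/2)^Suc k * (c + cf)" for x
      proof -
        have "\<bar>g x - f x\<bar> \<le> c + cf" using C_bound[OF that] .
        then have "\<bar>(1/2)^Suc k * (g x - f x)\<bar> \<le> (1/2)^Suc k * (c + cf)"
          unfolding abs_mult by (intro mult_mono) auto
        then show ?thesis using z[of x] unfolding step_def by linarith
      qed
      then have "\<bar>step k z g xF\<bar> \<le> N (step k z g)" by (rule le_N[OF xF])
      then show ?thesis by linarith
    qed
    then have bdd: "bdd_below ?S" by (intro bdd_belowI[of _ 0]) auto
    have ne: "?S \<noteq> {}" using hC by blast
    obtain s where "s \<in> ?S" "s < Inf ?S + \<delta> k"
      using cInf_lessD[OF ne, of "Inf ?S + \<delta> k"] \<delta>[of k] by auto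
    then obtain g where g: "g \<in> C k" "N (step k z g) < Inf ?S + \<delta> k" by auto
    have "N (step k z g) \<le> N (step k z g') + \<delta> k" if "g' \<in> C k" for g'
      using g(2) cInf_lower[OF imageI[OF that] bdd] by linarith
    then show ?thesis using g(1) unfolding good_def by blast
  qed
  \<comment> \<open>The greedy choice at stage k depends on the past only through the partial sum,
    so the recursion runs on partial sums.\<close>
  define Z where "Z = rec_nat (\<lambda>x. 0) (\<lambda>k z. step k z (SOME g. good k z g))"
  define G where "G k = (SOME g. good k (Z k) g)" for k
  have Z0: "Z 0 = (\<lambda>x. 0)" and ZS: "\<And>k. Z (Suc k) = step k (Z k) (G k)"
    by (simp_all add: Z_def G_def)
  have ZG: "(\<exists>B. \<forall>x. \<bar>Z k x\<bar> \<le> B) \<and> good k (Z k) (G k)" for k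
  proof (induction k)
    case 0
    have "good 0 (Z 0) (G 0)" unfolding G_def by (rule someI_ex[of "good 0 (Z 0)"], rule good_ex[of _ 0]) (simp add: Z0)
    then show ?case by (auto simp: Z0)
  next
    case (Suc k)
    then obtain B where B: "\<And>x. \<bar>Z k x\<bar> \<le> B" by blast
    have "\<bar>Z (Suc k) x\<bar> \<le> B + (1/2)^Suc k * (c + cf)" for x
    proof -
      have "\<bar>G k x - f x\<bar> \<le> c + cf" using Suc by (intro C_bound) (auto simp: good_def)
      then have "\<bar>(1/2)^Suc k * (G k x - f x)\<bar> \<le> (1/2)^Suc k * (c + cf)"
        unfolding abs_mult by (intro mult_mono) auto
      then show ?thesis using B[of x] unfolding ZS step_def by linarith
    qed
    then have b: "\<exists>B. \<forall>x. \<bar>Z (Suc k) x\<bar> \<le> B" by blast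
    then have "good (Suc k) (Z (Suc k)) (G (Suc k))"
      unfolding G_def[of "Suc k"] using good_ex by (intro someI_ex[of "good (Suc k) (Z (Suc k))"]) blast
    with b show ?case by blast
  qed
  then have GC: "G k \<in> C k" and Gmin: "\<And>g'. g' \<in> C k \<Longrightarrow> N (Z (Suc k)) \<le> N (step k (Z k) g') + \<delta> k"
    and Zb: "\<exists>B. \<forall>x. \<bar>Z k x\<bar> \<le> B" for k
    unfolding ZS by (auto simp: good_def)
  have GD: "G k \<in> D" and Gc: "\<bar>G k x\<bar> \<le> c" for k x using GC[of k] by (auto simp: C_def)
  define w where "w i = (1/2::real) ^ Suc i" for i
  have w_sums: "w sums 1" unfolding w_def by (rule sums_half)
  have w0: "w i \<ge> 0" for i by (simp add: w_def)
  \<comment> \<open>The tail of the greedy series, renormalised to a convex combination of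
    \<open>G k\<close>, \<open>G (Suc k)\<close>, and so on. It lies in \<open>C k\<close> again and
    is therefore an admissible competitor at stage k.\<close>
  define H where "H k x = (\<Sum>i. w i * G (i + k) x)" for k x
  have wsum: "summable (\<lambda>i. w i * u i)" if "\<And>i. \<bar>u i\<bar> \<le> B" for u B
  proof (rule summable_comparison_test)
    show "summable (\<lambda>i. w i * B)" using w_sums by (simp add: sums_iff summable_mult2)
    show "\<exists>N. \<forall>n\<ge>N. norm (w n * u n) \<le> w n * B"
      using that w0 by (auto simp: abs_mult intro!: mult_left_mono)
  qed
  have wavg: "\<bar>(\<Sum>i. w i * u i) - a\<bar> \<le> r" if "\<And>i. \<bar>u i - a\<bar> \<le> r" for u a r
  proof -
    have su: "summable (\<lambda>i. w i * (u i - a))" by (rule wsum[OF that])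
    have sa: "(\<lambda>i. w i * a) sums a" using sums_mult2[OF w_sums, of a] by simp
    have sr: "(\<lambda>i. w i * r) sums r" using sums_mult2[OF w_sums, of r] by simp
    have "(\<lambda>i. w i * (u i - a) + w i * a) sums ((\<Sum>i. w i * (u i - a)) + a)"
      by (intro sums_add summable_sums su sa)
    then have eq: "(\<Sum>i. w i * u i) - a = (\<Sum>i. w i * (u i - a))" by (simp add: algebra_simps sums_iff)
    have "\<bar>w i * (u i - a)\<bar> \<le> w i * r" for i using that[of i] w0[of i] by (auto simp: abs_mult intro: mult_left_mono)
    then have "norm (\<Sum>i. w i * (u i - a)) \<le> (\<Sum>i. w i * r)"
      using sr by (intro norm_suminf_le) (auto simp: sums_iff)
    then show ?thesis using sr unfolding eq by (simp add: sums_iff)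
  qed
  have HD: "H k \<in> D" for k
  proof (rule lim)
    fix \<epsilon> :: real assume \<epsilon>: "\<epsilon> > 0"
    have P: "(\<lambda>x. \<Sum>i<n. w i * G (i + k) x) \<in> D" for n
    proof (induction n)
      case 0 show ?case using lin[OF hD[of 0] hD[of 0], of 0 0] by simp
    next
      case (Suc n) then show ?case using lin[OF Suc GD, of 1 "w n" "n + k"] by simp
    qed
    have c0: "c \<ge> 0" using hc[of 0] by (meson abs_ge_zero order_trans)
    have "(\<lambda>n. c * (1/2)^n) \<longlonglongrightarrow> c * 0" by (intro tendsto_mult tendsto_const LIMSEQ_power_zero) simp
    then have "\<forall>\<^sub>F n in sequentially. c * (1/2)^n < \<epsilon>" using \<epsilon> by (intro order_tendstoD) auto
    then obtain n where n: "c * (1/2)^n < \<epsilon>" by (auto simp: eventually_sequentially)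
    have "\<bar>(\<Sum>i<n. w i * G (i + k) x) - H k x\<bar> \<le> \<epsilon>" for x
    proof -
      have s: "summable (\<lambda>i. w i * G (i + k) x)" by (rule wsum[OF Gc])
      have "H k x = (\<Sum>i. w (i + n) * G (i + n + k) x) + (\<Sum>i<n. w i * G (i + k) x)"
        unfolding H_def by (rule suminf_split_initial_segment[OF s])
      also have "(\<Sum>i. w (i + n) * G (i + n + k) x) = (\<Sum>i. (1/2)^n * (w i * G (i + n + k) x))"
        by (intro suminf_cong) (simp add: w_def power_add)
      also have "\<dots> = (1/2)^n * (\<Sum>i. w i * G (i + n + k) x)" by (rule suminf_mult[OF wsum[OF Gc]])
      finally have "\<bar>(\<Sum>i<n. w i * G (i + k) x) - H k x\<bar> = (1/2)^n * \<bar>(\<Sum>i. w i * G (i + n + k) x)\<bar>"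
        by (simp add: abs_mult)
      also have "\<dots> \<le> (1/2)^n * c" using wavg[of "\<lambda>i. G (i + n + k) x" 0 c] Gc by (intro mult_left_mono) auto
      finally show ?thesis using n by (simp add: mult.commute)
    qed
    then show "\<exists>g\<in>D. \<forall>x. \<bar>g x - H k x\<bar> \<le> \<epsilon>" by (intro bexI[OF _ P[of n]]) blast
  qed
  have HC: "H k \<in> C k" for k
  proof -
    have "\<bar>H k x\<bar> \<le> c" for x unfolding H_def using wavg[of "\<lambda>i. G (i + k) x" 0 c] Gc by simp
    moreover have "\<bar>H k x - f x\<bar> \<le> r" if "x \<in> F" "\<forall>n\<ge>k. \<bar>h n x - f x\<bar> \<le> r" for x r
    proof -
      have "\<bar>G (i + k) x - f x\<bar> \<le> r" for i
        using GC[of "i + k"] C_mono[of k "i + k"] that by (auto simp: C_def)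
      then show ?thesis unfolding H_def by (rule wavg)
    qed
    ultimately show ?thesis using HD by (simp add: C_def)
  qed
  have H_rec: "H k x = (1/2) * G k x + (1/2) * H (Suc k) x" for k x
  proof -
    have "H k x = (\<Sum>i. w (i + 1) * G (i + 1 + k) x) + (\<Sum>i<1. w i * G (i + k) x)"
      unfolding H_def by (rule suminf_split_initial_segment[OF wsum[OF Gc]])
    also have "(\<Sum>i. w (i + 1) * G (i + 1 + k) x) = (\<Sum>i. (1/2) * (w i * G (i + Suc k) x))"
      by (intro suminf_cong) (simp add: w_def)
    also have "\<dots> = (1/2) * H (Suc k) x" unfolding H_def by (rule suminf_mult[OF wsum[OF Gc]])
    finally show ?thesis by (simp add: w_def)
  qed
  define z where "z = (\<lambda>x. H 0 x - f x)"
  have zZ: "z x = Z k x + (1/2)^k * (H k x - f x)" for k x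
  proof (induction k)
    case 0 show ?case by (simp add: z_def Z0)
  next
    case (Suc k)
    then show ?case by (simp add: ZS step_def H_rec[of k] algebra_simps diff_divide_distrib)
  qed
  have zb: "\<bar>z x\<bar> \<le> c + cf" for x
    unfolding z_def by (rule C_bound[OF HC])
  obtain x0 where x0: "x0 \<in> F" "\<bar>z x0\<bar> > e" using far[OF HD] unfolding z_def by blast
  have Nz: "N z \<ge> e" using le_N[where u=z, OF x0(1) zb] x0(2) by linarith
  \<comment> \<open>The heart of the argument. Stepping towards the competitor \<open>H k\<close>
    leads to the midpoint of \<open>Z k\<close> and \<open>z\<close>, so near-minimality of the
    actual step preserves at least half of the gap, up to the slack.\<close>
  have s: "N z - N (Z k) \<ge> (1/2)^k * (e/2 + e/2 * (1/2)^k)" for k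
  proof (induction k)
    case 0
    have "N (Z 0) \<le> 0" by (rule N_le) (simp add: Z0)
    then show ?case using Nz by simp
  next
    case (Suc k)
    obtain B where B: "\<And>x. \<bar>Z k x\<bar> \<le> B" using Zb by blast
    have N1: "N (Z (Suc k)) \<le> N (step k (Z k) (H k)) + \<delta> k" by (rule Gmin[OF HC])
    have N2: "N (step k (Z k) (H k)) \<le> (N (Z k) + N z) / 2"
    proof (rule N_le)
      fix x assume x: "x \<in> F"
      have "step k (Z k) (H k) x = (Z k x + z x) / 2"
        unfolding step_def zZ[of x k] by (simp add: algebra_simps diff_divide_distrib)
      then show "\<bar>step k (Z k) (H k) x\<bar> \<le> (N (Z k) + N z) / 2"
        using le_N[where u="Z k", OF x B] le_N[where u=z, OF x zb] abs_triangle_ineq[of "Z k x" "z x"]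
        by simp
    qed
    have a: "N z - N (Z (Suc k)) \<ge> (N z - N (Z k)) / 2 - \<delta> k"
      using N1 N2 by (simp add: add_divide_distrib diff_divide_distrib)
    have "(1/4::real)^k = (1/2)^k * (1/2)^k" by (simp flip: power_mult_distrib)
    then have "\<delta> k = e / 8 * ((1/2)^k * (1/2)^k)" by (simp add: \<delta>_def power_divide)
    then show ?case using a Suc by (simp add: algebra_simps) argo
  qed
  have "z \<in> C0" unfolding z_def using HD D by (intro C0_diff f) auto
  then obtain b where b: "b \<in> F" "\<And>x. x \<in> F \<Longrightarrow> \<bar>z x\<bar> \<le> \<bar>z b\<bar>"
    using C0_attains_sup[OF _ F x0(1)] x0(2) e by force
  have Nb: "N z \<le> \<bar>z b\<bar>" by (rule N_le) (rule b(2))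
  \<comment> \<open>At the maximum point \<open>b\<close> all tail functions from some
    \<open>k\<close> on are e/4-close to \<open>f\<close>, hence so is \<open>H k\<close>. This
    bounds the remainder z b - Z k b by 2^-k e/4, below the gap of at least 2^-k e/2.\<close>
  obtain k where k: "\<And>n. n \<ge> k \<Longrightarrow> \<bar>h n b - f b\<bar> < e / 4"
    using LIMSEQ_D[OF conv[OF b(1)], of "e/4"] e by auto
  have "\<bar>H k b - f b\<bar> \<le> e / 4" using HC[of k] b(1) less_imp_le[OF k] unfolding C_def by blast
  then have "(1/2)^k * \<bar>H k b - f b\<bar> \<le> (1/2)^k * (e / 4)" by (intro mult_left_mono) auto
  moreover have "(1/2)^k * \<bar>H k b - f b\<bar> = \<bar>z b - Z k b\<bar>" unfolding zZ[of b k] by (simp add: abs_mult)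
  moreover obtain B where B: "\<And>x. \<bar>Z k x\<bar> \<le> B" using Zb by blast
  moreover have "\<bar>Z k b\<bar> \<le> N (Z k)" by (rule le_N[where u="Z k", OF b(1) B])
  ultimately have "N z - N (Z k) \<le> (1/2)^k * (e / 4)" using Nb by linarith
  moreover have "(1/2)^k * (e/4) < (1/2)^k * (e/2 + e/2 * (1/2)^k)"
    using e by (intro mult_strict_left_mono) (auto intro!: add_strict_increasing)
  ultimately show False using s[of k] by linarith
qed

section \<open>Lower semicontinuous kernels and continuity of potentials\<close>

text \<open>An asymptotic lower bound for \<open>b\<close> becomes an asymptotic upper bound for a =
  s - b, because \<open>s\<close> converges to the sum of the two lower bounds.\<close>

lemma tendsto_of_liminf_sum:
  fixes a b s :: "nat \<Rightarrow> real"
  assumes a: "ennreal A \<le> liminf (\<lambda>n. ennreal (a n))" and b: "ennreal B \<le> liminf (\<lambda>n. ennreal (b n))"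
    and s: "s \<longlonglongrightarrow> A + B" and eq: "\<And>n. a n + b n = s n"
    and nn: "0 \<le> A" "0 \<le> B" "\<And>n. 0 \<le> a n" "\<And>n. 0 \<le> b n"
  shows "a \<longlonglongrightarrow> A"
proof (rule LIMSEQ_I)
  fix r :: real assume r: "r > 0"
  have low: "\<forall>\<^sub>F n in sequentially. C - r/2 < c n"
    if "ennreal C \<le> liminf (\<lambda>n. ennreal (c n))" "0 \<le> C" "\<And>n. 0 \<le> c n" for C and c :: "nat \<Rightarrow> real"
  \<comment> \<open>\<open>ennreal\<close> sends negative numbers to 0, so a strict comparison
    through it needs a nonnegative level.\<close>
  proof (cases "C - r/2 < 0")
    case True
    have "C - r/2 < c n" for n using True that(3)[of n] by linarith
    then show ?thesis by simp
  next
    case False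
    then have "ennreal (C - r/2) < ennreal C" using r by (auto intro!: ennreal_lessI)
    then have "ennreal (C - r/2) < liminf (\<lambda>n. ennreal (c n))" using that(1) by (rule less_le_trans)
    then have "\<forall>\<^sub>F n in sequentially. ennreal (C - r/2) < ennreal (c n)" by (rule less_LiminfD)
    then show ?thesis by eventually_elim (use False in \<open>simp add: ennreal_less_iff\<close>)
  qed
  have "\<forall>\<^sub>F n in sequentially. s n < A + B + r/2" using s r by (intro order_tendstoD) auto
  then have "\<forall>\<^sub>F n in sequentially. norm (a n - A) < r"
    using low[OF a nn(1,3)] low[OF b nn(2,4)]
  proof eventually_elim
    case (elim n) then show ?case using eq[of n] by (auto simp: abs_less_iff)
  qed
  then show "\<exists>no. \<forall>n\<ge>no. norm (a n - A) < r" by (simp add: eventually_sequentially)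
qed

lemma lower_semicont_measurable: "lower_semicont f \<Longrightarrow> f \<in> borel_measurable borel"
  by (rule borel_measurableI_greater) (auto simp: lower_semicont_def)

lemma lower_semicont_section:
  assumes "lower_semicont (\<lambda>(x, y). G x y)"
  shows "lower_semicont (\<lambda>x. G x y)" "lower_semicont (\<lambda>y. G x y)"
proof -
  have "open ((\<lambda>x. (x, y)) -` {z. c < (\<lambda>(x, y). G x y) z})" "open ((\<lambda>y. (x, y)) -` {z. c < (\<lambda>(x, y). G x y) z})" for c
    using assms by (intro open_vimage continuous_intros; simp add: lower_semicont_def)+
  then show "lower_semicont (\<lambda>x. G x y)" "lower_semicont (\<lambda>y. G x y)"
    by (simp_all add: lower_semicont_def vimage_def)
qed

lemma lower_semicont_liminf:
  assumes "lower_semicont f" "X \<longlonglongrightarrow> x"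
  shows "f x \<le> liminf (\<lambda>n. f (X n))"
  unfolding le_Liminf_iff
proof safe
  fix c assume "c < f x"
  moreover have "open {x. c < f x}" using assms(1) by (simp add: lower_semicont_def)
  ultimately show "\<forall>\<^sub>F n in sequentially. c < f (X n)"
    using topological_tendstoD[OF assms(2)] by fastforce
qed

text \<open>Both \<open>G(f \<mu>)\<close> and \<open>G((c - f) \<mu>)\<close> are lower semicontinuous by Fatou's lemma,
  and their sum is continuous.\<close>

lemma lower_semicont_potential_C0:
  fixes G :: "'a::metric_space \<Rightarrow> 'a \<Rightarrow> ennreal" and f :: "'a \<Rightarrow> real"
  assumes G: "lower_semicont (\<lambda>(x, y). G x y)" and \<mu>: "sets \<mu> = sets borel"
    and fin: "\<And>x. (\<integral>\<^sup>+ y. G x y \<partial>\<mu>) < \<infinity>"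
    and C0: "(\<lambda>x. enn2real (\<integral>\<^sup>+ y. G x y \<partial>\<mu>)) \<in> C0"
    and f: "f \<in> borel_measurable borel" "\<And>y. 0 \<le> f y" "\<And>y. f y \<le> c"
  shows "(\<integral>\<^sup>+ y. G x y * ennreal (f y) \<partial>\<mu>) < \<infinity>"
    and "(\<lambda>x. enn2real (\<integral>\<^sup>+ y. G x y * ennreal (f y) \<partial>\<mu>)) \<in> C0"
proof -
  have [measurable]: "f \<in> borel_measurable \<mu>" "G x \<in> borel_measurable \<mu>" for x
    using f(1) lower_semicont_measurable[OF lower_semicont_section(2)[OF G]]
    by (simp_all add: measurable_cong_sets[OF \<mu> refl])
  define V where "V g x = (\<integral>\<^sup>+ y. G x y * ennreal (g y) \<partial>\<mu>)" for g :: "'a \<Rightarrow> real" and x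
  have c0: "0 \<le> c" using f(2,3) order_trans by blast
  have sum: "V f x + V (\<lambda>y. c - f y) x = (\<integral>\<^sup>+ y. G x y \<partial>\<mu>) * ennreal c" for x
  proof -
    have "V f x + V (\<lambda>y. c - f y) x = (\<integral>\<^sup>+ y. G x y * ennreal (f y) + G x y * ennreal (c - f y) \<partial>\<mu>)"
      unfolding V_def by (rule nn_integral_add[symmetric]) auto
    also have "\<dots> = (\<integral>\<^sup>+ y. G x y * ennreal c \<partial>\<mu>)"
      using f(2,3) by (intro nn_integral_cong) (simp add: distrib_left[symmetric] ennreal_plus[symmetric] del: ennreal_plus)
    finally show ?thesis by (simp add: nn_integral_multc)
  qed
  have top: "(\<integral>\<^sup>+ y. G x y \<partial>\<mu>) * ennreal c < \<infinity>" for x using fin[of x] by (simp add: ennreal_mult_less_top)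
  have Vfin: "V f x < \<infinity>" "V (\<lambda>y. c - f y) x < \<infinity>" for x
    using top[of x] unfolding sum[of x, symmetric] by (simp_all add: ennreal_add_less_top)
  then show "(\<integral>\<^sup>+ y. G x y * ennreal (f y) \<partial>\<mu>) < \<infinity>" by (simp add: V_def)
  have sumr: "enn2real (V f x) + enn2real (V (\<lambda>y. c - f y) x) = c * enn2real (\<integral>\<^sup>+ y. G x y \<partial>\<mu>)" for x
  proof -
    have "enn2real (V f x) + enn2real (V (\<lambda>y. c - f y) x) = enn2real (V f x + V (\<lambda>y. c - f y) x)"
      using Vfin[of x] by (intro enn2real_plus[symmetric]) simp_all
    then show ?thesis using c0 by (simp add: sum enn2real_mult)
  qed
  have lsc: "V g x \<le> liminf (\<lambda>n. V g (X n))" if "X \<longlonglongrightarrow> x" "g \<in> borel_measurable \<mu>" for g X x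
  proof -
    note [measurable] = that(2)
    have "V g x \<le> (\<integral>\<^sup>+ y. liminf (\<lambda>n. G (X n) y * ennreal (g y)) \<partial>\<mu>)"
      unfolding V_def
    proof (rule nn_integral_mono)
      fix y
      have "ennreal (g y) * G x y \<le> ennreal (g y) * liminf (\<lambda>n. G (X n) y)"
        by (intro mult_left_mono lower_semicont_liminf[OF lower_semicont_section(1)[OF G]] that) simp
      \<comment> \<open>Multiplication by the finite constant \<open>ennreal (g y)\<close> is
        continuous and monotone, hence commutes with the liminf.\<close>
      also have "\<dots> = liminf (\<lambda>n. ennreal (g y) * G (X n) y)"
        by (rule Liminf_compose_continuous_mono[symmetric])
           (auto intro!: ennreal_continuous_on_cmult continuous_on_id simp: mono_def mult_left_mono)
      finally show "G x y * ennreal (g y) \<le> liminf (\<lambda>n. G (X n) y * ennreal (g y))" by (simp add: mult.commute)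
    qed
    also have "\<dots> \<le> liminf (\<lambda>n. V g (X n))" unfolding V_def by (rule nn_integral_liminf) simp
    finally show ?thesis .
  qed
  have "continuous_on UNIV (\<lambda>x. enn2real (V f x))"
  proof (rule continuous_on_sequentiallyI)
    fix X x assume X: "X \<longlonglongrightarrow> (x::'a)"
    have "continuous (at x) (\<lambda>x. enn2real (\<integral>\<^sup>+ y. G x y \<partial>\<mu>))"
      using C0_continuous[OF C0] by (simp add: continuous_on_eq_continuous_at)
    then have "(\<lambda>n. c * enn2real (\<integral>\<^sup>+ y. G (X n) y \<partial>\<mu>)) \<longlonglongrightarrow> c * enn2real (\<integral>\<^sup>+ y. G x y \<partial>\<mu>)"
      by (intro tendsto_mult tendsto_const isCont_tendsto_compose[OF _ X])
    then show "(\<lambda>n. enn2real (V f (X n))) \<longlonglongrightarrow> enn2real (V f x)"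
      unfolding sumr[symmetric]
      by (rule tendsto_of_liminf_sum[rotated 2])
         (use lsc[OF X] Vfin in \<open>auto simp: ennreal_enn2real_if less_top[symmetric]\<close>)
  qed
  moreover have "\<bar>enn2real (V f x)\<bar> \<le> \<bar>c * enn2real (\<integral>\<^sup>+ y. G x y \<partial>\<mu>)\<bar>" for x
    using sumr[of x] by (smt (verit) enn2real_nonneg)
  ultimately show "(\<lambda>x. enn2real (\<integral>\<^sup>+ y. G x y * ennreal (f y) \<partial>\<mu>)) \<in> C0"
    unfolding V_def[symmetric] by (rule C0_dominated[OF _ C0_scale[OF C0]])
qed

section \<open>Compact exhaustions and integrals of functions in C0\<close>

text \<open>Serves to express decay at infinity by sequences: points \<open>X n\<close> outside
  \<open>K n\<close> eventually leave every compact set. Lindelof's theorem makes a cover by open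
  sets with compact supersets countable, and finite unions of these compacts exhaust the
  space.\<close>

lemma compact_exhaustion:
  assumes "locally_compact_space (euclidean :: 'a::second_countable_topology topology)"
  shows "\<exists>K :: nat \<Rightarrow> 'a set. (\<forall>n. compact (K n)) \<and> (\<forall>C. compact C \<longrightarrow> (\<exists>n. C \<subseteq> K n)) \<and> incseq K"
proof -
  have "\<exists>U K. open U \<and> compact K \<and> x \<in> U \<and> U \<subseteq> K" for x :: 'a
    using assms by (auto simp: locally_compact_space_def)
  then obtain U L where U: "\<And>x. open (U x)" "\<And>x. compact (L x)" "\<And>x. x \<in> U x" "\<And>x::'a. U x \<subseteq> L x"
    by metis
  obtain \<F> where \<F>: "\<F> \<subseteq> range U" "countable \<F>" "\<Union>\<F> = \<Union>(range U)"
    using Lindelof[of "range U"] U(1) by blast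
  then obtain I where I: "countable I" "\<F> = U ` I" by (metis countable_subset_image)
  have ne: "I \<noteq> {}" using \<F>(3) I U(3) by auto
  define K where "K n = (\<Union>i\<le>n. L (from_nat_into I i))" for n :: nat
  have "\<exists>n. C \<subseteq> K n" if C: "compact C" for C
  proof -
    have "C \<subseteq> (\<Union>n. U (from_nat_into I n))"
    proof
      fix x assume "x \<in> C"
      have "x \<in> \<Union>\<F>" using \<F>(3) U(3) by blast
      then obtain i where i: "i \<in> I" "x \<in> U i" using I(2) by blast
      then obtain n where "from_nat_into I n = i" using from_nat_into_surj[OF I(1)] by blast
      then show "x \<in> (\<Union>n. U (from_nat_into I n))" using i by blast
    qed    then obtain D where D: "D \<subseteq> UNIV" "finite D" "C \<subseteq> (\<Union>n\<in>D. U (from_nat_into I n))"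
      by (rule compactE_image[OF C, of UNIV "\<lambda>n. U (from_nat_into I n)", rotated]) (use U(1) in auto)
    have "C \<subseteq> K (Max D)"
    proof
      fix x assume "x \<in> C"
      then obtain n where "n \<in> D" "x \<in> U (from_nat_into I n)" using D(3) by blast
      then show "x \<in> K (Max D)" unfolding K_def using D(2) U(4) by (intro UN_I[of n]) auto
    qed
    then show ?thesis by blast
  qed
  moreover have "compact (K n)" for n unfolding K_def using U(2) by (intro compact_UN) auto
  moreover have "incseq K" unfolding K_def incseq_def by (intro allI impI UN_mono) auto
  ultimately show ?thesis by blast
qed

text \<open>Dominated convergence is used twice: along convergent sequences of points for
  continuity, and along sequences escaping the compact exhaustion for decay at infinity.\<close>

lemma C0_integral:
  fixes h :: "'t \<Rightarrow> 'a::{metric_space, second_countable_topology} \<Rightarrow> real"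
  assumes lc: "locally_compact_space (euclidean :: 'a topology)"
    and h: "\<And>t. t \<in> space M \<Longrightarrow> h t \<in> C0" "\<And>t x. t \<in> space M \<Longrightarrow> \<bar>h t x\<bar> \<le> w t" "integrable M w"
    and meas: "\<And>x. (\<lambda>t. h t x) \<in> borel_measurable M"
  shows "(\<lambda>x. \<integral>t. h t x \<partial>M) \<in> C0"
  unfolding C0_def
proof safe
  have dct: "(\<lambda>n. \<integral>t. h t (X n) \<partial>M) \<longlonglongrightarrow> (\<integral>t. l t \<partial>M)"
    if "\<And>t. t \<in> space M \<Longrightarrow> (\<lambda>n. h t (X n)) \<longlonglongrightarrow> l t" "l \<in> borel_measurable M" for X l
    by (rule integral_dominated_convergence[where w=w]) (use that meas h in auto)
  show "continuous_on UNIV (\<lambda>x. \<integral>t. h t x \<partial>M)"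
  proof (rule continuous_on_sequentiallyI)
    fix X x assume X: "X \<longlonglongrightarrow> (x::'a)"
    have "(\<lambda>n. h t (X n)) \<longlonglongrightarrow> h t x" if "t \<in> space M" for t
    proof (rule isCont_tendsto_compose[OF _ X])
      show "isCont (h t) x" using C0_continuous[OF h(1)[OF that]] by (simp add: continuous_on_eq_continuous_at)
    qed
    then show "(\<lambda>n. \<integral>t. h t (X n) \<partial>M) \<longlonglongrightarrow> (\<integral>t. h t x \<partial>M)" by (rule dct[OF _ meas])
  qed
  fix e :: real assume e: "e > 0"
  obtain K :: "nat \<Rightarrow> 'a set" where K: "\<And>n. compact (K n)" "\<And>C. compact C \<Longrightarrow> \<exists>n. C \<subseteq> K n" "incseq K"
    using compact_exhaustion[OF lc] by blast
  show "\<exists>K. compact K \<and> (\<forall>x. x \<notin> K \<longrightarrow> \<bar>\<integral>t. h t x \<partial>M\<bar> < e)"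
  proof (rule ccontr)
    assume "\<not> ?thesis"
    then have "\<forall>n. \<exists>x. x \<notin> K n \<and> \<bar>\<integral>t. h t x \<partial>M\<bar> \<ge> e" using K(1) by (meson not_le)
    then obtain X where X: "\<And>n. X n \<notin> K n" "\<And>n. \<bar>\<integral>t. h t (X n) \<partial>M\<bar> \<ge> e" by metis
    have "(\<lambda>n. h t (X n)) \<longlonglongrightarrow> 0" if t: "t \<in> space M" for t
    proof (rule LIMSEQ_I)
      fix r :: real assume "r > 0"
      then obtain C where C: "compact C" "\<And>x. x \<notin> C \<Longrightarrow> \<bar>h t x\<bar> < r" using C0_D[OF h(1)[OF t]] by blast
      obtain N where N: "C \<subseteq> K N" using K(2)[OF C(1)] by blast
      have "norm (h t (X n) - 0) < r" if "n \<ge> N" for n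
        using N incseqD[OF K(3) that] X(1)[of n] C(2)[of "X n"] by auto
      then show "\<exists>no. \<forall>n\<ge>no. norm (h t (X n) - 0) < r" by blast
    qed
    then have "(\<lambda>n. \<integral>t. h t (X n) \<partial>M) \<longlonglongrightarrow> (\<integral>t. 0 \<partial>M)" by (rule dct[OF _ borel_measurable_const])
    then have "\<forall>\<^sub>F n in sequentially. \<bar>(\<integral>t. h t (X n) \<partial>M) - 0\<bar> < e"
      using e by (auto simp: tendsto_iff dist_real_def)
    then show False using X(2) by (auto simp: eventually_sequentially not_less[symmetric])
  qed
qed

section \<open>The one-point compactification\<close>

lemma openin_comp_top:
  fixes W :: "'a::metric_space option set"
  shows "openin comp_top W \<longleftrightarrow> (\<exists>U. open U \<and> W = Some ` U) \<or> (\<exists>K. compact K \<and> W = UNIV - Some ` K)"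
proof -
  have "- Some ` K = insert None (Some ` (- K))" for K :: "'a set"
    by (auto simp: image_iff) (metis ComplI option.exhaust)
  then show ?thesis
    by (auto simp: comp_top_def openin_Alexandroff_compactification Compl_eq_Diff_UNIV compact_imp_closed)
qed

lemma topspace_comp_top: "topspace comp_top = UNIV"
  by (auto simp: comp_top_def image_iff notin_range_Some)

lemma space_comp_borel [simp]: "space comp_borel = UNIV"
  by (simp add: comp_borel_def)

text \<open>Neighbourhoods of the cemetery add nothing to the generator: complements of compact sets
  arise from images of open sets by difference and complement.\<close>

lemma sets_comp_borel:
  "sets (comp_borel :: 'a::metric_space option measure) = sigma_sets UNIV {Some ` U | U. open U}"
proof -
  let ?S = "sigma_sets UNIV {Some ` U | U. open (U :: 'a set)}"
  have "sigma_sets UNIV {U. openin comp_top U} = ?S"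
  proof (rule sigma_sets_eqI)
    fix W :: "'a option set" assume "W \<in> {U. openin comp_top U}"
    then consider U where "open U" "W = Some ` U" | K where "compact K" "W = UNIV - Some ` K"
      by (auto simp: openin_comp_top)
    then show "W \<in> ?S"
    proof cases
      case 2
      interpret sigma_algebra UNIV ?S by (rule sigma_algebra_sigma_sets) auto
      have "Some ` UNIV - Some ` (- K) \<in> ?S"
        using compact_imp_closed[OF 2(1)] by (intro Diff sigma_sets.Basic) (auto simp: closed_def)
      also have "Some ` UNIV - Some ` (- K) = Some ` K" by auto
      finally show ?thesis using 2 compl_sets by auto
    qed auto
  qed (auto simp: openin_comp_top)
  then show ?thesis by (simp add: comp_borel_def)
qed

lemma Some_measurable [measurable]: "Some \<in> borel \<rightarrow>\<^sub>M (comp_borel :: 'a::metric_space option measure)"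
proof (rule measurable_sigma_sets[OF sets_comp_borel])
  show "Some -` A \<inter> space borel \<in> sets borel" if "A \<in> {Some ` U | U. open (U :: 'a set)}" for A
    using that by (auto simp: inj_vimage_image_eq)
qed auto

lemma Some_image_sets [intro]:
  assumes "B \<in> sets (borel :: 'a::metric_space measure)"
  shows "Some ` B \<in> sets comp_borel"
  using assms unfolding sets_borel
proof (induction B rule: sigma_sets.induct)
  case (Compl B)
  have "Some ` (UNIV :: 'a set) \<in> sets comp_borel" unfolding sets_comp_borel by blast
  then have "Some ` UNIV - Some ` B \<in> sets comp_borel" using Compl by blast
  moreover have "Some ` UNIV - Some ` B = Some ` (UNIV - B)" by auto
  ultimately show ?case by simp
next
  case (Union B)
  then have "(\<Union>i. Some ` B i) \<in> sets comp_borel" by blast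
  then show ?case by (simp add: image_UN)
qed (auto simp: sets_comp_borel)

lemma None_sets [measurable, intro]: "{None :: 'a::metric_space option} \<in> sets comp_borel"
proof -
  have "UNIV - Some ` (UNIV :: 'a set) = {None}" by (auto simp: image_iff)
  moreover have "UNIV - Some ` (UNIV :: 'a set) \<in> sets comp_borel"
    using sets.compl_sets[OF Some_image_sets[of "UNIV :: 'a set"]] by simp
  ultimately show ?thesis by simp
qed

lemma ext0_simps [simp]: "ext0 u None = 0" "ext0 u (Some x) = u x"
  by (simp_all add: ext0_def)

lemma ext0_measurable [measurable (raw)]:
  fixes f :: "'a::metric_space \<Rightarrow> 'b::{zero, topological_space}"
  assumes f: "f \<in> borel_measurable borel"
  shows "ext0 f \<in> borel_measurable comp_borel"
proof (rule measurableI)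
  fix S :: "'b set" assume S: "S \<in> sets borel"
  have "ext0 f -` S = Some ` (f -` S) \<union> (if 0 \<in> S then {None} else {})"
  proof (intro set_eqI)
    show "z \<in> ext0 f -` S \<longleftrightarrow> z \<in> Some ` (f -` S) \<union> (if 0 \<in> S then {None} else {})" for z
      by (cases z) auto
  qed
  moreover have "Some ` (f -` S) \<in> sets comp_borel"
    using measurable_sets[OF f S] by auto
  ultimately show "ext0 f -` S \<inter> space comp_borel \<in> sets comp_borel" by (simp add: Un_insert_right None_sets sets.Un split: if_splits)
qed simp

text \<open>Extension by zero makes a function in \<open>C0\<close> continuous on the whole
  compactification. At the cemetery this is decay at infinity: if 0 lies in \<open>S\<close>, the
  complement of the preimage of \<open>S\<close> is a closed subset of a compact set.\<close>

lemma ext0_tendsto: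
  fixes f :: "'a::metric_space \<Rightarrow> real"
  assumes f: "f \<in> C0" and lim: "limitin comp_top g l F"
  shows "((\<lambda>x. ext0 f (g x)) \<longlongrightarrow> ext0 f l) F"
proof (rule topological_tendstoI)
  fix S :: "real set" assume S: "open S" "ext0 f l \<in> S"
  have oS: "open (f -` S)" using C0_continuous[OF f] S(1) by (simp add: open_vimage)
  have "openin comp_top (ext0 f -` S)"
  proof (cases "0 \<in> S")
    case False
    have "ext0 f -` S = Some ` (f -` S)"
      by (intro set_eqI; case_tac x) (use False in auto)
    then show ?thesis using oS by (auto simp: openin_comp_top)
  next
    case True
    then obtain e where e: "e > 0" "\<And>y. \<bar>y\<bar> < e \<Longrightarrow> y \<in> S"
      using S(1) by (auto simp: open_dist dist_real_def)
    obtain K where K: "compact K" "\<And>x. x \<notin> K \<Longrightarrow> \<bar>f x\<bar> < e" using C0_D[OF f e(1)] by blast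
    have "- (f -` S) \<subseteq> K" using K(2) e(2) by blast
    then have "- (f -` S) = K \<inter> - (f -` S)" by blast
    then have "compact (- (f -` S))" using compact_Int_closed[OF K(1) closed_Compl[OF oS]] by simp
    moreover have "ext0 f -` S = UNIV - Some ` (- (f -` S))"
      by (intro set_eqI; case_tac x) (use True in auto)
    ultimately show ?thesis by (auto simp: openin_comp_top)
  qed
  then have "\<forall>\<^sub>F x in F. g x \<in> ext0 f -` S" using lim S(2) by (auto simp: limitin_def)
  then show "\<forall>\<^sub>F x in F. ext0 f (g x) \<in> S" by eventually_elim simp
qed

text \<open>Each point of \<open>U\<close> has a ball inside \<open>U\<close> whose closed version
  is compact; it is the positivity set of a tent function, and Lindelof's theorem leaves countably
  many tents.\<close>

lemma open_eq_Union_C0: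
  fixes U :: "'a::{metric_space, second_countable_topology} set"
  assumes lc: "locally_compact_space (euclidean :: 'a topology)" and U: "open U"
  shows "\<exists>f :: nat \<Rightarrow> 'a \<Rightarrow> real. (\<forall>n. f n \<in> C0) \<and> U = (\<Union>n. {x. 0 < f n x})"
proof -
  have "\<exists>r>0. ball x r \<subseteq> U \<and> compact (cball x r)" if x: "x \<in> U" for x
  proof -
    obtain V K where "open V" "compact K" "x \<in> V" "V \<subseteq> K"
      using lc by (simp add: locally_compact_space_def) blast
    moreover obtain r where "r > 0" "cball x r \<subseteq> U \<inter> V"
      using open_contains_cball[of "U \<inter> V"] open_Int[OF U \<open>open V\<close>] \<open>x \<in> V\<close> x by blast
    moreover have "compact (cball x r)"
    proof -
      have "cball x r = K \<inter> cball x r" using calculation by blast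
      then show ?thesis using compact_Int_closed[OF \<open>compact K\<close>, of "cball x r"] by simp
    qed
    ultimately show ?thesis using ball_subset_cball by blast
  qed
  then obtain r where r: "\<And>x. x \<in> U \<Longrightarrow> r x > 0" "\<And>x. x \<in> U \<Longrightarrow> ball x (r x) \<subseteq> U"
      "\<And>x. x \<in> U \<Longrightarrow> compact (cball x (r x))" by metis
  define \<phi> where "\<phi> c x = max 0 (r c - dist c x)" for c x
  have \<phi>: "\<phi> c \<in> C0" if "c \<in> U" for c
    unfolding C0_def \<phi>_def using r(3)[OF that]
    by (auto intro!: continuous_intros exI[of _ "cball c (r c)"])
  obtain \<F> where \<F>: "\<F> \<subseteq> (\<lambda>x. ball x (r x)) ` U" "countable \<F>" "\<Union>\<F> = \<Union>((\<lambda>x. ball x (r x)) ` U)"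
    by (rule Lindelof[of "(\<lambda>x. ball x (r x)) ` U"]) auto
  then obtain I where I: "I \<subseteq> U" "countable I" "\<F> = (\<lambda>x. ball x (r x)) ` I" using countable_subset_image[of \<F> "\<lambda>x. ball x (r x)" U] by auto
  have UU: "U = (\<Union>c\<in>I. {x. 0 < \<phi> c x})"
  proof -
    have "U = \<Union>((\<lambda>x. ball x (r x)) ` U)" using r(1,2) by (fastforce intro: centre_in_ball[THEN iffD2])
    also have "\<dots> = (\<Union>c\<in>I. ball c (r c))" using \<F>(3) I(3) by simp
    also have "\<dots> = (\<Union>c\<in>I. {x. 0 < \<phi> c x})" by (auto simp: \<phi>_def)
    finally show ?thesis .
  qed
  show ?thesis
  proof (cases "I = {}")
    case True
    then show ?thesis using UU C0_zero by (intro exI[of _ "\<lambda>n x. 0"]) auto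
  next
    case False
    have "U = (\<Union>c\<in>range (from_nat_into I). {x. 0 < \<phi> c x})"
      using UU range_from_nat_into[OF False I(2)] by simp
    then have "U = (\<Union>n. {x. 0 < \<phi> (from_nat_into I n) x})" by simp
    moreover have "\<phi> (from_nat_into I n) \<in> C0" for n
      using \<phi> I(1) from_nat_into[OF False] by blast
    ultimately show ?thesis by (intro exI[of _ "\<lambda>n. \<phi> (from_nat_into I n)"]) auto
  qed
qed

text \<open>Reduces measurability into the compactification to real functions, for which limits
  along right-continuous paths are available.\<close>

lemma measurable_comp_borelI:
  fixes W :: "'w \<Rightarrow> 'a::{metric_space, second_countable_topology} option"
  assumes lc: "locally_compact_space (euclidean :: 'a topology)"
    and W: "\<And>f :: 'a \<Rightarrow> real. f \<in> C0 \<Longrightarrow> (\<lambda>\<omega>. ext0 f (W \<omega>)) \<in> borel_measurable M"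
  shows "W \<in> M \<rightarrow>\<^sub>M comp_borel"
proof (rule measurable_sigma_sets[OF sets_comp_borel])
  fix S assume "S \<in> {Some ` U | U. open (U :: 'a set)}"
  then obtain U :: "'a set" where U: "open U" "S = Some ` U" by blast
  obtain f :: "nat \<Rightarrow> 'a \<Rightarrow> real" where f: "\<And>n. f n \<in> C0" "U = (\<Union>n. {x. 0 < f n x})"
    using open_eq_Union_C0[OF lc U(1)] by blast
  have "z \<in> Some ` U \<longleftrightarrow> (\<exists>n. 0 < ext0 (f n) z)" for z using f(2) by (cases z) auto
  then have "W -` S \<inter> space M = (\<Union>n. {\<omega> \<in> space M. 0 < ext0 (f n) (W \<omega>)})" using U(2) by auto
  also have "\<dots> \<in> sets M"
  proof -
    have [measurable]: "(\<lambda>\<omega>. ext0 (f n) (W \<omega>)) \<in> borel_measurable M" for n by (rule W[OF f(1)])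
    show ?thesis by measurable
  qed
  finally show "W -` S \<inter> space M \<in> sets M" .
qed auto

section \<open>The strong Markov property on path space\<close>

text \<open>The times in a cylinder are increments, so that the Markov property applies at its head.\<close>

primrec cyl_hits :: "('w, 'a) process \<Rightarrow> (ennreal \<times> 'a option set) list \<Rightarrow> ennreal \<Rightarrow> 'w \<Rightarrow> bool" where
  "cyl_hits X [] r \<omega> = True"
| "cyl_hits X (c # cs) r \<omega> = (Pos X (r + fst c) \<omega> \<in> snd c \<and> cyl_hits X cs (r + fst c) \<omega>)"

text \<open>Nested one-step transitions: the probability which the Markov property assigns to the
  cylinder for a given starting point.\<close>

primrec cyl_prob :: "('w, 'a) process \<Rightarrow> (ennreal \<times> 'a option set) list \<Rightarrow> 'a option \<Rightarrow> ennreal" where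
  "cyl_prob X [] z = 1"
| "cyl_prob X (c # cs) z =
     (\<integral>\<^sup>+ \<omega>. indicator (snd c) (Pos X (fst c) \<omega>) * cyl_prob X cs (Pos X (fst c) \<omega>) \<partial>Law X z)"

definition cyl_measurable :: "(ennreal \<times> 'a::topological_space option set) list \<Rightarrow> bool" where
  "cyl_measurable cs \<longleftrightarrow> (\<forall>c\<in>set cs. snd c \<in> sets comp_borel)"

locale std_process =
  fixes X :: "('w, 'a::{metric_space, second_countable_topology}) process"
  assumes lc: "locally_compact_space (euclidean :: 'a topology)"
    and std: "standard_process X"
begin

lemma markov: "markov_process X" and strong: "strong_markov X" and qlc: "quasi_left_continuous X"
  and aug_le_Filt: "sets (aug_filt X t) \<subseteq> sets (Filt X t)"
  and Filt_right: "t < \<infinity> \<Longrightarrow> sets (Filt X t) = (\<Inter>s\<in>{t<..}. sets (Filt X s))"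
proof -
  note s = std[unfolded standard_process_def]
  show "markov_process X" using s by (rule conjunct1)
  show "sets (aug_filt X t) \<subseteq> sets (Filt X t)"
    using s[THEN conjunct2, THEN conjunct1] by (rule spec)
  show "t < \<infinity> \<Longrightarrow> sets (Filt X t) = (\<Inter>s\<in>{t<..}. sets (Filt X s))"
    using s[THEN conjunct2, THEN conjunct2, THEN conjunct1] by simp
  show "strong_markov X" using s[THEN conjunct2, THEN conjunct2, THEN conjunct2] by (rule conjunct1)
  show "quasi_left_continuous X"
    using s[THEN conjunct2, THEN conjunct2, THEN conjunct2, THEN conjunct2, THEN conjunct2] .
qed

lemma right_cont_AE:
  "AE \<omega> in Law X z. \<forall>t<\<infinity>. limitin comp_top (\<lambda>s. Pos X s \<omega>) (Pos X t \<omega>) (at_right t)"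
proof -
  have "AE \<omega> in Law X z.
        (\<forall>t<\<infinity>. limitin comp_top (\<lambda>s. Pos X s \<omega>) (Pos X t \<omega>) (at_right t)) \<and>
        (\<forall>t. 0 < t \<and> t < lifetime X \<omega> \<longrightarrow> (\<exists>l. limitin comp_top (\<lambda>s. Pos X s \<omega>) l (at_left t)))"
    using std[unfolded standard_process_def, THEN conjunct2, THEN conjunct2, THEN conjunct2, THEN conjunct2, THEN conjunct1]
    by (rule spec)
  then show ?thesis by eventually_elim blast
qed

lemma prob_space_Law: "prob_space (Law X z)"
  and space_Law: "space (Law X z) = Path X"
  and sets_Law: "sets (Law X z) = sets (Law X None)"
  and filt: "filtration (Path X) (Filt X)"
  and Filt_le_Law: "sets (Filt X t) \<subseteq> sets (Law X z)"
  and Pos_Filt: "Pos X t \<in> Filt X t \<rightarrow>\<^sub>M comp_borel"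
  and Pos_infinity: "\<omega> \<in> Path X \<Longrightarrow> Pos X \<infinity> \<omega> = None"
  and Pos_absorb: "\<omega> \<in> Path X \<Longrightarrow> s \<le> t \<Longrightarrow> Pos X s \<omega> = None \<Longrightarrow> Pos X t \<omega> = None"
  and Shift_Path: "\<omega> \<in> Path X \<Longrightarrow> Shift X s \<omega> \<in> Path X"
  and Pos_Shift: "\<omega> \<in> Path X \<Longrightarrow> Pos X t (Shift X s \<omega>) = Pos X (s + t) \<omega>"
  and Pos_0_AE: "AE \<omega> in Law X z. Pos X 0 \<omega> = z"
  and Pos_emeasure_measurable: "B \<in> sets comp_borel \<Longrightarrow>
        (\<lambda>z. emeasure (Law X z) {\<omega>\<in>Path X. Pos X t \<omega> \<in> B}) \<in> borel_measurable comp_borel"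
proof -
  note m0 = markov[unfolded markov_process_def]
  note m1 = m0[THEN conjunct2] note m2 = m1[THEN conjunct2] note m3 = m2[THEN conjunct2]
  note m4 = m3[THEN conjunct2] note m5 = m4[THEN conjunct2] note m6 = m5[THEN conjunct2]
  note m7 = m6[THEN conjunct2] note m8 = m7[THEN conjunct2]
  show "prob_space (Law X z)" "space (Law X z) = Path X" using m0[THEN conjunct1] by simp_all
  show L: "sets (Law X z) = sets (Law X None)" using m0[THEN conjunct1] by simp
  show "filtration (Path X) (Filt X)" by (rule m1[THEN conjunct1])
  show "sets (Filt X t) \<subseteq> sets (Law X z)" unfolding L by (rule m2[THEN conjunct1, rule_format])
  show "Pos X t \<in> Filt X t \<rightarrow>\<^sub>M comp_borel" by (rule m3[THEN conjunct1, rule_format])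
  show "\<omega> \<in> Path X \<Longrightarrow> Pos X \<infinity> \<omega> = None" by (rule m4[THEN conjunct1, rule_format])
  show "\<omega> \<in> Path X \<Longrightarrow> s \<le> t \<Longrightarrow> Pos X s \<omega> = None \<Longrightarrow> Pos X t \<omega> = None"
    using m5[THEN conjunct1, rule_format, of \<omega> s t] by simp
  show "\<omega> \<in> Path X \<Longrightarrow> Shift X s \<omega> \<in> Path X" "\<omega> \<in> Path X \<Longrightarrow> Pos X t (Shift X s \<omega>) = Pos X (s + t) \<omega>"
    using m6[THEN conjunct1] by simp_all
  show "AE \<omega> in Law X z. Pos X 0 \<omega> = z" by (rule m7[THEN conjunct1, rule_format])
  show "B \<in> sets comp_borel \<Longrightarrow>
        (\<lambda>z. emeasure (Law X z) {\<omega>\<in>Path X. Pos X t \<omega> \<in> B}) \<in> borel_measurable comp_borel"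
    by (rule m8[THEN conjunct1, rule_format])
qed

sublocale filtration "Path X" "Filt X" by (rule filt)

lemma Pos_Law [measurable]: "Pos X t \<in> Law X z \<rightarrow>\<^sub>M comp_borel"
  using Pos_Filt[of t] Filt_le_Law[of t z] by (auto simp: measurable_def space_F space_Law)

lemma space_natural: "space (natural_filt X t) = Path X"
  by (simp add: natural_filt_def space_measure_of_conv)

lemma sets_natural:
  "sets (natural_filt X t) = sigma_sets (Path X) {Pos X s -` B \<inter> Path X | s B. s \<le> t \<and> B \<in> sets comp_borel}"
  unfolding natural_filt_def by (rule sets_measure_of) auto

lemma space_aug: "space (aug_filt X t) = Path X"
  by (simp add: aug_filt_def space_measure_of_conv)

lemma sets_aug:
  "sets (aug_filt X t) = sigma_sets (Path X) {A. A \<subseteq> Path X \<and> (\<forall>\<nu>. initial_law \<nu> \<longrightarrow>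
        (\<exists>B\<in>sets (natural_filt X t). null_from X \<nu> ((A - B) \<union> (B - A))))}"
  unfolding aug_filt_def by (rule sets_measure_of) auto

lemma natural_le_Law: "sets (natural_filt X t) \<subseteq> sets (Law X z)"
  unfolding sets_natural
proof (rule sets.sigma_sets_subset'[of _ "Law X z", unfolded space_Law])
  show "{Pos X s -` B \<inter> Path X | s B. s \<le> t \<and> B \<in> sets comp_borel} \<subseteq> sets (Law X z)"
    using measurable_sets[OF Pos_Law] by (auto simp: space_Law)
  show "Path X \<in> sets (Law X z)" using sets.top[of "Law X z"] by (simp add: space_Law)
qed

lemma aug_le_Law: "sets (aug_filt X t) \<subseteq> sets (Law X z)"
  using aug_le_Filt Filt_le_Law by blast

lemma measurable_aug_Law: "f \<in> aug_filt X t \<rightarrow>\<^sub>M N \<Longrightarrow> f \<in> Law X z \<rightarrow>\<^sub>M N"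
  using aug_le_Law[of t z] by (auto simp: measurable_def space_aug space_Law)

lemma measurable_natural_Law: "f \<in> natural_filt X t \<rightarrow>\<^sub>M N \<Longrightarrow> f \<in> Law X z \<rightarrow>\<^sub>M N"
  using natural_le_Law[of t z] by (auto simp: measurable_def space_natural space_Law)

lemma Pos_natural: "s \<le> t \<Longrightarrow> Pos X s \<in> natural_filt X t \<rightarrow>\<^sub>M comp_borel"
  by (auto simp: measurable_def space_natural sets_natural intro!: sigma_sets.Basic)

lemma natural_le_aug: "sets (natural_filt X t) \<subseteq> sets (aug_filt X t)"
proof
  fix A assume A: "A \<in> sets (natural_filt X t)"
  have "null_from X \<nu> ((A - A) \<union> (A - A))" for \<nu>
    unfolding null_from_def by (intro bexI[of _ "{}"]) auto
  then have "\<exists>B\<in>sets (natural_filt X t). null_from X \<nu> ((A - B) \<union> (B - A))" for \<nu> using A by blast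
  then show "A \<in> sets (aug_filt X t)" unfolding sets_aug
    using A sets.sets_into_space[OF A] by (intro sigma_sets.Basic) (auto simp: space_natural)
qed

lemma Pos_aug: "s \<le> t \<Longrightarrow> Pos X s \<in> aug_filt X t \<rightarrow>\<^sub>M comp_borel"
  using Pos_natural[of s t] natural_le_aug[of t] by (auto simp: measurable_def space_aug space_natural)

lemma kernel_measurable: "(\<lambda>z. distr (Law X z) comp_borel (Pos X t)) \<in> comp_borel \<rightarrow>\<^sub>M subprob_algebra comp_borel"
proof (rule measurable_subprob_algebra)
  fix z show "subprob_space (distr (Law X z) comp_borel (Pos X t))"
    by (intro prob_space_imp_subprob_space prob_space.prob_space_distr prob_space_Law Pos_Law)
next
  fix B :: "'a option set" assume B: "B \<in> sets comp_borel"
  show "(\<lambda>z. emeasure (distr (Law X z) comp_borel (Pos X t)) B) \<in> borel_measurable comp_borel"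
    using Pos_emeasure_measurable[OF B, of t] B
    by (simp add: emeasure_distr[OF Pos_Law B] space_Law vimage_def Int_def conj_commute)
qed simp

lemma semigroup_measurable:
  assumes "f \<in> borel_measurable comp_borel"
  shows "(\<lambda>z. \<integral>\<^sup>+ \<omega>. f (Pos X t \<omega>) \<partial>Law X z) \<in> borel_measurable comp_borel"
proof -
  have "(\<lambda>z. \<integral>\<^sup>+ y. f y \<partial>distr (Law X z) comp_borel (Pos X t)) \<in> borel_measurable comp_borel"
    using kernel_measurable nn_integral_measurable_subprob_algebra[OF assms] by (rule measurable_compose)
  moreover have "(\<integral>\<^sup>+ y. f y \<partial>distr (Law X z) comp_borel (Pos X t)) = (\<integral>\<^sup>+ \<omega>. f (Pos X t \<omega>) \<partial>Law X z)" for z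
    by (rule nn_integral_distr[OF Pos_Law]) (simp add: assms)
  ultimately show ?thesis by simp
qed

lemma pre_sigma_le_Law:
  assumes "stopping_time (Filt X) T" "A \<in> sets (pre_sigma T)"
  shows "A \<in> sets (Law X z)"
  using sets_pre_sigmaD[OF assms, of top] Filt_le_Law[of top z] by auto

lemma Pos_stopping_pre_sigma:
  assumes "stopping_time (Filt X) T"
  shows "(\<lambda>\<omega>. Pos X (T \<omega>) \<omega>) \<in> pre_sigma T \<rightarrow>\<^sub>M comp_borel"
  using strong[unfolded strong_markov_def, THEN spec, THEN mp, OF assms] by (rule conjunct1)

lemma Pos_stopping_Law:
  assumes "stopping_time (Filt X) T"
  shows "(\<lambda>\<omega>. Pos X (T \<omega>) \<omega>) \<in> Law X z \<rightarrow>\<^sub>M comp_borel"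
proof (rule measurableI)
  fix B :: "'a option set" assume B: "B \<in> sets comp_borel"
  show "(\<lambda>\<omega>. Pos X (T \<omega>) \<omega>) -` B \<inter> space (Law X z) \<in> sets (Law X z)"
    using pre_sigma_le_Law[OF assms measurable_sets[OF Pos_stopping_pre_sigma[OF assms] B], of z]
    by (simp add: space_pre_sigma space_Law)
qed simp

lemma stopping_time_add_const:
  assumes T: "stopping_time (Filt X) T"
  shows "stopping_time (Filt X) (\<lambda>\<omega>. T \<omega> + t)"
proof
  fix s show "Measurable.pred (Filt X s) (\<lambda>\<omega>. T \<omega> + t \<le> s)"
  proof (cases "t \<le> s \<and> t \<noteq> top")
    case True
    then have "T \<omega> + t \<le> s \<longleftrightarrow> T \<omega> \<le> s - t" for \<omega> by (auto simp: ennreal_le_minus_iff)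
    moreover have "Measurable.pred (Filt X s) (\<lambda>\<omega>. T \<omega> \<le> s - t)"
      by (rule stopping_time_le_const[OF T]) (simp add: diff_le_self_ennreal)
    ultimately show ?thesis by simp
  next
    case False
    have "t \<le> T \<omega> + t" for \<omega> by simp
    then have "T \<omega> + t \<le> s \<longleftrightarrow> t = top \<and> s = top" for \<omega>
      using False order_trans[of t "T \<omega> + t" s] by (auto simp: top_unique)
    then show ?thesis by simp
  qed
qed

text \<open>The definition speaks of single sets \<open>B\<close>. It thereby equates two measures,
  the law of the position at T + t and the law of the position at T followed by the transition
  kernel, and this extends to nonnegative Borel functions.\<close>

lemma strong_markov_fun:
  assumes T: "stopping_time (Filt X) T" and A: "A \<in> sets (pre_sigma T)"
    and f: "f \<in> borel_measurable comp_borel"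
  shows "(\<integral>\<^sup>+ \<omega>\<in>A. f (Pos X (T \<omega> + t) \<omega>) \<partial>Law X z)
       = (\<integral>\<^sup>+ \<omega>\<in>A. (\<integral>\<^sup>+ \<omega>'. f (Pos X t \<omega>') \<partial>Law X (Pos X (T \<omega>) \<omega>)) \<partial>Law X z)"
proof -
  have AL [measurable]: "A \<in> sets (Law X z)" by (rule pre_sigma_le_Law[OF T A])
  have [measurable]: "(\<lambda>\<omega>. Pos X (T \<omega>) \<omega>) \<in> Law X z \<rightarrow>\<^sub>M comp_borel"
      "(\<lambda>\<omega>. Pos X (T \<omega> + t) \<omega>) \<in> Law X z \<rightarrow>\<^sub>M comp_borel"
    using Pos_stopping_Law[OF T] Pos_stopping_Law[OF stopping_time_add_const[OF T]] by auto
  note [measurable] = f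
  \<comment> \<open>Weighting the law by the indicator of \<open>A\<close> turns both sides into
    integrals over the whole path space.\<close>
  define D where "D = density (Law X z) (indicator A)"
  have D [measurable_cong]: "sets D = sets (Law X z)" by (simp add: D_def)
  let ?K = "\<lambda>z. distr (Law X z) comp_borel (Pos X t)"
  note [measurable] = kernel_measurable[of t]
  have eq: "distr D comp_borel (\<lambda>\<omega>. Pos X (T \<omega> + t) \<omega>)
      = distr D comp_borel (\<lambda>\<omega>. Pos X (T \<omega>) \<omega>) \<bind> ?K" (is "?L = ?R")
  proof (rule measure_eqI)
    show "sets ?L = sets ?R" by simp
    fix B assume "B \<in> sets ?L"
    then have B [measurable]: "B \<in> sets comp_borel" by simp
    have "emeasure ?L B = emeasure D {\<omega>\<in>Path X. Pos X (T \<omega> + t) \<omega> \<in> B}"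
      by (subst emeasure_distr) (auto simp: D_def space_Law intro!: arg_cong2[where f=emeasure])
    also have "\<dots> = emeasure (Law X z) {\<omega>\<in>A. Pos X (T \<omega> + t) \<omega> \<in> B}"
    proof -
      have m: "{\<omega>\<in>Path X. Pos X (T \<omega> + t) \<omega> \<in> B} \<in> sets (Law X z)"
        unfolding space_Law[of z, symmetric] by measurable
      have "{\<omega>\<in>A. Pos X (T \<omega> + t) \<omega> \<in> B} = A \<inter> {\<omega>\<in>Path X. Pos X (T \<omega> + t) \<omega> \<in> B}"
        using sets.sets_into_space[OF AL] by (auto simp: space_Law)
      then show ?thesis unfolding D_def using m AL
        by (simp add: emeasure_density indicator_inter_arith[symmetric] sets.Int)
    qed
    also have "\<dots> = (\<integral>\<^sup>+ \<omega>\<in>A. emeasure (Law X (Pos X (T \<omega>) \<omega>)) {\<omega>'\<in>Path X. Pos X t \<omega>' \<in> B} \<partial>Law X z)"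
      using strong[unfolded strong_markov_def, THEN spec, THEN mp, OF T, THEN conjunct2] A B by simp
    also have "\<dots> = (\<integral>\<^sup>+ \<omega>\<in>A. emeasure (?K (Pos X (T \<omega>) \<omega>)) B \<partial>Law X z)"
    proof -
      have "emeasure (?K y) B = emeasure (Law X y) {\<omega>'\<in>Path X. Pos X t \<omega>' \<in> B}" for y
        unfolding emeasure_distr[OF Pos_Law B] space_Law by (rule arg_cong2[where f=emeasure]) auto
      then show ?thesis by simp
    qed
    also have "\<dots> = (\<integral>\<^sup>+ \<omega>. emeasure (?K (Pos X (T \<omega>) \<omega>)) B \<partial>D)"
      unfolding D_def
      by (subst nn_integral_density) (auto simp: mult.commute
        intro!: measurable_compose[OF _ measurable_compose[OF kernel_measurable measurable_emeasure_subprob_algebra]])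
    also have "\<dots> = emeasure ?R B"
      by (subst emeasure_bind[where N=comp_borel]) (auto simp: nn_integral_distr)
    finally show "emeasure ?L B = emeasure ?R B" .
  qed
  have "(\<integral>\<^sup>+ \<omega>\<in>A. f (Pos X (T \<omega> + t) \<omega>) \<partial>Law X z) = (\<integral>\<^sup>+ \<omega>. f (Pos X (T \<omega> + t) \<omega>) \<partial>D)"
    unfolding D_def by (subst nn_integral_density) (auto simp: mult.commute)
  also have "\<dots> = (\<integral>\<^sup>+ y. f y \<partial>?L)" by (simp add: nn_integral_distr)
  also have "\<dots> = (\<integral>\<^sup>+ y. \<integral>\<^sup>+ y'. f y' \<partial>?K y \<partial>distr D comp_borel (\<lambda>\<omega>. Pos X (T \<omega>) \<omega>))"
    unfolding eq by (rule nn_integral_bind[OF f]) (simp add: kernel_measurable)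
  also have "\<dots> = (\<integral>\<^sup>+ \<omega>. (\<integral>\<^sup>+ y'. f y' \<partial>?K (Pos X (T \<omega>) \<omega>)) \<partial>D)"
    by (rule nn_integral_distr) (auto intro!: measurable_compose[OF kernel_measurable nn_integral_measurable_subprob_algebra])
  also have "\<dots> = (\<integral>\<^sup>+ \<omega>\<in>A. (\<integral>\<^sup>+ \<omega>'. f (Pos X t \<omega>') \<partial>Law X (Pos X (T \<omega>) \<omega>)) \<partial>Law X z)"
    unfolding D_def
    by (subst nn_integral_density)
       (auto simp: nn_integral_distr mult.commute
             intro!: measurable_compose[OF _ semigroup_measurable] nn_integral_cong)
  finally show ?thesis .
qed

lemma cyl_prob_measurable: "cyl_measurable cs \<Longrightarrow> cyl_prob X cs \<in> borel_measurable comp_borel"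
proof (induction cs)
  case Nil
  have "cyl_prob X [] = (\<lambda>z. 1)" by (rule ext) simp
  then show ?case by simp
next
  case (Cons c cs)
  then have c [measurable]: "snd c \<in> sets comp_borel" "cyl_prob X cs \<in> borel_measurable comp_borel"
    by (auto simp: cyl_measurable_def)
  have "(\<lambda>y. indicator (snd c) y * cyl_prob X cs y) \<in> borel_measurable comp_borel" by measurable
  from semigroup_measurable[OF this, where t="fst c"] show ?case by simp
qed

text \<open>Induction along the cylinder. The event that its head is hit belongs to the
  sigma-algebra of the later time \<open>T\<close> plus the first increment, so it is absorbed into
  \<open>A\<close> before the induction hypothesis is applied there; hence the generality in
  \<open>T\<close> and \<open>A\<close>.\<close>

lemma strong_markov_cyl:
  assumes "stopping_time (Filt X) T" "A \<in> sets (pre_sigma T)" "cyl_measurable cs"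
  shows "{\<omega>\<in>A. cyl_hits X cs (T \<omega>) \<omega>} \<in> sets (Law X z) \<and>
    emeasure (Law X z) {\<omega>\<in>A. cyl_hits X cs (T \<omega>) \<omega>} = (\<integral>\<^sup>+ \<omega>\<in>A. cyl_prob X cs (Pos X (T \<omega>) \<omega>) \<partial>Law X z)"
  using assms
proof (induction cs arbitrary: T A)
  case Nil
  then show ?case using pre_sigma_le_Law[of T A z] by simp
next
  case (Cons c cs)
  note T = Cons.prems(1) and A = Cons.prems(2)
  have c [measurable]: "snd c \<in> sets comp_borel" and cs: "cyl_measurable cs"
    using Cons.prems(3) by (auto simp: cyl_measurable_def)
  define S where "S = (\<lambda>\<omega>. T \<omega> + fst c)"
  have S: "stopping_time (Filt X) S" unfolding S_def by (rule stopping_time_add_const[OF T])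
  define A' where "A' = {\<omega>\<in>A. Pos X (S \<omega>) \<omega> \<in> snd c}"
  have "A \<in> sets (pre_sigma S)"
    using mono_pre_sigma[OF T S] A by (auto simp: S_def)
  moreover have "A' = A \<inter> ((\<lambda>\<omega>. Pos X (S \<omega>) \<omega>) -` snd c \<inter> space (pre_sigma S))"
    using sets.sets_into_space[OF A] by (auto simp: A'_def space_pre_sigma)
  ultimately have A': "A' \<in> sets (pre_sigma S)"
    using measurable_sets[OF Pos_stopping_pre_sigma[OF S] c] by auto
  have e: "{\<omega>\<in>A. cyl_hits X (c # cs) (T \<omega>) \<omega>} = {\<omega>\<in>A'. cyl_hits X cs (S \<omega>) \<omega>}"
    by (auto simp: A'_def S_def)
  have f: "(\<lambda>y. indicator (snd c) y * cyl_prob X cs y) \<in> borel_measurable comp_borel"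
    using cyl_prob_measurable[OF cs] by measurable
  have "(\<integral>\<^sup>+ \<omega>\<in>A'. cyl_prob X cs (Pos X (S \<omega>) \<omega>) \<partial>Law X z)
      = (\<integral>\<^sup>+ \<omega>\<in>A. (indicator (snd c) (Pos X (S \<omega>) \<omega>) * cyl_prob X cs (Pos X (S \<omega>) \<omega>)) \<partial>Law X z)"
    by (intro nn_integral_cong) (auto simp: A'_def split: split_indicator)
  also have "\<dots> = (\<integral>\<^sup>+ \<omega>\<in>A. cyl_prob X (c # cs) (Pos X (T \<omega>) \<omega>) \<partial>Law X z)"
    unfolding S_def using strong_markov_fun[OF T A f, where t="fst c" and z=z] by simp
  finally show ?case using Cons.IH[OF S A' cs] unfolding e by simp
qed

lemma cyl_hits_Shift: "\<omega> \<in> Path X \<Longrightarrow> cyl_hits X cs r (Shift X s \<omega>) = cyl_hits X cs (s + r) \<omega>"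
  by (induction cs arbitrary: r) (auto simp: Pos_Shift add.assoc)

section \<open>Cylinder sets and the law of the shifted path\<close>

definition cylinders :: "'w set set" where
  "cylinders = {{\<omega>\<in>Path X. cyl_hits X cs 0 \<omega>} | cs. cyl_measurable cs}"

text \<open>Increments in \<open>ennreal\<close> are nonnegative and subtraction there is truncated,
  so only increasing times can be encoded; this is why sortedness is assumed.\<close>

lemma cyl_hits_of_sorted:
  assumes "sorted_wrt (\<le>) (map fst xs)" "\<forall>x\<in>set xs. r \<le> fst x" "cyl_measurable xs"
  shows "\<exists>cs. cyl_measurable cs \<and> (\<forall>\<omega>. cyl_hits X cs r \<omega> \<longleftrightarrow> (\<forall>(t, B)\<in>set xs. Pos X t \<omega> \<in> B))"
  using assms
proof (induction xs arbitrary: r)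
  case Nil
  then show ?case by (intro exI[of _ "[]"]) (simp add: cyl_measurable_def)
next
  case (Cons x xs)
  obtain cs where cs: "cyl_measurable cs" "\<And>\<omega>. cyl_hits X cs (fst x) \<omega> \<longleftrightarrow> (\<forall>(t, B)\<in>set xs. Pos X t \<omega> \<in> B)"
    using Cons.IH[of "fst x"] Cons.prems by (auto simp: cyl_measurable_def)
  have r: "r + (fst x - r) = fst x" using Cons.prems(2) by (intro add_diff_inverse_ennreal) auto
  have "cyl_hits X ((fst x - r, snd x) # cs) r \<omega> \<longleftrightarrow> (\<forall>(t, B)\<in>set (x # xs). Pos X t \<omega> \<in> B)" for \<omega>
    using cs(2)[of \<omega>] by (simp add: r case_prod_beta)
  then show ?case using cs(1) Cons.prems(3)
    by (intro exI[of _ "(fst x - r, snd x) # cs"]) (simp add: cyl_measurable_def)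
qed

lemma cyl_hits_of_list:
  assumes "cyl_measurable xs"
  shows "\<exists>cs. cyl_measurable cs \<and> (\<forall>\<omega>. cyl_hits X cs 0 \<omega> \<longleftrightarrow> (\<forall>(t, B)\<in>set xs. Pos X t \<omega> \<in> B))"
  using cyl_hits_of_sorted[of "sort_key fst xs" 0] assms by (auto simp: cyl_measurable_def)

lemma list_of_cyl_hits:
  assumes "cyl_measurable cs"
  shows "\<exists>xs. cyl_measurable xs \<and> (\<forall>\<omega>. cyl_hits X cs r \<omega> \<longleftrightarrow> (\<forall>(t, B)\<in>set xs. Pos X t \<omega> \<in> B))"
  using assms
proof (induction cs arbitrary: r)
  case Nil
  then show ?case by (intro exI[of _ "[]"]) (simp add: cyl_measurable_def)
next
  case (Cons c cs)
  obtain xs where "cyl_measurable xs" "\<forall>\<omega>. cyl_hits X cs (r + fst c) \<omega> \<longleftrightarrow> (\<forall>(t, B)\<in>set xs. Pos X t \<omega> \<in> B)"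
    using Cons.IH[of "r + fst c"] Cons.prems by (auto simp: cyl_measurable_def)
  then show ?case using Cons.prems
    by (intro exI[of _ "(r + fst c, snd c) # xs"]) (auto simp: cyl_measurable_def)
qed

text \<open>Lists of increments cannot simply be appended. Both are rewritten as constraints at
  absolute times, concatenated, sorted and turned back into increments.\<close>

lemma Int_stable_cylinders: "Int_stable cylinders"
proof (rule Int_stableI)
  fix A B assume "A \<in> cylinders" "B \<in> cylinders"
  then obtain a b where ab: "cyl_measurable a" "A = {\<omega>\<in>Path X. cyl_hits X a 0 \<omega>}"
      "cyl_measurable b" "B = {\<omega>\<in>Path X. cyl_hits X b 0 \<omega>}" by (auto simp: cylinders_def)
  obtain xs ys where xs: "cyl_measurable xs" "\<And>\<omega>. cyl_hits X a 0 \<omega> \<longleftrightarrow> (\<forall>(t, B)\<in>set xs. Pos X t \<omega> \<in> B)"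
    and ys: "cyl_measurable ys" "\<And>\<omega>. cyl_hits X b 0 \<omega> \<longleftrightarrow> (\<forall>(t, B)\<in>set ys. Pos X t \<omega> \<in> B)"
    using list_of_cyl_hits[OF ab(1), of 0] list_of_cyl_hits[OF ab(3), of 0] by blast
  obtain cs where cs: "cyl_measurable cs" "\<And>\<omega>. cyl_hits X cs 0 \<omega> \<longleftrightarrow> (\<forall>(t, B)\<in>set (xs @ ys). Pos X t \<omega> \<in> B)"
    using cyl_hits_of_list[of "xs @ ys"] xs(1) ys(1) by (auto simp: cyl_measurable_def)
  have "A \<inter> B = {\<omega>\<in>Path X. cyl_hits X cs 0 \<omega>}" unfolding ab(2,4) xs(2) ys(2) cs(2) set_append ball_Un by blast
  then show "A \<inter> B \<in> cylinders" using cs(1) by (auto simp: cylinders_def)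
qed

lemma cylinders_Pow: "cylinders \<subseteq> Pow (Path X)"
  by (auto simp: cylinders_def)

lemma cylinders_sets:
  assumes "C \<in> cylinders" shows "C \<in> sets (natural_filt X \<infinity>)"
proof -
  have "{\<omega>\<in>Path X. cyl_hits X cs r \<omega>} \<in> sets (natural_filt X \<infinity>)" if "cyl_measurable cs" for cs r
    using that
  proof (induction cs arbitrary: r)
    case Nil then show ?case using sets.top[of "natural_filt X \<infinity>"] by (simp add: space_natural)
  next
    case (Cons c cs)
    have "{\<omega>\<in>Path X. cyl_hits X (c # cs) r \<omega>} =
        (Pos X (r + fst c) -` snd c \<inter> space (natural_filt X \<infinity>)) \<inter> {\<omega>\<in>Path X. cyl_hits X cs (r + fst c) \<omega>}"
      by (auto simp: space_natural)
    also have "\<dots> \<in> sets (natural_filt X \<infinity>)"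
    proof (rule sets.Int)
      show "Pos X (r + fst c) -` snd c \<inter> space (natural_filt X \<infinity>) \<in> sets (natural_filt X \<infinity>)"
        using Cons.prems by (intro measurable_sets[OF Pos_natural]) (simp_all add: cyl_measurable_def)
      show "{\<omega>\<in>Path X. cyl_hits X cs (r + fst c) \<omega>} \<in> sets (natural_filt X \<infinity>)"
        using Cons by (simp add: cyl_measurable_def)
    qed
    finally show ?case .
  qed
  then show ?thesis using assms by (auto simp: cylinders_def)
qed

lemma sets_natural_cylinders: "sets (natural_filt X \<infinity>) = sigma_sets (Path X) cylinders"
proof (rule antisym)
  show "sigma_sets (Path X) cylinders \<subseteq> sets (natural_filt X \<infinity>)"
    using sets.sigma_sets_subset[of cylinders "natural_filt X \<infinity>"] cylinders_sets by (auto simp: space_natural)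
  have "Pos X s -` B \<inter> Path X \<in> sigma_sets (Path X) cylinders" if "B \<in> sets comp_borel" for s B
  proof (rule sigma_sets.Basic)
    show "Pos X s -` B \<inter> Path X \<in> cylinders"
      unfolding cylinders_def using that
      by (auto intro!: exI[of _ "[(s, B)]"] simp: cyl_measurable_def)
  qed
  then show "sets (natural_filt X \<infinity>) \<subseteq> sigma_sets (Path X) cylinders"
    unfolding sets_natural by (intro sigma_sets_mono) auto
qed

text \<open>The laws may live on a larger sigma-algebra, where nothing is known about measurability
  in the starting point. Restricted to natural events they form a kernel.\<close>

definition kernel :: "'a option \<Rightarrow> 'w measure" where
  "kernel z = distr (Law X z) (natural_filt X \<infinity>) (\<lambda>\<omega>. \<omega>)"

lemma id_natural: "(\<lambda>\<omega>. \<omega>) \<in> Law X z \<rightarrow>\<^sub>M natural_filt X \<infinity>"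
  by (rule measurable_natural_Law[of _ \<infinity>]) (rule measurable_ident_sets[OF refl])

lemma sets_kernel [measurable_cong, simp]: "sets (kernel z) = sets (natural_filt X \<infinity>)"
  by (simp add: kernel_def)

lemma emeasure_kernel:
  assumes "N \<in> sets (natural_filt X \<infinity>)" shows "emeasure (kernel z) N = emeasure (Law X z) N"
proof -
  have "(\<lambda>\<omega>. \<omega>) -` N \<inter> space (Law X z) = N"
    using sets.sets_into_space[OF assms] by (auto simp: space_Law space_natural)
  then show ?thesis unfolding kernel_def by (simp only: emeasure_distr[OF id_natural assms])
qed

text \<open>Cylinders form an intersection-stable generator. On a cylinder the strong Markov
  property at time 0, together with normality, gives the value \<open>cyl_prob cs z\<close>, which
  is measurable in \<open>z\<close>.\<close>

lemma kernel_prob: "kernel \<in> comp_borel \<rightarrow>\<^sub>M prob_algebra (natural_filt X \<infinity>)"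
proof (rule measurable_prob_algebra_generated[OF sets_natural_cylinders Int_stable_cylinders cylinders_Pow])
  fix z show "prob_space (kernel z)"
    unfolding kernel_def by (rule prob_space.prob_space_distr[OF prob_space_Law id_natural])
next
  fix C assume C: "C \<in> cylinders"
  then obtain cs where cs: "cyl_measurable cs" "C = {\<omega>\<in>Path X. cyl_hits X cs 0 \<omega>}" by (auto simp: cylinders_def)
  have "emeasure (kernel z) C = cyl_prob X cs z" for z
  proof -
    have P: "Path X \<in> sets (pre_sigma (\<lambda>_. 0))" using sets.top[of "pre_sigma (\<lambda>_. 0)"] by (simp add: space_pre_sigma)
    have "emeasure (kernel z) C = emeasure (Law X z) C"
      by (rule emeasure_kernel[OF cylinders_sets[OF C]])
    also have "\<dots> = (\<integral>\<^sup>+ \<omega>\<in>Path X. cyl_prob X cs (Pos X 0 \<omega>) \<partial>Law X z)"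
      using strong_markov_cyl[OF stopping_time_const P cs(1)] cs(2) by simp
    also have "\<dots> = (\<integral>\<^sup>+ \<omega>. cyl_prob X cs z \<partial>Law X z)"
    proof (rule nn_integral_cong_AE)
      show "AE \<omega> in Law X z. cyl_prob X cs (Pos X 0 \<omega>) * indicator (Path X) \<omega> = cyl_prob X cs z"
        using Pos_0_AE AE_space by eventually_elim (simp add: space_Law)
    qed
    also have "\<dots> = cyl_prob X cs z" by (simp add: prob_space.emeasure_space_1[OF prob_space_Law])
    finally show ?thesis .
  qed
  then show "(\<lambda>z. emeasure (kernel z) C) \<in> borel_measurable comp_borel"
    using cyl_prob_measurable[OF cs(1)] by simp
qed simp

lemma kernel_subprob [measurable]: "kernel \<in> comp_borel \<rightarrow>\<^sub>M subprob_algebra (natural_filt X \<infinity>)"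
  by (rule measurable_prob_algebraD[OF kernel_prob])

lemma Shift_measurable:
  assumes T: "stopping_time (Filt X) T"
  shows "(\<lambda>\<omega>. Shift X (T \<omega>) \<omega>) \<in> Law X z \<rightarrow>\<^sub>M natural_filt X \<infinity>"
proof (rule measurable_sigma_sets[OF sets_natural])
  fix A assume "A \<in> {Pos X s -` B \<inter> Path X | s B. s \<le> \<infinity> \<and> B \<in> sets comp_borel}"
  then obtain s B where B: "A = Pos X s -` B \<inter> Path X" "B \<in> sets comp_borel" by auto
  have "(\<lambda>\<omega>. Shift X (T \<omega>) \<omega>) -` A \<inter> space (Law X z) = (\<lambda>\<omega>. Pos X (T \<omega> + s) \<omega>) -` B \<inter> space (Law X z)"
    using B(1) by (auto simp: space_Law Pos_Shift Shift_Path)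
  also have "\<dots> \<in> sets (Law X z)"
    by (rule measurable_sets[OF Pos_stopping_Law[OF stopping_time_add_const[OF T]] B(2)])
  finally show "(\<lambda>\<omega>. Shift X (T \<omega>) \<omega>) -` A \<inter> space (Law X z) \<in> sets (Law X z)" .
qed (auto simp: space_Law Shift_Path)

text \<open>The strong Markov property for arbitrary natural path events: the shifted path is
  distributed like a path started afresh from the law of the position at \<open>T\<close>. On
  cylinders this is \<open>strong_markov_cyl\<close>.\<close>

lemma distr_Shift:
  assumes T: "stopping_time (Filt X) T"
  shows "distr (Law X z) (natural_filt X \<infinity>) (\<lambda>\<omega>. Shift X (T \<omega>) \<omega>)
       = distr (Law X z) comp_borel (\<lambda>\<omega>. Pos X (T \<omega>) \<omega>) \<bind> kernel" (is "?L = ?\<nu> \<bind> kernel")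
proof (rule measure_eqI_generator_eq[OF Int_stable_cylinders cylinders_Pow, where A="\<lambda>_. Path X"])
  show "sets ?L = sigma_sets (Path X) cylinders" unfolding sets_distr by (rule sets_natural_cylinders)
  have "sets (?\<nu> \<bind> kernel) = sets (natural_filt X \<infinity>)" by (rule sets_bind) simp_all
  then show "sets (?\<nu> \<bind> kernel) = sigma_sets (Path X) cylinders" unfolding sets_natural_cylinders .
  have "{\<omega>\<in>Path X. cyl_hits X [] 0 \<omega>} \<in> cylinders"
    unfolding cylinders_def by (auto intro!: exI[of _ "[]"] simp: cyl_measurable_def)
  then show "range (\<lambda>_. Path X) \<subseteq> cylinders" by auto
  show "emeasure ?L (Path X) \<noteq> \<infinity>" for i :: nat
    using finite_measure.emeasure_finite[OF prob_space.finite_measure[OF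
      prob_space.prob_space_distr[OF prob_space_Law Shift_measurable[OF T]]]] by simp
next
  fix C assume C: "C \<in> cylinders"
  then obtain cs where cs: "cyl_measurable cs" "C = {\<omega>\<in>Path X. cyl_hits X cs 0 \<omega>}" by (auto simp: cylinders_def)
  note m = Pos_stopping_Law[OF T, of z]
  have P: "Path X \<in> sets (pre_sigma T)" using sets.top[of "pre_sigma T"] by (simp add: space_pre_sigma)
  have "emeasure ?L C = emeasure (Law X z) {\<omega>\<in>Path X. cyl_hits X cs (T \<omega>) \<omega>}"
    using cs(2) by (subst emeasure_distr[OF Shift_measurable[OF T] cylinders_sets[OF C]])
      (auto simp: space_Law cyl_hits_Shift Shift_Path intro!: arg_cong2[where f=emeasure])
  also have "\<dots> = (\<integral>\<^sup>+ \<omega>. cyl_prob X cs (Pos X (T \<omega>) \<omega>) \<partial>Law X z)"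
    using strong_markov_cyl[OF T P cs(1)]
    by (auto intro!: nn_integral_cong simp: space_Law split: split_indicator)
  also have "\<dots> = (\<integral>\<^sup>+ y. emeasure (kernel y) C \<partial>?\<nu>)"
  proof (subst nn_integral_distr[OF m], goal_cases)
    case 1
    show ?case using measurable_compose[OF kernel_subprob measurable_emeasure_subprob_algebra[OF cylinders_sets[OF C]]]
      by simp
  next
    case 2
    show ?case
  proof (rule nn_integral_cong)
    fix \<omega>
    have P0: "Path X \<in> sets (pre_sigma (\<lambda>_. 0))" using sets.top[of "pre_sigma (\<lambda>_. 0)"] by (simp add: space_pre_sigma)
    let ?z = "Pos X (T \<omega>) \<omega>"
    have "emeasure (kernel ?z) C = emeasure (Law X ?z) C" by (rule emeasure_kernel[OF cylinders_sets[OF C]])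
    also have "\<dots> = (\<integral>\<^sup>+ \<omega>'\<in>Path X. cyl_prob X cs (Pos X 0 \<omega>') \<partial>Law X ?z)"
      using strong_markov_cyl[OF stopping_time_const P0 cs(1)] cs(2) by simp
    also have "\<dots> = (\<integral>\<^sup>+ \<omega>'. cyl_prob X cs ?z \<partial>Law X ?z)"
    proof (rule nn_integral_cong_AE)
      show "AE \<omega>' in Law X ?z. cyl_prob X cs (Pos X 0 \<omega>') * indicator (Path X) \<omega>' = cyl_prob X cs ?z"
        using Pos_0_AE AE_space by eventually_elim (simp add: space_Law)
    qed
    finally show "cyl_prob X cs ?z = emeasure (kernel ?z) C"
      by (simp add: prob_space.emeasure_space_1[OF prob_space_Law])
  qed
  qed
  also have "\<dots> = emeasure (?\<nu> \<bind> kernel) C"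
    by (rule emeasure_bind[symmetric, OF _ _ cylinders_sets[OF C]]) (use kernel_subprob in simp_all)
  finally show "emeasure ?L C = emeasure (?\<nu> \<bind> kernel) C" .
qed auto

end

section \<open>Completed laws and right-continuous processes at random times\<close>

lemma borel_measurable_completion_AE:
  fixes f g :: "'w \<Rightarrow> 'b::topological_space"
  assumes g: "g \<in> borel_measurable M" and ae: "AE \<omega> in M. f \<omega> = g \<omega>"
  shows "f \<in> borel_measurable (completion M)"
proof (rule measurableI)
  fix S :: "'b set" assume S: "S \<in> sets borel"
  obtain N where N: "N \<in> null_sets M" "{\<omega> \<in> space M. f \<omega> \<noteq> g \<omega>} \<subseteq> N"
    using ae by (auto elim!: AE_E)
  have "f -` S \<inter> space M = (g -` S \<inter> space M - N) \<union> (f -` S \<inter> space M \<inter> N)"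
    using N(2) by auto
  moreover have "g -` S \<inter> space M - N \<in> sets M"
    using measurable_sets[OF g S] N(1) by auto
  ultimately have "f -` S \<inter> space M \<in> sets (completion M)"
    using N(1) by (intro sets_completionI[of _ _ "f -` S \<inter> space M \<inter> N" N M]) auto
  then show "f -` S \<inter> space (completion M) \<in> sets (completion M)" by simp
qed simp

lemma integral_completion_AE:
  fixes f g :: "'w \<Rightarrow> real"
  assumes g: "g \<in> borel_measurable M" and ae: "AE \<omega> in M. f \<omega> = g \<omega>"
  shows "(\<integral>\<omega>. f \<omega> \<partial>completion M) = (\<integral>\<omega>. g \<omega> \<partial>M)"
proof -
  have "(\<integral>\<omega>. f \<omega> \<partial>completion M) = (\<integral>\<omega>. g \<omega> \<partial>completion M)"
    by (intro integral_cong_AE borel_measurable_completion_AE[OF g ae] measurable_completion[OF g] AE_completion[OF ae])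
  then show ?thesis by (simp add: integral_completion[OF g])
qed

text \<open>Bridge between \<open>expect\<close>, which integrates over completed laws, and ordinary
  integrals of measurable versions.\<close>

lemma expect_AE:
  assumes "g \<in> borel_measurable (Law X (Some x))" "AE \<omega> in Law X (Some x). f \<omega> = g \<omega>"
  shows "expect X x f = (\<integral>\<omega>. g \<omega> \<partial>Law X (Some x))"
  unfolding expect_def by (rule integral_completion_AE[OF assms])

lemma filterlim_at_right_iff:
  "filterlim f (at_right b) F \<longleftrightarrow> (\<forall>\<^sub>F x in F. f x > (b :: 'b::linorder_topology)) \<and> (f \<longlongrightarrow> b) F"
proof -
  have "f x \<in> {b<..} \<and> f x \<noteq> b \<longleftrightarrow> f x > b" for x by auto
  then show ?thesis unfolding filterlim_at by simp
qed

text \<open>The next dyadic number to the right of \<open>t\<close>. The added 1 makes it strictly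
  larger than \<open>t\<close>, as convergence in \<open>at_right t\<close> requires, and each level
  has only countably many values.\<close>

definition dyadic_above :: "nat \<Rightarrow> real \<Rightarrow> real" where
  "dyadic_above n t = (real (nat \<lfloor>2 ^ n * t\<rfloor>) + 1) / 2 ^ n"

lemma dyadic_above_at_right:
  assumes "t \<ge> 0" shows "filterlim (\<lambda>n. dyadic_above n t) (at_right t) sequentially"
  unfolding filterlim_at_right_iff
proof
  have b: "t < dyadic_above n t" "dyadic_above n t \<le> t + (1/2)^n" for n
  proof -
    have "0 \<le> 2^n * t" using assms by simp
    then have r: "real (nat \<lfloor>2 ^ n * t\<rfloor>) = of_int \<lfloor>2 ^ n * t\<rfloor>" by (simp add: of_nat_nat)
    have k: "2^n * t < of_int \<lfloor>2 ^ n * t\<rfloor> + 1" "of_int \<lfloor>2 ^ n * t\<rfloor> \<le> 2^n * t" by linarith+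
    show "t < dyadic_above n t"
      using k(1) unfolding dyadic_above_def r by (simp add: pos_less_divide_eq mult.commute)
    have "of_int \<lfloor>2 ^ n * t\<rfloor> / 2 ^ n \<le> t" using k(2) by (simp add: pos_divide_le_eq mult.commute)
    then show "dyadic_above n t \<le> t + (1/2)^n"
      unfolding dyadic_above_def r by (simp add: add_divide_distrib power_divide)
  qed
  then show "\<forall>\<^sub>F n in sequentially. dyadic_above n t > t" by simp
  show "(\<lambda>n. dyadic_above n t) \<longlonglongrightarrow> t"
  proof (rule tendsto_sandwich[of "\<lambda>_. t" _ _ "\<lambda>n. t + (1/2)^n"])
    have "(\<lambda>n. t + (1/2)^n) \<longlonglongrightarrow> t + 0" by (intro tendsto_intros LIMSEQ_power_zero) simp
    then show "(\<lambda>n. t + (1/2)^n) \<longlonglongrightarrow> t" by simp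
  qed (use b in \<open>auto intro: always_eventually less_imp_le\<close>)
qed

text \<open>Evaluation at dyadic times above \<open>T\<close> is measurable, since only countably
  many times occur, and right continuity identifies the limit. Elsewhere \<open>lim\<close> is
  unspecified, so nothing is claimed there.\<close>

lemma right_continuous_compose_measurable:
  fixes Y :: "real \<Rightarrow> 'm \<Rightarrow> real"
  assumes Y: "\<And>t. t \<ge> 0 \<Longrightarrow> Y t \<in> borel_measurable M" and T [measurable]: "T \<in> borel_measurable M"
  shows "\<exists>Z\<in>borel_measurable M. \<forall>\<omega>. T \<omega> \<ge> 0 \<longrightarrow> ((\<lambda>t. Y t \<omega>) \<longlongrightarrow> Y (T \<omega>) \<omega>) (at_right (T \<omega>)) \<longrightarrow> Z \<omega> = Y (T \<omega>) \<omega>"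
proof (intro bexI allI impI)
  have "(\<lambda>\<omega>. Y (dyadic_above n (T \<omega>)) \<omega>) \<in> borel_measurable M" for n
    unfolding dyadic_above_def
  proof (rule measurable_compose_countable[where f="\<lambda>k \<omega>. Y ((real k + 1) / 2 ^ n) \<omega>"])
    show "Y ((real k + 1) / 2 ^ n) \<in> borel_measurable M" for k by (rule Y) simp
    show "(\<lambda>\<omega>. nat \<lfloor>2 ^ n * T \<omega>\<rfloor>) \<in> M \<rightarrow>\<^sub>M count_space UNIV" by measurable
  qed
  then show "(\<lambda>\<omega>. lim (\<lambda>n. Y (dyadic_above n (T \<omega>)) \<omega>)) \<in> borel_measurable M"
    by (rule borel_measurable_lim_metric)
  fix \<omega> assume "T \<omega> \<ge> 0" "((\<lambda>t. Y t \<omega>) \<longlongrightarrow> Y (T \<omega>) \<omega>) (at_right (T \<omega>))"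
  then have "(\<lambda>n. Y (dyadic_above n (T \<omega>)) \<omega>) \<longlonglongrightarrow> Y (T \<omega>) \<omega>"
    using filterlim_compose[OF _ dyadic_above_at_right] by blast
  then show "lim (\<lambda>n. Y (dyadic_above n (T \<omega>)) \<omega>) = Y (T \<omega>) \<omega>" by (rule limI)
qed

lemma eventually_at_right_ennreal:
  fixes t :: ennreal
  assumes "t < top"
  shows "eventually P (at_right t) \<longleftrightarrow> (\<exists>b>t. \<forall>s>t. s < b \<longrightarrow> P s)"
  using eventually_at_right[OF assms, of P] by simp

lemma filterlim_ennreal_at_right:
  assumes "t \<ge> 0" shows "filterlim ennreal (at_right (ennreal t)) (at_right t)"
  unfolding filterlim_at_right_iff
proof
  show "\<forall>\<^sub>F x in at_right t. ennreal x > ennreal t"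
    using assms by (auto simp: eventually_at_filter intro!: always_eventually ennreal_lessI)
  show "((\<lambda>x. ennreal x) \<longlongrightarrow> ennreal t) (at_right t)" by (intro tendsto_ennrealI tendsto_ident_at)
qed

section \<open>Functionals measurable for the augmented filtration\<close>

context std_process
begin

lemma prob_space_kernel: "prob_space (kernel z)"
  unfolding kernel_def by (rule prob_space.prob_space_distr[OF prob_space_Law id_natural])

lemma initial_law_nonempty: "initial_law \<nu> \<Longrightarrow> space \<nu> \<noteq> {}"
  using sets_eq_imp_space_eq[of \<nu> comp_borel] by (simp add: initial_law_def)

lemma kernel_subprob': "initial_law \<nu> \<Longrightarrow> kernel \<in> \<nu> \<rightarrow>\<^sub>M subprob_algebra (natural_filt X \<infinity>)"
  using kernel_subprob measurable_cong_sets[of \<nu> comp_borel] by (auto simp: initial_law_def)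

lemma sets_bind_kernel: "initial_law \<nu> \<Longrightarrow> sets (\<nu> \<bind> kernel) = sets (natural_filt X \<infinity>)"
  by (rule sets_bind[OF sets_kernel initial_law_nonempty])

lemma emeasure_bind_kernel:
  assumes "initial_law \<nu>" "N \<in> sets (natural_filt X \<infinity>)"
  shows "emeasure (\<nu> \<bind> kernel) N = (\<integral>\<^sup>+ z. emeasure (Law X z) N \<partial>\<nu>)"
  using emeasure_bind[OF initial_law_nonempty[OF assms(1)] kernel_subprob'[OF assms(1)] assms(2)]
  by (simp only: emeasure_kernel[OF assms(2)])

lemma aug_le_completion:
  assumes \<nu>: "initial_law \<nu>"
  shows "sets (aug_filt X \<infinity>) \<subseteq> sets (completion (\<nu> \<bind> kernel))"
proof -
  let ?Q = "\<nu> \<bind> kernel"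
  have sp: "space ?Q = Path X" using sets_eq_imp_space_eq[OF sets_bind_kernel[OF \<nu>]] by (simp add: space_natural)
  have "{A. A \<subseteq> Path X \<and> (\<forall>\<nu>. initial_law \<nu> \<longrightarrow>
        (\<exists>B\<in>sets (natural_filt X \<infinity>). null_from X \<nu> ((A - B) \<union> (B - A))))} \<subseteq> sets (completion ?Q)"
  proof (rule subsetI, elim CollectE conjE)
    fix A assume A: "A \<subseteq> Path X" "\<forall>\<nu>. initial_law \<nu> \<longrightarrow>
        (\<exists>B\<in>sets (natural_filt X \<infinity>). null_from X \<nu> ((A - B) \<union> (B - A)))"
    obtain B N where B: "B \<in> sets (natural_filt X \<infinity>)" and N: "N \<in> sets (natural_filt X \<infinity>)"
        "(A - B) \<union> (B - A) \<subseteq> N" "(\<integral>\<^sup>+ z. emeasure (Law X z) N \<partial>\<nu>) = 0"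
      using A(2) \<nu> unfolding null_from_def by blast
    have "N \<in> null_sets ?Q"
      using N emeasure_bind_kernel[OF \<nu> N(1)] sets_bind_kernel[OF \<nu>] by (auto intro!: null_setsI)
    moreover have "B - N \<in> sets ?Q" unfolding sets_bind_kernel[OF \<nu>] using B N(1) by (rule sets.Diff)
    moreover have "A = (B - N) \<union> (A \<inter> N)" using N(2) by auto
    ultimately show "A \<in> sets (completion ?Q)" by (intro sets_completionI[of A "B - N" "A \<inter> N" N ?Q]) auto
  qed
  from sets.sigma_sets_subset[OF this] show ?thesis unfolding sets_aug space_completion sp .
qed

lemma aug_natural_version:
  fixes g :: "'w \<Rightarrow> real"
  assumes \<nu>: "initial_law \<nu>" and g: "g \<in> borel_measurable (aug_filt X \<infinity>)" and c: "\<And>\<omega>. \<bar>g \<omega>\<bar> \<le> c"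
  shows "\<exists>g'\<in>borel_measurable (natural_filt X \<infinity>). \<exists>N\<in>sets (natural_filt X \<infinity>).
    (\<forall>\<omega>. \<bar>g' \<omega>\<bar> \<le> c) \<and> (\<forall>\<omega>\<in>Path X - N. g \<omega> = g' \<omega>) \<and> (\<integral>\<^sup>+ z. emeasure (Law X z) N \<partial>\<nu>) = 0"
proof -
  let ?Q = "\<nu> \<bind> kernel"
  have sp: "space ?Q = Path X" using sets_eq_imp_space_eq[OF sets_bind_kernel[OF \<nu>]] by (simp add: space_natural)
  have "g \<in> borel_measurable (completion ?Q)"
  proof (rule measurableI)
    fix S :: "real set" assume "S \<in> sets borel"
    then show "g -` S \<inter> space (completion ?Q) \<in> sets (completion ?Q)"
      using measurable_sets[OF g, of S] aug_le_completion[OF \<nu>] by (auto simp: sp space_aug)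
  qed simp
  then obtain g0 where g0: "g0 \<in> borel_measurable ?Q" "AE \<omega> in ?Q. g \<omega> = g0 \<omega>"
    using completion_ex_borel_measurable_real by blast
  obtain N where N: "N \<in> null_sets ?Q" "{\<omega> \<in> space ?Q. g \<omega> \<noteq> g0 \<omega>} \<subseteq> N"
    using g0(2) by (auto elim!: AE_E)
  \<comment> \<open>Truncation keeps the bound \<open>c\<close> on all paths, including those where
    the version differs from \<open>g\<close>.\<close>
  define g' where "g' \<omega> = max (- c) (min c (g0 \<omega>))" for \<omega>
  have c0: "0 \<le> c" using c[of undefined] by linarith
  have "g0 \<in> borel_measurable (natural_filt X \<infinity>)"
    using g0(1) measurable_cong_sets[OF sets_bind_kernel[OF \<nu>] refl] by blast
  then have "g' \<in> borel_measurable (natural_filt X \<infinity>)" unfolding g'_def by measurable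
  moreover have "N \<in> sets (natural_filt X \<infinity>)" using N(1) sets_bind_kernel[OF \<nu>] by auto
  moreover from this have "(\<integral>\<^sup>+ z. emeasure (Law X z) N \<partial>\<nu>) = 0"
    using N(1) emeasure_bind_kernel[OF \<nu>, of N] by auto
  moreover have "\<bar>g' \<omega>\<bar> \<le> c" for \<omega> using c0 unfolding g'_def by linarith
  moreover have "g \<omega> = g' \<omega>" if "\<omega> \<in> Path X - N" for \<omega>
  proof -
    have "g \<omega> = g0 \<omega>" using N(2) that sp by auto
    then show ?thesis using c[of \<omega>] unfolding g'_def by linarith
  qed
  ultimately show ?thesis by blast
qed

lemma integral_Law_measurable:
  fixes g :: "'w \<Rightarrow> real"
  assumes g: "g \<in> borel_measurable (natural_filt X \<infinity>)"
  shows "(\<lambda>z. \<integral>\<omega>. g \<omega> \<partial>Law X z) \<in> borel_measurable comp_borel"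
proof -
  have "(\<lambda>z. \<integral>\<omega>. g \<omega> \<partial>kernel z) \<in> borel_measurable comp_borel"
    by (rule measurable_compose[OF kernel_subprob integral_measurable_subprob_algebra[OF g]])
  then show ?thesis by (simp only: kernel_def integral_distr[OF id_natural g])
qed

lemma finite_measure_Law: "finite_measure (Law X z)"
  using prob_space_Law by (rule prob_space.finite_measure)

lemma integrable_bounded_Law:
  fixes g :: "'w \<Rightarrow> real"
  assumes "g \<in> borel_measurable (Law X z)" "\<And>\<omega>. \<bar>g \<omega>\<bar> \<le> c"
  shows "integrable (Law X z) g"
  using assms by (intro finite_measure.integrable_const_bound[OF finite_measure_Law, of _ c]) auto

text \<open>Universal measurability of the expectation in the starting point, relative to a fixed
  initial law: the exceptional points are those whose law charges the null set of a natural
  version.\<close>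

lemma expectation_version:
  fixes g :: "'w \<Rightarrow> real"
  assumes \<nu>: "initial_law \<nu>" and g: "g \<in> borel_measurable (aug_filt X \<infinity>)" and c: "\<And>\<omega>. \<bar>g \<omega>\<bar> \<le> c"
  shows "\<exists>h\<in>borel_measurable comp_borel. \<exists>M\<in>null_sets \<nu>. \<forall>z. z \<notin> M \<longrightarrow> (\<integral>\<omega>. g \<omega> \<partial>Law X z) = h z"
proof -
  obtain g' N where g': "g' \<in> borel_measurable (natural_filt X \<infinity>)" and N: "N \<in> sets (natural_filt X \<infinity>)"
    "\<forall>\<omega>\<in>Path X - N. g \<omega> = g' \<omega>" "(\<integral>\<^sup>+ z. emeasure (Law X z) N \<partial>\<nu>) = 0"
    using aug_natural_version[OF assms] by blast
  have m: "(\<lambda>z. emeasure (Law X z) N) \<in> borel_measurable comp_borel"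
    using measurable_compose[OF kernel_subprob measurable_emeasure_subprob_algebra[OF N(1)]]
    by (simp only: emeasure_kernel[OF N(1)])
  then have m\<nu>: "(\<lambda>z. emeasure (Law X z) N) \<in> borel_measurable \<nu>"
    using \<nu> measurable_cong_sets[of \<nu> comp_borel] by (auto simp: initial_law_def)
  define M where "M = {z \<in> space \<nu>. emeasure (Law X z) N \<noteq> 0}"
  have sp: "space \<nu> = UNIV" using \<nu> sets_eq_imp_space_eq[of \<nu> comp_borel] by (simp add: initial_law_def)
  have "AE z in \<nu>. emeasure (Law X z) N = 0"
    using N(3) nn_integral_0_iff_AE[OF m\<nu>] by simp
  then have M: "M \<in> null_sets \<nu>"
    unfolding M_def using m\<nu> by (subst AE_iff_null[symmetric]) simp_all
  have eq: "(\<integral>\<omega>. g \<omega> \<partial>Law X z) = (\<integral>\<omega>. g' \<omega> \<partial>Law X z)" if "z \<notin> M" for z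
  proof (rule integral_cong_AE)
    show "g \<in> borel_measurable (Law X z)" "g' \<in> borel_measurable (Law X z)"
      by (rule measurable_aug_Law[OF g], rule measurable_natural_Law[OF g'])
    have "emeasure (Law X z) N = 0" using that sp by (auto simp: M_def)
    then have "N \<in> null_sets (Law X z)" using natural_le_Law N(1) by (auto intro!: null_setsI)
    then have "AE \<omega> in Law X z. \<omega> \<notin> N" by (rule AE_not_in)
    then show "AE \<omega> in Law X z. g \<omega> = g' \<omega>"
      using AE_space by eventually_elim (use N(2) in \<open>auto simp: space_Law\<close>)
  qed
  show ?thesis by (intro bexI[OF _ integral_Law_measurable[OF g']] bexI[OF _ M] allI impI eq)
qed

lemma initial_law_Pos:
  assumes "stopping_time (Filt X) T"
  shows "initial_law (distr (Law X z) comp_borel (\<lambda>\<omega>. Pos X (T \<omega>) \<omega>))"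
  unfolding initial_law_def
  by (intro conjI prob_space.prob_space_distr prob_space_Law Pos_stopping_Law[OF assms]) simp

text \<open>The right initial law is the distribution \<open>\<nu>\<close> of the position at
  \<open>T\<close>. By \<open>distr_Shift\<close> the path law from \<open>\<nu>\<close> is that of
  the shifted path, so an event null from \<open>\<nu>\<close> is negligible for the shifted path
  and for almost every restarted law. Both sides thus reduce to a natural version of
  \<open>g\<close>.\<close>

lemma strong_markov_aug:
  fixes g :: "'w \<Rightarrow> real"
  assumes T: "stopping_time (Filt X) T" and g: "g \<in> borel_measurable (aug_filt X \<infinity>)" and c: "\<And>\<omega>. \<bar>g \<omega>\<bar> \<le> c"
  shows "(\<lambda>\<omega>. g (Shift X (T \<omega>) \<omega>)) \<in> borel_measurable (completion (Law X z))"
    and "(\<lambda>\<omega>. \<integral>\<omega>'. g \<omega>' \<partial>Law X (Pos X (T \<omega>) \<omega>)) \<in> borel_measurable (completion (Law X z))"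
    and "(\<integral>\<omega>. g (Shift X (T \<omega>) \<omega>) \<partial>completion (Law X z)) =
         (\<integral>\<omega>. (\<integral>\<omega>'. g \<omega>' \<partial>Law X (Pos X (T \<omega>) \<omega>)) \<partial>completion (Law X z))"
proof -
  define \<nu> where "\<nu> = distr (Law X z) comp_borel (\<lambda>\<omega>. Pos X (T \<omega>) \<omega>)"
  note m = Pos_stopping_Law[OF T, of z] and S = Shift_measurable[OF T, of z]
  have \<nu>: "initial_law \<nu>" unfolding \<nu>_def by (rule initial_law_Pos[OF T])
  obtain g' N where g': "g' \<in> borel_measurable (natural_filt X \<infinity>)" and N: "N \<in> sets (natural_filt X \<infinity>)"
    "\<forall>\<omega>\<in>Path X - N. g \<omega> = g' \<omega>" "(\<integral>\<^sup>+ z. emeasure (Law X z) N \<partial>\<nu>) = 0" and g'c: "\<And>\<omega>. \<bar>g' \<omega>\<bar> \<le> c"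
    using aug_natural_version[OF \<nu> g c] by blast
  have "emeasure (Law X z) ((\<lambda>\<omega>. Shift X (T \<omega>) \<omega>) -` N \<inter> space (Law X z)) = 0"
    unfolding emeasure_distr[OF S N(1), symmetric] distr_Shift[OF T]
    using emeasure_bind_kernel[OF \<nu> N(1)] N(3) by (simp add: \<nu>_def)
  then have "(\<lambda>\<omega>. Shift X (T \<omega>) \<omega>) -` N \<inter> space (Law X z) \<in> null_sets (Law X z)"
    using measurable_sets[OF S N(1)] by (rule null_setsI)
  then have ae1: "AE \<omega> in Law X z. g (Shift X (T \<omega>) \<omega>) = g' (Shift X (T \<omega>) \<omega>)"
    by (rule AE_I') (use N(2) in \<open>auto simp: space_Law Shift_Path\<close>)
  have m1: "(\<lambda>\<omega>. g' (Shift X (T \<omega>) \<omega>)) \<in> borel_measurable (Law X z)"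
    by (rule measurable_compose[OF S g'])
  have hm: "(\<lambda>z. \<integral>\<omega>. g' \<omega> \<partial>Law X z) \<in> borel_measurable comp_borel" by (rule integral_Law_measurable[OF g'])
  have m2: "(\<lambda>\<omega>. \<integral>\<omega>'. g' \<omega>' \<partial>Law X (Pos X (T \<omega>) \<omega>)) \<in> borel_measurable (Law X z)"
    by (rule measurable_compose[OF m hm])
  have mN: "(\<lambda>z. emeasure (Law X z) N) \<in> borel_measurable comp_borel"
    using measurable_compose[OF kernel_subprob measurable_emeasure_subprob_algebra[OF N(1)]]
    by (simp only: emeasure_kernel[OF N(1)])
  have "(\<integral>\<^sup>+ \<omega>. emeasure (Law X (Pos X (T \<omega>) \<omega>)) N \<partial>Law X z) = 0"
    using N(3) unfolding \<nu>_def by (subst (asm) nn_integral_distr[OF m]) (simp_all add: mN)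
  then have "AE \<omega> in Law X z. emeasure (Law X (Pos X (T \<omega>) \<omega>)) N = 0"
    by (subst (asm) nn_integral_0_iff_AE[OF measurable_compose[OF m mN]])
  then have ae2: "AE \<omega> in Law X z. (\<integral>\<omega>'. g \<omega>' \<partial>Law X (Pos X (T \<omega>) \<omega>)) = (\<integral>\<omega>'. g' \<omega>' \<partial>Law X (Pos X (T \<omega>) \<omega>))"
  proof eventually_elim
    case (elim \<omega>)
    let ?M = "Law X (Pos X (T \<omega>) \<omega>)"
    show ?case
    proof (rule integral_cong_AE)
      show "g \<in> borel_measurable ?M" "g' \<in> borel_measurable ?M"
        by (rule measurable_aug_Law[OF g], rule measurable_natural_Law[OF g'])
      have "N \<in> null_sets ?M" using elim natural_le_Law N(1) by (auto intro!: null_setsI)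
      then have "AE \<omega> in ?M. \<omega> \<notin> N" by (rule AE_not_in)
      then show "AE \<omega> in ?M. g \<omega> = g' \<omega>"
        using AE_space by eventually_elim (use N(2) in \<open>auto simp: space_Law\<close>)
    qed
  qed
  show "(\<lambda>\<omega>. g (Shift X (T \<omega>) \<omega>)) \<in> borel_measurable (completion (Law X z))"
    by (rule borel_measurable_completion_AE[OF m1 ae1])
  show "(\<lambda>\<omega>. \<integral>\<omega>'. g \<omega>' \<partial>Law X (Pos X (T \<omega>) \<omega>)) \<in> borel_measurable (completion (Law X z))"
    by (rule borel_measurable_completion_AE[OF m2 ae2])
  have "(\<integral>\<omega>. g' (Shift X (T \<omega>) \<omega>) \<partial>Law X z) = (\<integral>\<omega>. g' \<omega> \<partial>(\<nu> \<bind> kernel))"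
    unfolding \<nu>_def distr_Shift[OF T, symmetric] by (rule integral_distr[OF S g', symmetric])
  also have "\<dots> = (\<integral>y. (\<integral>\<omega>. g' \<omega> \<partial>kernel y) \<partial>\<nu>)"
    using \<nu> by (intro integral_bind[where K="natural_filt X \<infinity>" and B=c and B'=1] g' kernel_subprob' initial_law_nonempty)
      (auto simp: g'c initial_law_def prob_space.emeasure_space_1[OF prob_space_kernel] intro: prob_space.finite_measure)
  also have "\<dots> = (\<integral>y. (\<integral>\<omega>. g' \<omega> \<partial>Law X y) \<partial>\<nu>)"
    by (simp only: kernel_def integral_distr[OF id_natural g'])
  also have "\<dots> = (\<integral>\<omega>. (\<integral>\<omega>'. g' \<omega>' \<partial>Law X (Pos X (T \<omega>) \<omega>)) \<partial>Law X z)"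
    unfolding \<nu>_def by (rule integral_distr[OF m hm])
  finally show "(\<integral>\<omega>. g (Shift X (T \<omega>) \<omega>) \<partial>completion (Law X z)) =
         (\<integral>\<omega>. (\<integral>\<omega>'. g \<omega>' \<partial>Law X (Pos X (T \<omega>) \<omega>)) \<partial>completion (Law X z))"
    unfolding integral_completion_AE[OF m1 ae1] integral_completion_AE[OF m2 ae2] .
qed

text \<open>For nonnegative bounded functionals, vanishing almost surely is the same as having
  integral zero, and this applies on either side of the strong Markov identity.\<close>

lemma strong_markov_null:
  fixes g :: "'w \<Rightarrow> real"
  assumes T: "stopping_time (Filt X) T" and g: "g \<in> borel_measurable (aug_filt X \<infinity>)"
    and c: "\<And>\<omega>. 0 \<le> g \<omega>" "\<And>\<omega>. g \<omega> \<le> c"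
  shows "(AE \<omega> in Law X z. g (Shift X (T \<omega>) \<omega>) = 0) \<longleftrightarrow>
    (AE \<omega> in Law X z. AE \<omega>' in Law X (Pos X (T \<omega>) \<omega>). g \<omega>' = 0)"
proof -
  have c': "\<bar>g \<omega>\<bar> \<le> c" for \<omega> using c[of \<omega>] by simp
  note S = strong_markov_aug[OF T g c', of z]
  have fin: "finite_measure (completion (Law X z))"
    using finite_measure.emeasure_finite[OF finite_measure_Law, of z "space (Law X z)"]
    by (intro finite_measureI) simp
  have i0: "(\<integral>\<omega>'. g \<omega>' \<partial>Law X y) = 0 \<longleftrightarrow> (AE \<omega>' in Law X y. g \<omega>' = 0)" for y
    by (rule integral_nonneg_eq_0_iff_AE[OF integrable_bounded_Law[OF measurable_aug_Law[OF g] c']]) (simp add: c)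
  have I: "0 \<le> (\<integral>\<omega>'. g \<omega>' \<partial>Law X y)" "(\<integral>\<omega>'. g \<omega>' \<partial>Law X y) \<le> c" for y
    using c prob_space.integral_le_const[OF prob_space_Law integrable_bounded_Law[OF measurable_aug_Law[OF g] c'], of c]
    by (auto intro: integral_nonneg_AE)
  have "(AE \<omega> in completion (Law X z). g (Shift X (T \<omega>) \<omega>) = 0) \<longleftrightarrow> (\<integral>\<omega>. g (Shift X (T \<omega>) \<omega>) \<partial>completion (Law X z)) = 0"
    by (rule integral_nonneg_eq_0_iff_AE[symmetric])
       (auto intro!: finite_measure.integrable_const_bound[OF fin, of _ c] S(1) simp: c)
  also have "\<dots> \<longleftrightarrow> (\<integral>\<omega>. (\<integral>\<omega>'. g \<omega>' \<partial>Law X (Pos X (T \<omega>) \<omega>)) \<partial>completion (Law X z)) = 0"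
    unfolding S(3) ..
  also have "\<dots> \<longleftrightarrow> (AE \<omega> in completion (Law X z). (\<integral>\<omega>'. g \<omega>' \<partial>Law X (Pos X (T \<omega>) \<omega>)) = 0)"
    by (rule integral_nonneg_eq_0_iff_AE)
       (auto intro!: finite_measure.integrable_const_bound[OF fin, of _ c] S(2) simp: I)
  finally show ?thesis unfolding AE_completion_iff i0 .
qed

section \<open>Right-continuous paths and optional times\<close>

definition rc_paths :: "'w set" where
  "rc_paths = {\<omega>\<in>Path X. \<forall>t<\<infinity>. limitin comp_top (\<lambda>s. Pos X s \<omega>) (Pos X t \<omega>) (at_right t)}"

lemma rc_paths_AE: "AE \<omega> in Law X z. \<omega> \<in> rc_paths"
  using right_cont_AE AE_space by eventually_elim (simp add: rc_paths_def space_Law)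

lemma limitin_comp_top_const: "(\<And>s. f s = l) \<Longrightarrow> limitin comp_top f l F"
  by (simp add: limitin_def topspace_comp_top)

lemma rc_paths_Shift:
  assumes \<omega>: "\<omega> \<in> rc_paths" shows "Shift X s \<omega> \<in> rc_paths"
proof -
  have P: "\<omega> \<in> Path X" using \<omega> by (simp add: rc_paths_def)
  have "limitin comp_top (\<lambda>r. Pos X (s + r) \<omega>) (Pos X (s + t) \<omega>) (at_right t)" if t: "t < \<infinity>" for t
  proof (cases "s = top")
    case True
    then show ?thesis by (intro limitin_comp_top_const) simp
  next
    case False
    then have st: "s + t < top" using t by (simp add: less_top)
    then have "limitin comp_top (\<lambda>s. Pos X s \<omega>) (Pos X (s + t) \<omega>) (at_right (s + t))"
      using \<omega> by (simp add: rc_paths_def)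
    moreover have "filterlim (\<lambda>r. s + r) (at_right (s + t)) (at_right t)"
      unfolding filterlim_at_right_iff
    proof
      show "((\<lambda>r. s + r) \<longlongrightarrow> s + t) (at_right t)" by (intro tendsto_add tendsto_const tendsto_ident_at)
      show "\<forall>\<^sub>F r in at_right t. s + t < s + r"
        using False by (auto simp: eventually_at_filter ennreal_add_left_cancel_less intro!: always_eventually)
    qed
    ultimately show ?thesis unfolding limitin_def by (auto simp: filterlim_iff)
  qed
  then show ?thesis using P by (simp add: rc_paths_def Shift_Path Pos_Shift)
qed

lemma rc_paths_tendsto:
  fixes f :: "'a \<Rightarrow> real"
  assumes "\<omega> \<in> rc_paths" "f \<in> C0" "t < top"
  shows "((\<lambda>s. ext0 f (Pos X s \<omega>)) \<longlongrightarrow> ext0 f (Pos X t \<omega>)) (at_right t)"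
  using assms by (intro ext0_tendsto) (auto simp: rc_paths_def)

lemma rc_paths_tendsto_real:
  fixes f :: "'a \<Rightarrow> real"
  assumes "\<omega> \<in> rc_paths" "f \<in> C0" "t \<ge> 0"
  shows "((\<lambda>s. ext0 f (Pos X (ennreal s) \<omega>)) \<longlongrightarrow> ext0 f (Pos X (ennreal t) \<omega>)) (at_right t)"
  by (rule filterlim_compose[OF rc_paths_tendsto filterlim_ennreal_at_right]) (use assms in auto)

text \<open>Right continuity of the filtration is the reason: {T <= s} is the intersection of the
  events {T < u n} for levels u n above s tending to s, and cutting the levels at r > s places the
  event in \<open>Filt X r\<close>.\<close>

lemma stopping_timeI_less:
  assumes T: "\<And>t. {\<omega>\<in>Path X. T \<omega> < t} \<in> sets (Filt X t)"
  shows "stopping_time (Filt X) T"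
proof
  fix s :: ennreal
  show "Measurable.pred (Filt X s) (\<lambda>\<omega>. T \<omega> \<le> s)"
  proof (cases "s = top")
    case False
    then have s: "s < \<infinity>" by (simp add: less_top)
    have "{\<omega>\<in>Path X. T \<omega> \<le> s} \<in> sets (Filt X r)" if r: "s < r" for r
    proof -
      obtain u where u: "\<And>n::nat. s < u n" "u \<longlonglongrightarrow> s" using approx_from_above_dense_linorder[OF r] by blast
      have "T \<omega> \<le> s \<longleftrightarrow> (\<forall>n. T \<omega> < min (u n) r)" for \<omega>
      proof
        show "T \<omega> \<le> s \<Longrightarrow> \<forall>n. T \<omega> < min (u n) r" using u(1) r by (auto intro: le_less_trans)
        assume "\<forall>n. T \<omega> < min (u n) r"
        then show "T \<omega> \<le> s" by (intro LIMSEQ_le_const[OF u(2)]) (auto intro: less_imp_le)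
      qed
      then have "{\<omega>\<in>Path X. T \<omega> \<le> s} = (\<Inter>n. {\<omega>\<in>Path X. T \<omega> < min (u n) r})" by auto
      also have "\<dots> \<in> sets (Filt X r)"
      proof -
        have "{\<omega>\<in>Path X. T \<omega> < min (u n) r} \<in> sets (Filt X r)" for n
          using T[of "min (u n) r"] sets_F_mono[of "min (u n) r" r] by auto
        then show ?thesis by blast
      qed
      finally show ?thesis .
    qed
    then show ?thesis unfolding pred_def space_F Filt_right[OF s] by blast
  qed simp
qed

end

section \<open>Inverse of the additive functional\<close>

locale time_change = std_process X
  for X :: "('w, 'a::{metric_space, second_countable_topology}) process" +
  fixes A :: "real \<Rightarrow> 'w \<Rightarrow> real" and L :: "'w set"
  assumes A_aug: "0 \<le> t \<Longrightarrow> A t \<in> borel_measurable (aug_filt X (ennreal t))"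
    and L_sets: "L \<in> sets (aug_filt X \<infinity>)"
    and L_AE: "AE \<omega> in Law X (Some x). \<omega> \<in> L"
    and L_Shift: "\<omega> \<in> L \<Longrightarrow> 0 \<le> t \<Longrightarrow> Shift X (ennreal t) \<omega> \<in> L"
    and A_0: "\<omega> \<in> L \<Longrightarrow> A 0 \<omega> = 0"
    and A_nonneg: "\<omega> \<in> L \<Longrightarrow> 0 \<le> t \<Longrightarrow> 0 \<le> A t \<omega>"
    and A_cont: "\<omega> \<in> L \<Longrightarrow> continuous_on {0..} (\<lambda>t. A t \<omega>)"
    and A_lifetime: "\<omega> \<in> L \<Longrightarrow> 0 \<le> s \<Longrightarrow> s \<le> t \<Longrightarrow> lifetime X \<omega> \<le> ennreal s \<Longrightarrow> A t \<omega> = A s \<omega>"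
    and A_add: "\<omega> \<in> L \<Longrightarrow> 0 \<le> s \<Longrightarrow> 0 \<le> t \<Longrightarrow> A (s + t) \<omega> = A s \<omega> + A t (Shift X (ennreal s) \<omega>)"
begin

abbreviation tau :: "real \<Rightarrow> 'w \<Rightarrow> ennreal" where
  "tau \<equiv> inverse_pcaf A"

lemma L_Path: "\<omega> \<in> L \<Longrightarrow> \<omega> \<in> Path X"
  using sets.sets_into_space[OF L_sets] by (auto simp: space_aug)

lemma A_mono: "\<omega> \<in> L \<Longrightarrow> 0 \<le> s \<Longrightarrow> s \<le> t \<Longrightarrow> A s \<omega> \<le> A t \<omega>"
  using A_add[of \<omega> s "t - s"] A_nonneg[OF L_Shift, of \<omega> s "t - s"] by simp

text \<open>Strictness on both sides relies on continuity of \<open>A\<close>: if A s exceeds t,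
  there is a time r < s at which \<open>A\<close> takes the value halfway between t and A s.\<close>

lemma tau_less_iff:
  assumes \<omega>: "\<omega> \<in> L" and t: "0 \<le> t" and s: "0 \<le> s"
  shows "tau t \<omega> < ennreal s \<longleftrightarrow> t < A s \<omega>"
proof
  assume "tau t \<omega> < ennreal s"
  then obtain r where r: "0 \<le> r" "t < A r \<omega>" "ennreal r < ennreal s"
    unfolding inverse_pcaf_def Inf_less_iff by blast
  then have "r \<le> s" using s by (simp add: ennreal_less_iff)
  then show "t < A s \<omega>" using r A_mono[OF \<omega>, of r s] by linarith
next
  assume ts: "t < A s \<omega>"
  have c: "continuous_on {0..s} (\<lambda>r. A r \<omega>)" using A_cont[OF \<omega>] by (rule continuous_on_subset) auto
  obtain r where r: "0 \<le> r" "r \<le> s" "A r \<omega> = (t + A s \<omega>) / 2"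
    using IVT'[of "\<lambda>r. A r \<omega>" 0 "(t + A s \<omega>) / 2" s] c s t ts A_0[OF \<omega>] by auto
  have "r \<noteq> s" using r(3) ts by auto
  have "tau t \<omega> \<le> ennreal r" unfolding inverse_pcaf_def using r ts by (intro Inf_lower) auto
  also have "ennreal r < ennreal s" using r \<open>r \<noteq> s\<close> by (intro ennreal_lessI) auto
  finally show "tau t \<omega> < ennreal s" .
qed

text \<open>Continuity excludes jumping over the level t. Were \<open>A\<close> still below t at
  time \<open>T\<close>, it would remain so slightly later, although t is exceeded at every time
  after \<open>T\<close>.\<close>

lemma A_tau:
  assumes \<omega>: "\<omega> \<in> L" and t: "0 \<le> t" and T: "0 \<le> T" "tau t \<omega> = ennreal T"
  shows "A T \<omega> = t"
proof (rule antisym)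
  show "A T \<omega> \<le> t" using tau_less_iff[OF \<omega> t T(1)] T(2) by auto
  show "t \<le> A T \<omega>"
  proof (rule ccontr)
    assume "\<not> t \<le> A T \<omega>"
    moreover have "((\<lambda>s. A s \<omega>) \<longlongrightarrow> A T \<omega>) (at T within {0..})"
      using A_cont[OF \<omega>] T(1) by (simp add: continuous_on_def)
    ultimately have "\<forall>\<^sub>F s in at T within {0..}. A s \<omega> < t" by (intro order_tendstoD) auto
    then obtain d where d: "d > 0" "\<And>s. s \<in> {0..} \<Longrightarrow> s \<noteq> T \<Longrightarrow> dist s T < d \<Longrightarrow> A s \<omega> < t"
      unfolding eventually_at by blast
    have "A (T + d/2) \<omega> < t" using d T(1) by (intro d(2)) (auto simp: dist_real_def)
    moreover have "tau t \<omega> < ennreal (T + d/2)" using d(1) T by (simp add: ennreal_less_iff)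
    then have "t < A (T + d/2) \<omega>" using tau_less_iff[OF \<omega> t, of "T + d/2"] d(1) T(1) by auto
    ultimately show False by simp
  qed
qed

lemma tau_finite_E:
  assumes "tau t \<omega> < top"
  obtains T where "0 \<le> T" "tau t \<omega> = ennreal T"
  using assms by (cases "tau t \<omega>") auto

text \<open>The level t is exceeded immediately after tau t, whereas \<open>A\<close> no longer
  grows once the path has died.\<close>

lemma tau_finite_alive:
  assumes \<omega>: "\<omega> \<in> L" and t: "0 \<le> t" and fin: "tau t \<omega> < top"
  shows "Pos X (tau t \<omega>) \<omega> \<noteq> None"
proof
  assume N: "Pos X (tau t \<omega>) \<omega> = None"
  obtain T where T: "0 \<le> T" "tau t \<omega> = ennreal T" using fin by (rule tau_finite_E)
  have "lifetime X \<omega> \<le> ennreal T" unfolding lifetime_def using N T by (intro Inf_lower) auto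
  then have "A (T + 1) \<omega> = A T \<omega>" using T by (intro A_lifetime[OF \<omega>]) auto
  moreover have "tau t \<omega> < ennreal (T + 1)" using T by (simp add: ennreal_less_iff)
  then have "t < A (T + 1) \<omega>" using tau_less_iff[OF \<omega> t, of "T + 1"] T(1) by simp
  ultimately show False using A_tau[OF \<omega> t T] by simp
qed

lemma tau_mono: "s \<le> t \<Longrightarrow> tau s \<omega> \<le> tau t \<omega>"
  unfolding inverse_pcaf_def by (rule Inf_superset_mono) auto

lemma tau_right_cont:
  assumes \<omega>: "\<omega> \<in> L" and t: "0 \<le> t" and r: "tau t \<omega> < r"
  shows "\<exists>d>t. \<forall>s. s < d \<longrightarrow> tau s \<omega> < r"
proof -
  obtain q where q: "tau t \<omega> < q" "q < r" using dense[OF r] by blast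
  then have "q < top" using less_le_trans[OF q(2), of top] by simp
  then obtain q' where q': "0 \<le> q'" "q = ennreal q'" by (cases q) auto
  have d: "t < A q' \<omega>" using tau_less_iff[OF \<omega> t q'(1)] q(1) q'(2) by simp
  have "tau s \<omega> < r" if s: "s < A q' \<omega>" for s
  proof -
    have "tau s \<omega> \<le> q" unfolding inverse_pcaf_def using s q' by (intro Inf_lower) auto
    then show ?thesis using q(2) by simp
  qed
  then show ?thesis using d by blast
qed

lemma tau_pos:
  assumes \<omega>: "\<omega> \<in> L" and t: "0 < t" shows "0 < tau t \<omega>"
proof (rule ccontr)
  assume "\<not> 0 < tau t \<omega>"
  then have "tau t \<omega> = ennreal 0" by simp
  then show False using A_tau[OF \<omega>, of t 0] A_0[OF \<omega>] t by simp
qed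

text \<open>Both sides have the same strict upper bounds: since \<open>A\<close> equals t at time
  \<open>T\<close>, additivity turns an excess over t + s at time T + r into an excess over s at
  time r for the shifted path.\<close>

lemma tau_Shift:
  assumes \<omega>: "\<omega> \<in> L" and t: "0 \<le> t" and s: "0 \<le> s" and T: "0 \<le> T" "tau t \<omega> = ennreal T"
  shows "ennreal T + tau s (Shift X (ennreal T) \<omega>) = tau (t + s) \<omega>"
proof -
  let ?a = "tau s (Shift X (ennreal T) \<omega>)" and ?b = "tau (t + s) \<omega>"
  have iff: "?a < ennreal r \<longleftrightarrow> ?b < ennreal (T + r)" if r: "0 \<le> r" for r
    using tau_less_iff[OF L_Shift[OF \<omega> T(1)] s r] tau_less_iff[OF \<omega>, of "t + s" "T + r"]
      A_add[OF \<omega> T(1) r] A_tau[OF \<omega> t T] t s T(1) r by auto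
  have Tb: "ennreal T \<le> ?b" using tau_mono[of t "t + s" \<omega>] s T(2) by simp
  show ?thesis
  proof (rule linorder_cases[of "ennreal T + ?a" ?b])
    assume "ennreal T + ?a < ?b"
    then obtain q where q: "ennreal T + ?a < q" "q < ?b" using dense by blast
    then obtain q' where q': "0 \<le> q'" "q = ennreal q'" by (cases q) auto
    have Tq: "T \<le> q'"
    proof -
      have "ennreal T \<le> ennreal T + ?a" by simp
      then have "ennreal T < ennreal q'" using q(1) q'(2) by (metis le_less_trans)
      then show ?thesis using T(1) by (simp add: ennreal_less_iff)
    qed
    have "ennreal T + ?a < ennreal T + ennreal (q' - T)"
      using q(1) q' T(1) Tq by (simp add: ennreal_plus[symmetric] del: ennreal_plus)
    then have "?a < ennreal (q' - T)" by (simp add: ennreal_add_left_cancel_less)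
    then have "?b < ennreal q'" using iff[of "q' - T"] Tq by simp
    then show ?thesis using q(2) q'(2) by simp
  next
    assume "?b < ennreal T + ?a"
    then obtain q where q: "?b < q" "q < ennreal T + ?a" using dense by blast
    then obtain q' where q': "0 \<le> q'" "q = ennreal q'" by (cases q) auto
    have Tq: "T \<le> q'" using Tb q(1) q' T(1) by (metis ennreal_less_iff less_imp_le le_less_trans)
    have "?a < ennreal (q' - T)" using iff[of "q' - T"] Tq q(1) q'(2) by simp
    then have "ennreal T + ?a < ennreal T + ennreal (q' - T)" by (simp add: ennreal_add_left_cancel_less)
    also have "\<dots> = q" using q' T(1) Tq by (simp add: ennreal_plus[symmetric] del: ennreal_plus)
    finally show ?thesis using q(2) by simp
  qed
qed

text \<open>Off the defining set \<open>L\<close> the paths of \<open>A\<close> are arbitrary and \<open>L\<close> need not belong to the filtration; restricting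
  to rational times yields an honest stopping time.\<close>

definition rtau :: "real \<Rightarrow> 'w \<Rightarrow> ennreal" where
  "rtau t \<omega> = (INF q\<in>{q\<in>\<rat>. 0 \<le> q}. if t < A q \<omega> then ennreal q else top)"

lemma rtau_less_iff: "rtau t \<omega> < s \<longleftrightarrow> (\<exists>q\<in>{q\<in>\<rat>. 0 \<le> q}. t < A q \<omega> \<and> ennreal q < s)"
  unfolding rtau_def INF_less_iff by (auto split: if_splits)

text \<open>By monotonicity of \<open>A\<close> on \<open>L\<close>, every time beyond tau t is
  preceded by a rational time at which the level is already exceeded.\<close>

lemma rtau_eq:
  assumes \<omega>: "\<omega> \<in> L" and t: "0 \<le> t" shows "rtau t \<omega> = tau t \<omega>"
proof (rule linorder_cases[of "rtau t \<omega>" "tau t \<omega>"])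
  assume "rtau t \<omega> < tau t \<omega>"
  then obtain q where "0 \<le> q" "t < A q \<omega>" "ennreal q < tau t \<omega>" unfolding rtau_less_iff by blast
  then show ?thesis using tau_less_iff[OF \<omega> t, of q] by auto
next
  assume "tau t \<omega> < rtau t \<omega>"
  then obtain s where s: "tau t \<omega> < s" "s < rtau t \<omega>" using dense by blast
  obtain s' where s': "0 \<le> s'" "s = ennreal s'" using s(2) by (cases s) auto
  obtain r where r: "s < r" "r < rtau t \<omega>" using dense[OF s(2)] by blast
  obtain r' where r': "0 \<le> r'" "r = ennreal r'" using r(2) by (cases r) auto
  have "s' < r'" using r(1) s' r' by (simp add: ennreal_less_iff)
  then obtain q where q: "q \<in> \<rat>" "s' < q" "q < r'" using Rats_dense_in_real by blast
  have "t < A s' \<omega>" using tau_less_iff[OF \<omega> t s'(1)] s(1) s'(2) by simp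
  then have "t < A q \<omega>" using A_mono[OF \<omega> s'(1), of q] q(2) by simp
  moreover have "ennreal q < r" using q r' s'(1) by (auto intro!: ennreal_lessI)
  ultimately have "rtau t \<omega> < r" unfolding rtau_less_iff using q s'(1) by (auto intro!: bexI[of _ q])
  then show ?thesis using r(2) by simp
qed auto

lemma A_aug_infinity: "0 \<le> t \<Longrightarrow> A t \<in> borel_measurable (aug_filt X \<infinity>)"
proof (rule measurableI)
  fix S :: "real set" assume t: "0 \<le> t" and S: "S \<in> sets borel"
  have "sets (aug_filt X (ennreal t)) \<subseteq> sets (aug_filt X \<infinity>)"
  proof -
    have nat: "sets (natural_filt X (ennreal t)) \<subseteq> sets (natural_filt X \<infinity>)"
      unfolding sets_natural by (rule sigma_sets_mono') auto
    show ?thesis unfolding sets_aug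
      by (rule sigma_sets_mono') (use nat in blast)
  qed
  then show "A t -` S \<inter> space (aug_filt X \<infinity>) \<in> sets (aug_filt X \<infinity>)"
    using measurable_sets[OF A_aug[OF t] S] by (auto simp: space_aug)
qed simp

lemma rtau_stopping: "stopping_time (Filt X) (rtau t)"
proof (rule stopping_timeI_less)
  fix s :: ennreal
  have "{\<omega>\<in>Path X. rtau t \<omega> < s} = (\<Union>q\<in>{q\<in>\<rat>. 0 \<le> q \<and> ennreal q < s}. {\<omega>\<in>Path X. t < A q \<omega>})"
    by (auto simp: rtau_less_iff)
  also have "\<dots> \<in> sets (Filt X s)"
  proof (rule sets.countable_UN'')
    show "countable {q \<in> \<rat>. 0 \<le> (q::real) \<and> ennreal q < s}" by (rule countable_subset[OF _ countable_rat]) auto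
    show "{\<omega>\<in>Path X. t < A q \<omega>} \<in> sets (Filt X s)" if q: "q \<in> {q \<in> \<rat>. 0 \<le> q \<and> ennreal q < s}" for q
    proof -
      have "0 \<le> q" using q by simp
      note m [measurable] = A_aug[OF this]
      have "{\<omega>\<in>space (aug_filt X (ennreal q)). t < A q \<omega>} \<in> sets (aug_filt X (ennreal q))" by measurable
      then show ?thesis using aug_le_Filt[of "ennreal q"] sets_F_mono[of "ennreal q" s] q
        by (auto simp: space_aug intro: less_imp_le)
    qed
  qed
  finally show "{\<omega>\<in>Path X. rtau t \<omega> < s} \<in> sets (Filt X s)" .
qed

lemma rtau_measurable: "(\<lambda>(t, \<omega>). rtau t \<omega>) \<in> borel_measurable (borel \<Otimes>\<^sub>M aug_filt X \<infinity>)"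
proof -
  have "countable {q::real. q \<in> \<rat> \<and> 0 \<le> q}" by (rule countable_subset[OF _ countable_rat]) auto
  moreover have "(\<lambda>x. if fst x < A q (snd x) then ennreal q else top) \<in> borel_measurable (borel \<Otimes>\<^sub>M aug_filt X \<infinity>)"
    if "0 \<le> q" for q
  proof -
    note [measurable] = A_aug_infinity[OF that]
    show ?thesis by measurable
  qed
  ultimately show ?thesis unfolding rtau_def split_beta' by (intro borel_measurable_INF) auto
qed

text \<open>\<open>L\<close> is known to have full measure only for starting points in the space.
  Adding the paths that are dead from the start gives full measure under every law, the one from the
  cemetery included, and stability under all shifts: the shift by infinity produces a dead
  path.\<close>

definition good :: "'w set" where
  "good = {\<omega>\<in>rc_paths. \<omega> \<in> L \<or> (\<forall>t. Pos X t \<omega> = None)}"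

lemma good_Path: "\<omega> \<in> good \<Longrightarrow> \<omega> \<in> Path X"
  by (simp add: good_def rc_paths_def)

lemma good_rc: "\<omega> \<in> good \<Longrightarrow> \<omega> \<in> rc_paths"
  by (simp add: good_def)

lemma good_AE: "AE \<omega> in Law X z. \<omega> \<in> good"
proof (cases z)
  case None
  show ?thesis using rc_paths_AE Pos_0_AE AE_space
  proof eventually_elim
    case (elim \<omega>)
    then have "Pos X t \<omega> = None" for t using Pos_absorb[of \<omega> 0 t] None by (simp add: space_Law)
    then show ?case using elim by (simp add: good_def)
  qed
next
  case (Some x)
  show ?thesis unfolding Some using rc_paths_AE L_AE by eventually_elim (simp add: good_def)
qed

lemma good_L_AE: "AE \<omega> in Law X (Some x). \<omega> \<in> good \<and> \<omega> \<in> L"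
  using good_AE L_AE by eventually_elim simp

lemma good_Shift: "\<omega> \<in> good \<Longrightarrow> Shift X s \<omega> \<in> good"
proof -
  assume \<omega>: "\<omega> \<in> good"
  have P: "\<omega> \<in> Path X" by (rule good_Path[OF \<omega>])
  consider "s = top" | "\<forall>t. Pos X t \<omega> = None" | "s < top" "\<omega> \<in> L"
    using \<omega> by (auto simp: good_def less_top[symmetric])
  then show ?thesis
  proof cases
    case 3
    then show ?thesis using L_Shift[of \<omega> "enn2real s"] rc_paths_Shift[OF good_rc[OF \<omega>]]
      by (simp add: good_def)
  qed (use rc_paths_Shift[OF good_rc[OF \<omega>]] Pos_infinity[OF P] in \<open>simp_all add: good_def Pos_Shift[OF P]\<close>)
qed

text \<open>Beyond \<open>tau_Shift\<close> two degenerate cases have to fit: for a dead path or an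
  infinite tau t both positions are the cemetery.\<close>

lemma Pos_tau_Shift:
  assumes \<omega>: "\<omega> \<in> good" and t: "0 \<le> t" and s: "0 \<le> s"
  shows "Pos X (tau s (Shift X (tau t \<omega>) \<omega>)) (Shift X (tau t \<omega>) \<omega>) = Pos X (tau (t + s) \<omega>) \<omega>"
proof -
  have P: "\<omega> \<in> Path X" by (rule good_Path[OF \<omega>])
  consider "\<forall>t. Pos X t \<omega> = None" | "\<omega> \<in> L" "tau t \<omega> < top" | "tau t \<omega> = top"
    using \<omega> by (auto simp: good_def less_top[symmetric])
  then show ?thesis
  proof cases
    case 2
    obtain T where T: "0 \<le> T" "tau t \<omega> = ennreal T" using 2(2) by (rule tau_finite_E)
    show ?thesis unfolding Pos_Shift[OF P] T(2) tau_Shift[OF 2(1) t s T] ..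
  next
    case 3
    then have "tau (t + s) \<omega> = top" using tau_mono[of t "t + s" \<omega>] s by (simp add: top_unique)
    then show ?thesis using 3 Pos_infinity[OF P] by (simp add: Pos_Shift[OF P])
  qed (simp add: Pos_Shift[OF P])
qed

lemma rtau_Pos:
  assumes "\<omega> \<in> good" "0 \<le> t" shows "Pos X (rtau t \<omega>) \<omega> = Pos X (tau t \<omega>) \<omega>"
  using assms rtau_eq by (auto simp: good_def)

lemma Pos_tau_tendsto:
  fixes f :: "'a \<Rightarrow> real"
  assumes \<omega>: "\<omega> \<in> good" and f: "f \<in> C0" and t: "0 \<le> t"
  shows "((\<lambda>s. ext0 f (Pos X (tau s \<omega>) \<omega>)) \<longlongrightarrow> ext0 f (Pos X (tau t \<omega>) \<omega>)) (at_right t)"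
proof -
  have P: "\<omega> \<in> Path X" by (rule good_Path[OF \<omega>])
  consider "\<forall>t. Pos X t \<omega> = None" | "\<omega> \<in> L" "tau t \<omega> < top" | "tau t \<omega> = top"
    using \<omega> by (auto simp: good_def less_top[symmetric])
  then show ?thesis
  proof cases
    case 2
    show ?thesis
    proof (rule tendstoI)
      fix e :: real assume "e > 0"
      then have "\<forall>\<^sub>F s in at_right (tau t \<omega>). dist (ext0 f (Pos X s \<omega>)) (ext0 f (Pos X (tau t \<omega>) \<omega>)) < e"
        using rc_paths_tendsto[OF good_rc[OF \<omega>] f 2(2)] by (auto dest: tendstoD)
      then obtain b where b: "b > tau t \<omega>"
        "\<And>s. s > tau t \<omega> \<Longrightarrow> s < b \<Longrightarrow> dist (ext0 f (Pos X s \<omega>)) (ext0 f (Pos X (tau t \<omega>) \<omega>)) < e"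
        unfolding eventually_at_right_ennreal[OF 2(2)] by blast
      obtain d where d: "d > t" "\<And>s. s < d \<Longrightarrow> tau s \<omega> < b"
        using tau_right_cont[OF 2(1) t b(1)] by blast
      \<comment> \<open>tau may be constant to the right of t. Then the distance is 0, while
        \<open>b\<close> only controls times strictly after tau t; hence the case
        distinction.\<close>
      have "dist (ext0 f (Pos X (tau s \<omega>) \<omega>)) (ext0 f (Pos X (tau t \<omega>) \<omega>)) < e" if "s > t" "s < d" for s
        using b(2)[of "tau s \<omega>"] d(2)[OF that(2)] tau_mono[of t s \<omega>] that(1) \<open>e > 0\<close>
        by (cases "tau s \<omega> = tau t \<omega>") auto
      then show "\<forall>\<^sub>F s in at_right t. dist (ext0 f (Pos X (tau s \<omega>) \<omega>)) (ext0 f (Pos X (tau t \<omega>) \<omega>)) < e"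
        using d(1) by (auto simp: eventually_at_right_field)
    qed
  next
    case 3
    then have "tau s \<omega> = top" if "s > t" for s using tau_mono[of t s \<omega>] that by (simp add: top_unique)
    then have "\<forall>\<^sub>F s in at_right t. ext0 f (Pos X (tau t \<omega>) \<omega>) = ext0 f (Pos X (tau s \<omega>) \<omega>)"
      using 3 by (auto simp: eventually_at_filter)
    then show ?thesis by (rule Lim_transform_eventually[OF tendsto_const])
  qed simp
qed

text \<open>The position at tau is not known to be jointly measurable in time and path. Evaluating
  the right-continuous path at \<open>rtau\<close> by dyadic approximation gives a measurable
  function that agrees with it on \<open>good\<close>.\<close>

lemma version_exists:
  fixes f :: "'a \<Rightarrow> real"
  assumes f: "f \<in> C0"
  shows "\<exists>\<Phi>\<in>borel_measurable (borel \<Otimes>\<^sub>M aug_filt X \<infinity>).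
    (\<forall>t\<ge>0. \<forall>\<omega>\<in>good. \<Phi> (t, \<omega>) = ext0 f (Pos X (tau t \<omega>) \<omega>)) \<and> (\<forall>c. (\<forall>x. \<bar>f x\<bar> \<le> c) \<longrightarrow> (\<forall>p. \<bar>\<Phi> p\<bar> \<le> c))"
proof -
  note [measurable] = rtau_measurable
  let ?M = "borel \<Otimes>\<^sub>M aug_filt X \<infinity>"
  have "(\<lambda>p. ext0 f (Pos X (ennreal r) (snd p))) \<in> borel_measurable ?M" for r
    by (rule measurable_compose[OF measurable_compose[OF measurable_snd Pos_aug] ext0_measurable[OF C0_measurable[OF f]]]) simp
  moreover have "(\<lambda>p. enn2real ((\<lambda>(t, \<omega>). rtau t \<omega>) p)) \<in> borel_measurable ?M" by measurable
  ultimately obtain Z where Z: "Z \<in> borel_measurable ?M"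
    "\<And>p. ((\<lambda>t. ext0 f (Pos X (ennreal t) (snd p))) \<longlongrightarrow> ext0 f (Pos X (ennreal (enn2real (rtau (fst p) (snd p)))) (snd p)))
        (at_right (enn2real (rtau (fst p) (snd p)))) \<Longrightarrow> Z p = ext0 f (Pos X (ennreal (enn2real (rtau (fst p) (snd p)))) (snd p))"
    using right_continuous_compose_measurable[of "\<lambda>r p. ext0 f (Pos X (ennreal r) (snd p))" ?M "\<lambda>p. enn2real ((\<lambda>(t, \<omega>). rtau t \<omega>) p)"]
    by (force simp: split_beta)
  note [measurable] = Z(1)
  \<comment> \<open>The least bound of |f|: truncation at this level makes one version respect every
    bound \<open>c\<close> simultaneously.\<close>
  define C where "C = (SUP x. \<bar>f x\<bar>)"
  obtain B where B: "\<And>x. \<bar>f x\<bar> \<le> B" using C0_bounded[OF f] by blast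
  have C: "\<bar>f x\<bar> \<le> C" for x unfolding C_def by (rule cSUP_upper) (auto intro!: bdd_aboveI[of _ B] B)
  have C_le: "C \<le> c" if "\<forall>x. \<bar>f x\<bar> \<le> c" for c unfolding C_def using that by (intro cSUP_least) auto
  have C0: "0 \<le> C" using C[of undefined] by linarith
  \<comment> \<open>Infinite times are treated apart: \<open>enn2real\<close> would send them to
    time 0, whereas the position there is the cemetery, where the extended function is 0.\<close>
  define \<Psi> where "\<Psi> p = (if (\<lambda>(t, \<omega>). rtau t \<omega>) p = top then 0 else Z p)" for p
  have \<Psi>: "\<Psi> (t, \<omega>) = ext0 f (Pos X (tau t \<omega>) \<omega>)" if t: "0 \<le> t" and \<omega>: "\<omega> \<in> good" for t \<omega>
  proof (cases "rtau t \<omega> = top")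
    case True
    then show ?thesis using rtau_Pos[OF \<omega> t] Pos_infinity[OF good_Path[OF \<omega>]] by (simp add: \<Psi>_def)
  next
    case False
    have "Z (t, \<omega>) = ext0 f (Pos X (ennreal (enn2real (rtau (fst (t, \<omega>)) (snd (t, \<omega>))))) (snd (t, \<omega>)))"
      by (rule Z(2)) (use rc_paths_tendsto_real[OF good_rc[OF \<omega>] f] in simp)
    then show ?thesis using False rtau_Pos[OF \<omega> t] by (simp add: \<Psi>_def less_top)
  qed
  have "\<Psi> \<in> borel_measurable ?M" unfolding \<Psi>_def by measurable
  then have m: "(\<lambda>p. max (- C) (min C (\<Psi> p))) \<in> borel_measurable ?M" by measurable
  have cl: "max (- C) (min C (ext0 f z)) = ext0 f z" for z
  proof (cases z)
    case (Some x)
    then show ?thesis using C[of x] by simp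
  qed (use C0 in simp)
  have bd: "\<bar>max (- C) (min C r)\<bar> \<le> C" for r using C0 by linarith
  show ?thesis
  proof (rule bexI[OF _ m], intro conjI allI impI ballI)
    show "max (- C) (min C (\<Psi> (t, \<omega>))) = ext0 f (Pos X (tau t \<omega>) \<omega>)" if "0 \<le> t" "\<omega> \<in> good" for t \<omega>
      using \<Psi>[OF that] cl by simp
    show "\<bar>max (- C) (min C (\<Psi> p))\<bar> \<le> c" if "\<forall>x. \<bar>f x\<bar> \<le> c" for c p
      using bd[of "\<Psi> p"] C_le[OF that] by linarith
  qed
qed

end

section \<open>The Lebesgue-Stieltjes measure of the functional and the occupation formula\<close>

lemma emeasure_lborel_sandwich:
  fixes a b :: real
  assumes "a \<le> b" "{a<..<b} \<subseteq> E" "E \<subseteq> {a..b}" "E \<in> sets borel"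
  shows "emeasure lborel E = ennreal (b - a)"
proof (rule antisym)
  show "emeasure lborel E \<le> ennreal (b - a)"
    using emeasure_mono[OF assms(3), of lborel] assms(1) by simp
  show "ennreal (b - a) \<le> emeasure lborel E"
    using emeasure_mono[OF assms(2), of lborel] assms(1,4) by simp
qed

lemma interval_measure_unique:
  assumes F: "\<And>x y. x \<le> y \<Longrightarrow> F x \<le> F y" "\<And>a. continuous (at_right a) F"
    and M: "sets M = sets borel" "\<And>a b. a \<le> b \<Longrightarrow> emeasure M {a<..b} = ennreal (F b - F a)"
  shows "interval_measure F = M"
proof (rule measure_eqI_generator_eq[where \<Omega>=UNIV and E="range (\<lambda>(a, b). {a<..b})" and A="\<lambda>n::nat. {- real n<..real n}"])
  show "Int_stable (range (\<lambda>(a, b). {a<..b :: real}))"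
    by (auto simp: Int_stable_def)
  show "sets (interval_measure F) = sigma_sets UNIV (range (\<lambda>(a, b). {a<..b :: real}))"
    by (simp add: borel_sigma_sets_Ioc)
  then show "sets M = sigma_sets UNIV (range (\<lambda>(a, b). {a<..b :: real}))" using M(1) by simp
  show "emeasure (interval_measure F) E = emeasure M E" if "E \<in> range (\<lambda>(a, b). {a<..b :: real})" for E
  proof -
    obtain a b where E: "E = {a<..b}" using \<open>E \<in> _\<close> by auto
    show ?thesis unfolding E
      by (cases "a \<le> b") (simp_all add: emeasure_interval_measure_Ioc F M(2))
  qed
  show "(\<Union>n::nat. {- real n<..real n}) = UNIV"
  proof -
    have "\<exists>n::nat. - real n < x \<and> x \<le> real n" for x :: real
    proof -
      obtain n :: nat where "\<bar>x\<bar> < real n" using reals_Archimedean2 by blast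
      then show ?thesis by (intro exI[of _ n]) auto
    qed
    then show ?thesis by auto
  qed
  show "emeasure (interval_measure F) {- real n<..real n} \<noteq> \<infinity>" for n :: nat
    by (simp add: emeasure_interval_measure_Ioc F)
qed auto

lemma measurable_max_0: "(max 0 :: real \<Rightarrow> real) \<in> borel_measurable borel"
  by (rule borel_measurable_max[OF measurable_ident_sets[OF refl] borel_measurable_const])

context time_change
begin

lemma tau_borel:
  assumes \<omega>: "\<omega> \<in> L" shows "(\<lambda>t. tau (max 0 t) \<omega>) \<in> borel_measurable borel"
proof -
  have "(\<lambda>t::real. (max 0 t, \<omega>)) \<in> borel \<rightarrow>\<^sub>M borel \<Otimes>\<^sub>M aug_filt X \<infinity>"
  proof (rule measurable_Pair)
    show "(\<lambda>t::real. max 0 t) \<in> borel \<rightarrow>\<^sub>M borel" by (rule measurable_max_0)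
    show "(\<lambda>t::real. \<omega>) \<in> borel \<rightarrow>\<^sub>M aug_filt X \<infinity>" using L_Path[OF \<omega>] by (simp add: space_aug)
  qed
  from measurable_compose[OF this rtau_measurable] show ?thesis by (simp add: rtau_eq[OF \<omega>])
qed

text \<open>For a <= b the times t with a < tau t <= b fill the interval from A a to A b up to its
  end points, so the image of Lebesgue measure under tau has the increments of \<open>A\<close>. The
  \<open>max 0\<close> matches the constant extension of \<open>A\<close> to negative times.\<close>

lemma stieltjes_eq:
  assumes \<omega>: "\<omega> \<in> L"
  shows "stieltjes A \<omega> = distr (restrict_space lborel {t. 0 \<le> t \<and> tau (max 0 t) \<omega> < top}) borel (\<lambda>t. enn2real (tau (max 0 t) \<omega>))"
proof -
  note [measurable] = tau_borel[OF \<omega>]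
  let ?S = "{t. 0 \<le> t \<and> tau (max 0 t) \<omega> < top}" and ?T = "\<lambda>t. enn2real (tau (max 0 t) \<omega>)"
  have S: "?S \<in> sets borel" by measurable
  have T: "?T \<in> restrict_space lborel ?S \<rightarrow>\<^sub>M borel" by (rule measurable_restrict_space1) measurable
  show ?thesis unfolding stieltjes_def
  proof (rule interval_measure_unique)
    show "A (max 0 x) \<omega> \<le> A (max 0 y) \<omega>" if "x \<le> y" for x y using A_mono[OF \<omega>, of "max 0 x" "max 0 y"] that by simp
    show "continuous (at_right a) (\<lambda>t. A (max 0 t) \<omega>)" for a
    proof -
      have "continuous_on UNIV (\<lambda>t. A (max 0 t) \<omega>)"
        by (rule continuous_on_compose2[OF A_cont[OF \<omega>], of _ "\<lambda>t. max 0 t"]) (auto intro!: continuous_intros)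
      then show ?thesis by (simp add: continuous_on_eq_continuous_at continuous_at_imp_continuous_at_within)
    qed
    fix a b :: real assume ab: "a \<le> b"
    let ?E = "{t. 0 \<le> t \<and> tau (max 0 t) \<omega> < top \<and> a < ?T t \<and> ?T t \<le> b}"
    have E: "?E \<in> sets borel" by measurable
    have "emeasure (distr (restrict_space lborel ?S) borel ?T) {a<..b} = emeasure lborel ?E"
    proof -
      have "?T -` {a<..b} \<inter> space (restrict_space lborel ?S) = ?E" by (auto simp: space_restrict_space)
      moreover have "emeasure (restrict_space lborel ?S) ?E = emeasure lborel ?E"
        using S by (intro emeasure_restrict_space) auto
      ultimately show ?thesis by (subst emeasure_distr[OF T]) simp_all
    qed
    also have "\<dots> = ennreal (A (max 0 b) \<omega> - A (max 0 a) \<omega>)"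
    proof (rule emeasure_lborel_sandwich[OF _ _ _ E])
      show "A (max 0 a) \<omega> \<le> A (max 0 b) \<omega>" using A_mono[OF \<omega>, of "max 0 a" "max 0 b"] ab by simp
      show "{A (max 0 a) \<omega><..<A (max 0 b) \<omega>} \<subseteq> ?E"
      proof
        fix t assume t: "t \<in> {A (max 0 a) \<omega><..<A (max 0 b) \<omega>}"
        have t0: "0 \<le> t" using t A_nonneg[OF \<omega>, of "max 0 a"] by simp
        have lt: "tau t \<omega> < ennreal (max 0 b)" using tau_less_iff[OF \<omega> t0, of "max 0 b"] t by simp
        then have fin: "tau t \<omega> < top" using less_le_trans[OF lt, of top] by simp
        then obtain T where T: "0 \<le> T" "tau t \<omega> = ennreal T" by (rule tau_finite_E)
        have AT: "A T \<omega> = t" by (rule A_tau[OF \<omega> t0 T])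
        have "T < max 0 b" using lt T by (simp add: ennreal_less_iff)
        moreover have "max 0 a < T"
        proof (rule ccontr)
          assume "\<not> max 0 a < T"
          then have "A T \<omega> \<le> A (max 0 a) \<omega>" using T(1) by (intro A_mono[OF \<omega>]) auto
          then show False using AT t by simp
        qed
        ultimately show "t \<in> ?E" using t0 T fin by (auto simp: less_max_iff_disj)
      qed
      show "?E \<subseteq> {A (max 0 a) \<omega>..A (max 0 b) \<omega>}"
      proof
        fix t assume t: "t \<in> ?E"
        then have t0: "0 \<le> t" and fin: "tau t \<omega> < top" by auto
        from fin obtain T where T: "0 \<le> T" "tau t \<omega> = ennreal T" by (rule tau_finite_E)
        have AT: "A T \<omega> = t" by (rule A_tau[OF \<omega> t0 T])
        have "a < T" "T \<le> b" using t T t0 by auto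
        then show "t \<in> {A (max 0 a) \<omega>..A (max 0 b) \<omega>}"
          using A_mono[OF \<omega>, of "max 0 a" T] A_mono[OF \<omega>, of T "max 0 b"] T(1) AT by auto
      qed
    qed
    finally show "emeasure (distr (restrict_space lborel ?S) borel ?T) {a<..b} = ennreal (A (max 0 b) \<omega> - A (max 0 a) \<omega>)" .
  qed simp
qed

lemma Pos_borel:
  assumes "\<omega> \<in> rc_paths" shows "(\<lambda>s. Pos X (ennreal s) \<omega>) \<in> borel \<rightarrow>\<^sub>M comp_borel"
proof (rule measurable_comp_borelI[OF lc])
  fix f :: "'a \<Rightarrow> real" assume f: "f \<in> C0"
  obtain Z where Z: "Z \<in> borel_measurable borel"
    "\<forall>s::real. max 0 s \<ge> 0 \<longrightarrow> ((\<lambda>t. ext0 f (Pos X (ennreal t) \<omega>)) \<longlongrightarrow> ext0 f (Pos X (ennreal (max 0 s)) \<omega>)) (at_right (max 0 s))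
      \<longrightarrow> Z s = ext0 f (Pos X (ennreal (max 0 s)) \<omega>)"
    using right_continuous_compose_measurable[of "\<lambda>t s. ext0 f (Pos X (ennreal t) \<omega>)" borel "\<lambda>s. max 0 s"] by auto
  have "Z s = ext0 f (Pos X (ennreal s) \<omega>)" for s
  proof -
    have "ennreal (max 0 s) = ennreal s" by (cases "0 \<le> s") (auto simp: ennreal_neg)
    then show ?thesis using Z(2) rc_paths_tendsto_real[OF assms f, of "max 0 s"] by simp
  qed
  then have "Z = (\<lambda>s. ext0 f (Pos X (ennreal s) \<omega>))" by auto
  then show "(\<lambda>s. ext0 f (Pos X (ennreal s) \<omega>)) \<in> borel_measurable borel" using Z(1) by simp
qed

lemma stieltjes_time_change:
  fixes f :: "'a \<Rightarrow> ennreal"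
  assumes \<omega>: "\<omega> \<in> good" "\<omega> \<in> L" and f: "f \<in> borel_measurable borel"
  shows "(\<integral>\<^sup>+ s\<in>{0..}. ext0 f (Pos X (ennreal s) \<omega>) \<partial>stieltjes A \<omega>)
       = (\<integral>\<^sup>+ t\<in>{0..}. ext0 f (Pos X (tau t \<omega>) \<omega>) \<partial>lborel)"
proof -
  note [measurable] = tau_borel[OF \<omega>(2)]
  let ?S = "{t. 0 \<le> t \<and> tau (max 0 t) \<omega> < top}" and ?T = "\<lambda>t. enn2real (tau (max 0 t) \<omega>)"
  have S: "?S \<in> sets borel" by measurable
  have T: "?T \<in> restrict_space lborel ?S \<rightarrow>\<^sub>M borel" by (rule measurable_restrict_space1) measurable
  note [measurable] = measurable_compose[OF Pos_borel[OF good_rc[OF \<omega>(1)]] ext0_measurable[OF f]]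
  have m: "(\<lambda>s. ext0 f (Pos X (ennreal s) \<omega>) * indicator {0..} s) \<in> borel_measurable borel" by measurable
  have "(\<integral>\<^sup>+ s\<in>{0..}. ext0 f (Pos X (ennreal s) \<omega>) \<partial>stieltjes A \<omega>)
      = (\<integral>\<^sup>+ t. ext0 f (Pos X (ennreal (?T t)) \<omega>) * indicator {0..} (?T t) \<partial>restrict_space lborel ?S)"
    unfolding stieltjes_eq[OF \<omega>(2)] by (rule nn_integral_distr[OF T]) (use m in simp)
  also have "\<dots> = (\<integral>\<^sup>+ t. ext0 f (Pos X (ennreal (?T t)) \<omega>) * indicator {0..} (?T t) * indicator ?S t \<partial>lborel)"
    using S by (intro nn_integral_restrict_space) simp
  \<comment> \<open>Restricting to finite tau loses nothing: at infinite tau the position is the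
    cemetery and the integrand on the right is 0.\<close>
  also have "\<dots> = (\<integral>\<^sup>+ t\<in>{0..}. ext0 f (Pos X (tau t \<omega>) \<omega>) \<partial>lborel)"
  proof (rule nn_integral_cong)
    fix t :: real
    show "ext0 f (Pos X (ennreal (?T t)) \<omega>) * indicator {0..} (?T t) * indicator ?S t = ext0 f (Pos X (tau t \<omega>) \<omega>) * indicator {0..} t"
      using Pos_infinity[OF good_Path[OF \<omega>(1)]]
      by (cases "0 \<le> t"; cases "tau t \<omega> = top") (auto simp: less_top)
  qed
  finally show ?thesis .
qed

text \<open>\<open>version_exists\<close> treats one function in \<open>C0\<close> at a time, but
  Fubini for arbitrary Borel functions needs a single jointly measurable position process. For each
  starting point it is obtained by sending the process to the cemetery off a measurable set of full
  probability.\<close>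

lemma occ_exists:
  "\<exists>W. W \<in> borel \<Otimes>\<^sub>M Law X (Some x) \<rightarrow>\<^sub>M comp_borel \<and>
    (AE \<omega> in Law X (Some x). \<forall>t\<ge>0. W (t, \<omega>) = Pos X (tau t \<omega>) \<omega>)"
proof -
  obtain N where N: "{\<omega>\<in>space (Law X (Some x)). \<not> (\<omega> \<in> good \<and> \<omega> \<in> L)} \<subseteq> N" "emeasure (Law X (Some x)) N = 0" "N \<in> sets (Law X (Some x))"
    using AE_E[OF good_L_AE] by blast
  define G where "G = Path X - N"
  have G: "G \<in> sets (Law X (Some x))" "G \<subseteq> good"
    unfolding G_def using N(1,3) sets.top[of "Law X (Some x)"] by (auto simp: space_Law)
  define occ where "occ t \<omega> = (if \<omega> \<in> G then Pos X (tau (max 0 t) \<omega>) \<omega> else None)" for t \<omega>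
  have "(\<lambda>(t, \<omega>). occ t \<omega>) \<in> borel \<Otimes>\<^sub>M Law X (Some x) \<rightarrow>\<^sub>M comp_borel"
  proof (rule measurable_comp_borelI[OF lc])
    fix f :: "'a \<Rightarrow> real" assume "f \<in> C0"
    then obtain \<Phi> where \<Phi>: "\<Phi> \<in> borel_measurable (borel \<Otimes>\<^sub>M aug_filt X \<infinity>)"
      "\<And>t \<omega>. t \<ge> 0 \<Longrightarrow> \<omega> \<in> good \<Longrightarrow> \<Phi> (t, \<omega>) = ext0 f (Pos X (tau t \<omega>) \<omega>)"
      using version_exists by blast
    have "(\<lambda>\<omega>. \<omega>) \<in> Law X (Some x) \<rightarrow>\<^sub>M aug_filt X \<infinity>"
      using measurable_aug_Law[of "\<lambda>\<omega>. \<omega>" \<infinity> "aug_filt X \<infinity>"] measurable_ident_sets[OF refl] by blast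
    then have "(\<lambda>p::real \<times> _. (max 0 (fst p), snd p)) \<in> borel \<Otimes>\<^sub>M Law X (Some x) \<rightarrow>\<^sub>M borel \<Otimes>\<^sub>M aug_filt X \<infinity>"
      by (intro measurable_Pair measurable_compose[OF measurable_fst measurable_max_0] measurable_compose[OF measurable_snd])
    from measurable_compose[OF this \<Phi>(1)]
    have "(\<lambda>p. if snd p \<in> G then \<Phi> (max 0 (fst p), snd p) else 0) \<in> borel_measurable (borel \<Otimes>\<^sub>M Law X (Some x))"
      by (rule measurable_If) (use G(1) in measurable)
    moreover have "(\<lambda>p. if snd p \<in> G then \<Phi> (max 0 (fst p), snd p) else 0) = (\<lambda>p. ext0 f (case p of (t, \<omega>) \<Rightarrow> occ t \<omega>))"
      using \<Phi>(2) G(2) by (auto simp: occ_def fun_eq_iff)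
    ultimately show "(\<lambda>p. ext0 f (case p of (t, \<omega>) \<Rightarrow> occ t \<omega>)) \<in> borel_measurable (borel \<Otimes>\<^sub>M Law X (Some x))" by simp
  qed
  moreover have "AE \<omega> in Law X (Some x). \<omega> \<notin> N" using N(2,3) by (intro AE_not_in null_setsI)
  then have "AE \<omega> in Law X (Some x). \<forall>t\<ge>0. occ t \<omega> = Pos X (tau t \<omega>) \<omega>"
    using AE_space by eventually_elim (auto simp: occ_def G_def space_Law)
  ultimately show ?thesis by (intro exI[of _ "\<lambda>(t, \<omega>). occ t \<omega>"]) simp
qed

definition occ :: "'a \<Rightarrow> real \<Rightarrow> 'w \<Rightarrow> 'a option" where
  "occ x t \<omega> = (SOME W. W \<in> borel \<Otimes>\<^sub>M Law X (Some x) \<rightarrow>\<^sub>M comp_borel \<and>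
    (AE \<omega> in Law X (Some x). \<forall>t\<ge>0. W (t, \<omega>) = Pos X (tau t \<omega>) \<omega>)) (t, \<omega>)"

lemma occ_props:
  "(\<lambda>(t, \<omega>). occ x t \<omega>) \<in> borel \<Otimes>\<^sub>M Law X (Some x) \<rightarrow>\<^sub>M comp_borel"
  "AE \<omega> in Law X (Some x). \<forall>t\<ge>0. occ x t \<omega> = Pos X (tau t \<omega>) \<omega>"
  using someI_ex[OF occ_exists[of x]] unfolding occ_def by simp_all

lemma occ_measurable: "occ x t \<in> Law X (Some x) \<rightarrow>\<^sub>M comp_borel"
  using measurable_compose[OF measurable_Pair1' occ_props(1), of t] by simp

text \<open>Fubini's theorem and the change of variables t = A s: the potential of the additive
  functional is the potential of the time-changed process.\<close>

lemma occupation: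
  fixes f :: "'a \<Rightarrow> ennreal"
  assumes f: "f \<in> borel_measurable borel"
  shows "(\<integral>\<^sup>+ t\<in>{0..}. (\<integral>\<^sup>+ \<omega>. ext0 f (occ x t \<omega>) \<partial>Law X (Some x)) \<partial>lborel)
    = (\<integral>\<^sup>+ \<omega>. (\<integral>\<^sup>+ s\<in>{0..}. ext0 f (Pos X (ennreal s) \<omega>) \<partial>stieltjes A \<omega>) \<partial>Law X (Some x))"
proof -
  interpret P: prob_space "Law X (Some x)" by (rule prob_space_Law)
  interpret pair_sigma_finite lborel "Law X (Some x)" by standard
  have m: "(\<lambda>p. ext0 f (case p of (t, \<omega>) \<Rightarrow> occ x t \<omega>)) \<in> borel_measurable (lborel \<Otimes>\<^sub>M Law X (Some x))"
    using measurable_compose[OF occ_props(1)[of x] ext0_measurable[OF f]]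
    by (simp cong: measurable_cong_sets)
  have m2: "(\<lambda>p. ext0 f (occ x (fst p) (snd p)) * indicator {0..} (fst p)) \<in> borel_measurable (lborel \<Otimes>\<^sub>M Law X (Some x))"
    using m by (simp add: split_beta)
  have mt: "(\<lambda>\<omega>. ext0 f (occ x t \<omega>)) \<in> borel_measurable (Law X (Some x))" for t
    by (rule measurable_compose[OF occ_measurable ext0_measurable[OF f]])
  have "(\<integral>\<^sup>+ t\<in>{0..}. (\<integral>\<^sup>+ \<omega>. ext0 f (occ x t \<omega>) \<partial>Law X (Some x)) \<partial>lborel)
      = (\<integral>\<^sup>+ t. (\<integral>\<^sup>+ \<omega>. ext0 f (occ x t \<omega>) * indicator {0..} t \<partial>Law X (Some x)) \<partial>lborel)"
    by (simp add: nn_integral_multc[OF mt])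
  also have "\<dots> = (\<integral>\<^sup>+ \<omega>. (\<integral>\<^sup>+ t. ext0 f (occ x t \<omega>) * indicator {0..} t \<partial>lborel) \<partial>Law X (Some x))"
    using Fubini[OF m2] by simp
  also have "\<dots> = (\<integral>\<^sup>+ \<omega>. (\<integral>\<^sup>+ s\<in>{0..}. ext0 f (Pos X (ennreal s) \<omega>) \<partial>stieltjes A \<omega>) \<partial>Law X (Some x))"
  proof (rule nn_integral_cong_AE)
    show "AE \<omega> in Law X (Some x). (\<integral>\<^sup>+ t. ext0 f (occ x t \<omega>) * indicator {0..} t \<partial>lborel)
        = (\<integral>\<^sup>+ s\<in>{0..}. ext0 f (Pos X (ennreal s) \<omega>) \<partial>stieltjes A \<omega>)"
      using occ_props(2) good_L_AE
    proof eventually_elim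
      case (elim \<omega>)
      then have "(\<integral>\<^sup>+ t. ext0 f (occ x t \<omega>) * indicator {0..} t \<partial>lborel) = (\<integral>\<^sup>+ t\<in>{0..}. ext0 f (Pos X (tau t \<omega>) \<omega>) \<partial>lborel)"
        by (intro nn_integral_cong) (auto split: split_indicator)
      then show ?case using stieltjes_time_change[of \<omega>, OF _ _ f] elim by simp
    qed
  qed
  finally show ?thesis .
qed

end

section \<open>The time-changed semigroup\<close>

lemma exp_tail_integral:
  assumes \<alpha>: "0 < (\<alpha> :: real)"
  shows "has_bochner_integral lborel (\<lambda>t. indicator {d..} t * exp (- \<alpha> * t)) (exp (- \<alpha> * d) / \<alpha>)"
proof (rule has_bochner_integral_nn_integral)
  have "(\<integral>\<^sup>+ t. ennreal (exp (- \<alpha> * t)) * indicator {d..} t \<partial>lborel) = ennreal (0 - (- exp (- \<alpha> * d) / \<alpha>))"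
  proof (rule nn_integral_FTC_atLeast[where F="\<lambda>t. - exp (- \<alpha> * t) / \<alpha>"])
    show "((\<lambda>t. - exp (- \<alpha> * t) / \<alpha>) \<longlongrightarrow> 0) at_top" using \<alpha> by real_asymp
    show "DERIV (\<lambda>t. - exp (- \<alpha> * t) / \<alpha>) t :> exp (- \<alpha> * t)" for t
      using \<alpha> by (auto intro!: derivative_eq_intros)
  qed auto
  also have "(\<integral>\<^sup>+ t. ennreal (exp (- \<alpha> * t)) * indicator {d..} t \<partial>lborel) = (\<integral>\<^sup>+ t. ennreal (indicator {d..} t * exp (- \<alpha> * t)) \<partial>lborel)"
    by (intro nn_integral_cong) (auto split: split_indicator)
  finally show "(\<integral>\<^sup>+ t. ennreal (indicator {d..} t * exp (- \<alpha> * t)) \<partial>lborel) = ennreal (exp (- \<alpha> * d) / \<alpha>)" by simp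
qed (use \<alpha> in auto)

context time_change
begin

definition version :: "('a \<Rightarrow> real) \<Rightarrow> real \<times> 'w \<Rightarrow> real" where
  "version f = (SOME \<Phi>. \<Phi> \<in> borel_measurable (borel \<Otimes>\<^sub>M aug_filt X \<infinity>) \<and>
    (\<forall>t\<ge>0. \<forall>\<omega>\<in>good. \<Phi> (t, \<omega>) = ext0 f (Pos X (tau t \<omega>) \<omega>)) \<and> (\<forall>c. (\<forall>x. \<bar>f x\<bar> \<le> c) \<longrightarrow> (\<forall>p. \<bar>\<Phi> p\<bar> \<le> c)))"

lemma version:
  assumes "f \<in> C0"
  shows version_measurable: "version f \<in> borel_measurable (borel \<Otimes>\<^sub>M aug_filt X \<infinity>)"
    and version_good: "0 \<le> t \<Longrightarrow> \<omega> \<in> good \<Longrightarrow> version f (t, \<omega>) = ext0 f (Pos X (tau t \<omega>) \<omega>)"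
    and version_bound: "(\<And>x. \<bar>f x\<bar> \<le> c) \<Longrightarrow> \<bar>version f p\<bar> \<le> c"
proof -
  have "\<exists>\<Phi>. \<Phi> \<in> borel_measurable (borel \<Otimes>\<^sub>M aug_filt X \<infinity>) \<and>
    (\<forall>t\<ge>0. \<forall>\<omega>\<in>good. \<Phi> (t, \<omega>) = ext0 f (Pos X (tau t \<omega>) \<omega>)) \<and> (\<forall>c. (\<forall>x. \<bar>f x\<bar> \<le> c) \<longrightarrow> (\<forall>p. \<bar>\<Phi> p\<bar> \<le> c))"
    using version_exists[OF assms] by blast
  from someI_ex[OF this]
  have v: "version f \<in> borel_measurable (borel \<Otimes>\<^sub>M aug_filt X \<infinity>)"
      "\<forall>t\<ge>0. \<forall>\<omega>\<in>good. version f (t, \<omega>) = ext0 f (Pos X (tau t \<omega>) \<omega>)"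
      "\<forall>c. (\<forall>x. \<bar>f x\<bar> \<le> c) \<longrightarrow> (\<forall>p. \<bar>version f p\<bar> \<le> c)"
    unfolding version_def[symmetric] by simp_all
  show "version f \<in> borel_measurable (borel \<Otimes>\<^sub>M aug_filt X \<infinity>)" by (rule v(1))
  show "0 \<le> t \<Longrightarrow> \<omega> \<in> good \<Longrightarrow> version f (t, \<omega>) = ext0 f (Pos X (tau t \<omega>) \<omega>)" using v(2) by simp
  show "(\<And>x. \<bar>f x\<bar> \<le> c) \<Longrightarrow> \<bar>version f p\<bar> \<le> c" by (rule v(3)[rule_format])
qed

lemma version_measurable_Law: "f \<in> C0 \<Longrightarrow> version f \<in> borel_measurable (borel \<Otimes>\<^sub>M Law X z)"
proof -
  assume f: "f \<in> C0"
  have "(\<lambda>p::real \<times> 'w. (fst p, snd p)) \<in> borel \<Otimes>\<^sub>M Law X z \<rightarrow>\<^sub>M borel \<Otimes>\<^sub>M aug_filt X \<infinity>"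
    by (intro measurable_Pair measurable_fst measurable_compose[OF measurable_snd measurable_aug_Law[OF measurable_ident_sets[OF refl]]])
  from measurable_compose[OF this version_measurable[OF f]] show ?thesis by simp
qed

lemma version_section: "f \<in> C0 \<Longrightarrow> (\<lambda>\<omega>. version f (t, \<omega>)) \<in> borel_measurable (aug_filt X \<infinity>)"
  by (rule measurable_compose[OF measurable_Pair1' version_measurable]) simp_all

lemma version_section_Law: "f \<in> C0 \<Longrightarrow> (\<lambda>\<omega>. version f (t, \<omega>)) \<in> borel_measurable (Law X z)"
  by (rule measurable_aug_Law[OF version_section])

lemma tc_semigroup_eq:
  assumes f: "f \<in> C0" and t: "0 \<le> t"
  shows "tc_semigroup X A t f x = (\<integral>\<omega>. version f (t, \<omega>) \<partial>Law X (Some x))"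
  unfolding tc_semigroup_def
proof (rule expect_AE[OF version_section_Law[OF f]])
  show "AE \<omega> in Law X (Some x). ext0 f (Pos X (tau t \<omega>) \<omega>) = version f (t, \<omega>)"
    using good_AE by eventually_elim (simp add: version_good[OF f t])
qed

lemma version_None:
  assumes f: "f \<in> C0" and t: "0 \<le> t"
  shows "(\<integral>\<omega>. version f (t, \<omega>) \<partial>Law X None) = 0"
proof (rule integral_eq_zero_AE)
  show "AE \<omega> in Law X None. version f (t, \<omega>) = 0"
    using good_AE Pos_0_AE
  proof eventually_elim
    case (elim \<omega>)
    then show ?case using Pos_absorb[OF good_Path, of \<omega> 0 "tau t \<omega>"] by (simp add: version_good[OF f t])
  qed
qed

lemma integral_version:
  assumes f: "f \<in> C0" and t: "0 \<le> t"
  shows "(\<integral>\<omega>. version f (t, \<omega>) \<partial>Law X z) = ext0 (tc_semigroup X A t f) z"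
  by (cases z) (simp_all add: version_None[OF assms] tc_semigroup_eq[OF assms])

lemma version_integrable:
  assumes f: "f \<in> C0" shows "integrable (Law X z) (\<lambda>\<omega>. version f (t, \<omega>))"
proof -
  obtain c where "\<And>x. \<bar>f x\<bar> \<le> c" using C0_bounded[OF f] by blast
  then show ?thesis by (intro integrable_bounded_Law[OF version_section_Law[OF f]] version_bound[OF f])
qed

lemma tc_semigroup_bound:
  assumes f: "f \<in> C0" and t: "0 \<le> t" and c: "\<And>x. \<bar>f x\<bar> \<le> c"
  shows "\<bar>tc_semigroup X A t f x\<bar> \<le> c"
proof -
  have "\<bar>\<integral>\<omega>. version f (t, \<omega>) \<partial>Law X (Some x)\<bar> \<le> (\<integral>\<omega>. \<bar>version f (t, \<omega>)\<bar> \<partial>Law X (Some x))" by simp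
  also have "\<dots> \<le> c"
    by (rule prob_space.integral_le_const[OF prob_space_Law])
       (auto intro!: integrable_abs version_integrable f version_bound[OF f c])
  finally show ?thesis by (simp add: tc_semigroup_eq[OF f t])
qed

lemma tc_semigroup_lincomb:
  assumes f: "f \<in> C0" and g: "g \<in> C0" and t: "0 \<le> t"
  shows "tc_semigroup X A t (\<lambda>x. a * f x + b * g x) x = a * tc_semigroup X A t f x + b * tc_semigroup X A t g x"
proof -
  note h = C0_lincomb[OF f g, of a b]
  have "(\<integral>\<omega>. version (\<lambda>x. a * f x + b * g x) (t, \<omega>) \<partial>Law X (Some x))
      = (\<integral>\<omega>. a * version f (t, \<omega>) + b * version g (t, \<omega>) \<partial>Law X (Some x))"
  proof (rule integral_cong_AE)
    show "AE \<omega> in Law X (Some x). version (\<lambda>x. a * f x + b * g x) (t, \<omega>) = a * version f (t, \<omega>) + b * version g (t, \<omega>)"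
      using good_AE
    proof eventually_elim
      case (elim \<omega>)
      show ?case unfolding version_good[OF f t elim] version_good[OF g t elim] version_good[OF h t elim]
        by (cases "Pos X (tau t \<omega>) \<omega>") simp_all
    qed
  qed (auto intro!: version_section_Law f g h borel_measurable_add borel_measurable_times)
  then show ?thesis
    by (simp add: tc_semigroup_eq[OF h t] tc_semigroup_eq[OF f t] tc_semigroup_eq[OF g t] version_integrable f g)
qed

lemma completion_cong_AE:
  fixes f g :: "'m \<Rightarrow> real"
  assumes g: "g \<in> borel_measurable (completion M)" and ae: "AE \<omega> in M. f \<omega> = g \<omega>"
  shows "(\<integral>\<omega>. f \<omega> \<partial>completion M) = (\<integral>\<omega>. g \<omega> \<partial>completion M)"
proof -
  obtain h where h: "h \<in> borel_measurable M" "AE \<omega> in M. g \<omega> = h \<omega>"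
    using completion_ex_borel_measurable_real[OF g] by blast
  have "AE \<omega> in M. f \<omega> = h \<omega>" using ae h(2) by eventually_elim simp
  then show ?thesis using integral_completion_AE[OF h(1)] h(2) by simp
qed

text \<open>A function \<open>v\<close> that arises as the expectation of a path functional can be
  fed into the semigroup without being known to be Borel. The semigroup law and the action on time
  integrals are the two applications.\<close>

lemma tc_semigroup_strong_markov:
  fixes g :: "'w \<Rightarrow> real" and v :: "'a \<Rightarrow> real"
  assumes g: "g \<in> borel_measurable (aug_filt X \<infinity>)" and c: "\<And>\<omega>. \<bar>g \<omega>\<bar> \<le> c" and t: "0 \<le> t"
    and v: "\<And>z. (\<integral>\<omega>. g \<omega> \<partial>Law X z) = ext0 v z"
    and h: "h \<in> borel_measurable (Law X (Some x))" "\<And>\<omega>. \<omega> \<in> good \<Longrightarrow> g (Shift X (tau t \<omega>) \<omega>) = h \<omega>"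
  shows "tc_semigroup X A t v x = (\<integral>\<omega>. h \<omega> \<partial>Law X (Some x))"
proof -
  note S = strong_markov_aug[OF rtau_stopping[of t] g c, where z="Some x", unfolded v]
  have "tc_semigroup X A t v x = (\<integral>\<omega>. ext0 v (Pos X (tau t \<omega>) \<omega>) \<partial>completion (Law X (Some x)))"
    by (simp add: tc_semigroup_def expect_def)
  also have "\<dots> = (\<integral>\<omega>. ext0 v (Pos X (rtau t \<omega>) \<omega>) \<partial>completion (Law X (Some x)))"
    by (rule completion_cong_AE[OF S(2)], use good_AE in eventually_elim) (simp add: rtau_Pos[OF _ t])
  also have "\<dots> = (\<integral>\<omega>. g (Shift X (rtau t \<omega>) \<omega>) \<partial>completion (Law X (Some x)))"
    by (rule S(3)[symmetric])
  also have "\<dots> = (\<integral>\<omega>. h \<omega> \<partial>Law X (Some x))"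
    by (rule integral_completion_AE[OF h(1)], use good_L_AE in eventually_elim) (simp add: rtau_eq[OF _ t] h(2))
  finally show ?thesis .
qed

lemma tc_semigroup_add:
  assumes f: "f \<in> C0" and t: "0 \<le> t" and s: "0 \<le> s"
  shows "tc_semigroup X A t (tc_semigroup X A s f) x = tc_semigroup X A (t + s) f x"
proof -
  obtain c where c: "\<And>x. \<bar>f x\<bar> \<le> c" using C0_bounded[OF f] by blast
  have ts: "0 \<le> t + s" using t s by simp
  have "tc_semigroup X A t (tc_semigroup X A s f) x = (\<integral>\<omega>. version f (t + s, \<omega>) \<partial>Law X (Some x))"
  proof (rule tc_semigroup_strong_markov[OF version_section[OF f] version_bound[OF f c] t integral_version[OF f s] version_section_Law[OF f]])
    show "version f (s, Shift X (tau t \<omega>) \<omega>) = version f (t + s, \<omega>)" if "\<omega> \<in> good" for \<omega>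
      unfolding version_good[OF f s good_Shift[OF that]] version_good[OF f ts that] Pos_tau_Shift[OF that t s] ..
  qed
  then show ?thesis by (simp add: tc_semigroup_eq[OF f ts])
qed

text \<open>One weight covers both operators needed: the indicator of [0, s] gives K_s and the
  exponential on [0, \<infinity>) the resolvent.\<close>

definition tc_integral :: "(real \<Rightarrow> real) \<Rightarrow> ('a \<Rightarrow> real) \<Rightarrow> 'a \<Rightarrow> real" where
  "tc_integral w f x = (\<integral>r. w r * tc_semigroup X A r f x \<partial>lborel)"

lemma version_time_integral:
  assumes f: "f \<in> C0" and w: "integrable lborel w"
  shows "(\<lambda>\<omega>. \<integral>r. w r * version f (t + r, \<omega>) \<partial>lborel) \<in> borel_measurable (aug_filt X \<infinity>)"
    and "(\<integral>\<omega>. (\<integral>r. w r * version f (t + r, \<omega>) \<partial>lborel) \<partial>Law X z)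
       = (\<integral>r. w r * (\<integral>\<omega>. version f (t + r, \<omega>) \<partial>Law X z) \<partial>lborel)"
    and "(\<And>x. \<bar>f x\<bar> \<le> c) \<Longrightarrow> \<bar>\<integral>r. w r * version f (t + r, \<omega>) \<partial>lborel\<bar> \<le> (\<integral>r. \<bar>w r\<bar> * c \<partial>lborel)"
proof -
  have wm [measurable]: "w \<in> borel_measurable lborel" using w by simp
  have sw: "(\<lambda>p. w (snd p) * version f (t + snd p, fst p)) \<in> borel_measurable (N \<Otimes>\<^sub>M lborel)"
    if v: "version f \<in> borel_measurable (borel \<Otimes>\<^sub>M N)" for N
  proof -
    have "(\<lambda>p::'w \<times> real. (t + snd p, fst p)) \<in> N \<Otimes>\<^sub>M lborel \<rightarrow>\<^sub>M borel \<Otimes>\<^sub>M N" by measurable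
    from measurable_compose[OF this v]
    have [measurable]: "(\<lambda>p. version f (t + snd p, fst p)) \<in> borel_measurable (N \<Otimes>\<^sub>M lborel)" .
    show ?thesis by measurable
  qed
  show "(\<lambda>\<omega>. \<integral>r. w r * version f (t + r, \<omega>) \<partial>lborel) \<in> borel_measurable (aug_filt X \<infinity>)"
    by (rule sigma_finite_measure.borel_measurable_lebesgue_integral[OF sigma_finite_lborel])
       (use sw[OF version_measurable[OF f]] in \<open>simp add: split_beta'\<close>)
  interpret P: prob_space "Law X z" by (rule prob_space_Law)
  interpret Q: pair_sigma_finite "Law X z" lborel by standard
  obtain B where B: "\<And>x. \<bar>f x\<bar> \<le> B" using C0_bounded[OF f] by blast
  have vB: "\<bar>version f p\<bar> \<le> B" for p by (rule version_bound[OF f B])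
  have "integrable (Law X z \<Otimes>\<^sub>M lborel) (\<lambda>p. w (snd p) * version f (t + snd p, fst p))"
  proof (rule Bochner_Integration.integrable_bound)
    show "integrable (Law X z \<Otimes>\<^sub>M lborel) (\<lambda>p. w (snd p) * B)"
    proof (rule Q.Fubini_integrable)
      show "(\<lambda>p. w (snd p) * B) \<in> borel_measurable (Law X z \<Otimes>\<^sub>M lborel)" by measurable
    qed (use w in simp_all)
    show "(\<lambda>p. w (snd p) * version f (t + snd p, fst p)) \<in> borel_measurable (Law X z \<Otimes>\<^sub>M lborel)"
      by (rule sw[OF version_measurable_Law[OF f]])
    show "AE p in Law X z \<Otimes>\<^sub>M lborel. norm (w (snd p) * version f (t + snd p, fst p)) \<le> norm (w (snd p) * B)"
      using order_trans[OF vB abs_ge_self] by (intro AE_I2) (auto simp: abs_mult intro: mult_left_mono)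
  qed
  then have "(\<integral>r. (\<integral>\<omega>. w r * version f (t + r, \<omega>) \<partial>Law X z) \<partial>lborel)
      = (\<integral>\<omega>. (\<integral>r. w r * version f (t + r, \<omega>) \<partial>lborel) \<partial>Law X z)"
    by (intro Q.Fubini_integral) (simp add: split_beta')
  then show "(\<integral>\<omega>. (\<integral>r. w r * version f (t + r, \<omega>) \<partial>lborel) \<partial>Law X z)
       = (\<integral>r. w r * (\<integral>\<omega>. version f (t + r, \<omega>) \<partial>Law X z) \<partial>lborel)"
    by simp
  assume c: "\<And>x. \<bar>f x\<bar> \<le> c"
  have c0: "0 \<le> c" using order_trans[OF abs_ge_zero c] .
  show "\<bar>\<integral>r. w r * version f (t + r, \<omega>) \<partial>lborel\<bar> \<le> (\<integral>r. \<bar>w r\<bar> * c \<partial>lborel)"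
  \<comment> \<open>Without integrability the Bochner integral is 0 by convention, so the bound
    holds for every single path, as the strong Markov lemma demands.\<close>
  proof (cases "integrable lborel (\<lambda>r. w r * version f (t + r, \<omega>))")
    case True
    have "(\<integral>r. \<bar>w r * version f (t + r, \<omega>)\<bar> \<partial>lborel) \<le> (\<integral>r. \<bar>w r\<bar> * c \<partial>lborel)"
      by (rule integral_mono[OF integrable_abs[OF True]])
         (use w in \<open>auto simp: abs_mult intro!: mult_left_mono version_bound[OF f c]\<close>)
    then show ?thesis by (rule order_trans[OF integral_abs_bound])
  next
    case False
    then show ?thesis using c0 by (simp add: not_integrable_integral_eq)
  qed
qed

lemma integral_tc_cong:
  assumes f: "f \<in> C0" and w0: "\<And>r. r < 0 \<Longrightarrow> w r = 0" and t: "0 \<le> t"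
  shows "(\<integral>r. w r * (\<integral>\<omega>. version f (t + r, \<omega>) \<partial>Law X (Some x)) \<partial>lborel) = (\<integral>r. w r * tc_semigroup X A (t + r) f x \<partial>lborel)"
proof (rule Bochner_Integration.integral_cong[OF refl])
  show "w r * (\<integral>\<omega>. version f (t + r, \<omega>) \<partial>Law X (Some x)) = w r * tc_semigroup X A (t + r) f x" for r
    using w0[of r] t by (cases "r < 0") (simp_all add: tc_semigroup_eq[OF f])
qed

text \<open>The functional is the time integral of \<open>version f\<close>; its shift by tau t
  replaces r by t + r under the integral. The weight vanishes at negative r, where nothing is known
  about the version.\<close>

lemma tc_semigroup_integral:
  assumes f: "f \<in> C0" and w: "integrable lborel w" and w0: "\<And>r. r < 0 \<Longrightarrow> w r = 0" and t: "0 \<le> t"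
  shows "tc_semigroup X A t (tc_integral w f) x = (\<integral>r. w r * tc_semigroup X A (t + r) f x \<partial>lborel)"
proof -
  obtain c where c: "\<And>x. \<bar>f x\<bar> \<le> c" using C0_bounded[OF f] by blast
  define g where "g \<omega> = (\<integral>r. w r * version f (0 + r, \<omega>) \<partial>lborel)" for \<omega>
  have g: "g \<in> borel_measurable (aug_filt X \<infinity>)" "\<bar>g \<omega>\<bar> \<le> (\<integral>r. \<bar>w r\<bar> * c \<partial>lborel)" for \<omega>
    unfolding g_def by (rule version_time_integral(1)[OF f w], rule version_time_integral(3)[OF f w c])
  have v: "(\<integral>\<omega>. g \<omega> \<partial>Law X z) = ext0 (tc_integral w f) z" for z
  proof (cases z)
    case None
    have "w r * (\<integral>\<omega>. version f (0 + r, \<omega>) \<partial>Law X None) = 0" for r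
      using w0[of r] by (cases "r < 0") (simp_all add: version_None[OF f])
    then have "(\<lambda>r. w r * (\<integral>\<omega>. version f (0 + r, \<omega>) \<partial>Law X None)) = (\<lambda>r. 0)" by (rule ext)
    then show ?thesis unfolding g_def version_time_integral(2)[OF f w] None by simp
  next
    case (Some x)
    show ?thesis
      unfolding g_def version_time_integral(2)[OF f w] Some ext0_simps tc_integral_def
      using integral_tc_cong[OF f w0 order_refl] by simp
  qed
  have "tc_semigroup X A t (tc_integral w f) x = (\<integral>\<omega>. (\<integral>r. w r * version f (t + r, \<omega>) \<partial>lborel) \<partial>Law X (Some x))"
  proof (rule tc_semigroup_strong_markov[OF g t v])
    show "(\<lambda>\<omega>. \<integral>r. w r * version f (t + r, \<omega>) \<partial>lborel) \<in> borel_measurable (Law X (Some x))"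
      by (rule measurable_aug_Law[OF version_time_integral(1)[OF f w]])
    fix \<omega> assume \<omega>: "\<omega> \<in> good"
    show "g (Shift X (tau t \<omega>) \<omega>) = (\<integral>r. w r * version f (t + r, \<omega>) \<partial>lborel)"
      unfolding g_def
    proof (rule Bochner_Integration.integral_cong[OF refl])
      show "w r * version f (0 + r, Shift X (tau t \<omega>) \<omega>) = w r * version f (t + r, \<omega>)" for r
        using t w0[of r] by (cases "r < 0") (auto simp: version_good[OF f] good_Shift \<omega> Pos_tau_Shift)
    qed
  qed
  also have "\<dots> = (\<integral>r. w r * tc_semigroup X A (t + r) f x \<partial>lborel)"
    unfolding version_time_integral(2)[OF f w] by (rule integral_tc_cong[OF f w0 t])
  finally show ?thesis .
qed

lemma tc_resolvent_eq:
  assumes f: "f \<in> C0" and \<alpha>: "0 < \<alpha>"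
  shows "integrable lborel (\<lambda>t. indicator {0..} t * exp (- \<alpha> * t))"
    and "(\<integral>t. indicator {0..} t * exp (- \<alpha> * t) \<partial>lborel) = 1 / \<alpha>"
    and "tc_resolvent X A \<alpha> f x = tc_integral (\<lambda>t. indicator {0..} t * exp (- \<alpha> * t)) f x"
proof -
  let ?w = "\<lambda>t::real. indicator {0..} t * exp (- \<alpha> * t)"
  show w: "integrable lborel ?w" and "(\<integral>t. ?w t \<partial>lborel) = 1 / \<alpha>"
    using exp_tail_integral[OF \<alpha>, of 0] by (simp_all add: has_bochner_integral_iff)
  have "tc_resolvent X A \<alpha> f x = (\<integral>\<omega>. (\<integral>r. ?w r * version f (0 + r, \<omega>) \<partial>lborel) \<partial>Law X (Some x))"
    unfolding tc_resolvent_def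
  proof (rule expect_AE[OF measurable_aug_Law[OF version_time_integral(1)[OF f w]]])
    show "AE \<omega> in Law X (Some x). (LINT t:{0..}|lborel. exp (- \<alpha> * t) * ext0 f (Pos X (tau t \<omega>) \<omega>))
        = (\<integral>r. ?w r * version f (0 + r, \<omega>) \<partial>lborel)"
      using good_AE
    proof eventually_elim
      case (elim \<omega>)
      show ?case unfolding set_lebesgue_integral_def
        by (rule Bochner_Integration.integral_cong[OF refl])
           (auto simp: version_good[OF f _ elim] split: split_indicator)
    qed
  qed
  also have "\<dots> = tc_integral ?w f x"
    unfolding version_time_integral(2)[OF f w] tc_integral_def
    using integral_tc_cong[OF f, of ?w 0] by simp
  finally show "tc_resolvent X A \<alpha> f x = tc_integral ?w f x" .
qed

lemma tc_semigroup_tendsto: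
  assumes f: "f \<in> C0" and t: "0 \<le> t"
  shows "((\<lambda>s. tc_semigroup X A s f x) \<longlongrightarrow> tc_semigroup X A t f x) (at_right t)"
proof (rule tendsto_at_right_sequentially[of t "t + 1"])
  fix S :: "nat \<Rightarrow> real" assume S: "\<And>n. t < S n" "S \<longlonglongrightarrow> t"
  obtain c where c: "\<And>x. \<bar>f x\<bar> \<le> c" using C0_bounded[OF f] by blast
  have S0: "0 \<le> S n" for n using S(1)[of n] t by simp
  have "(\<lambda>n. \<integral>\<omega>. version f (S n, \<omega>) \<partial>Law X (Some x)) \<longlonglongrightarrow> (\<integral>\<omega>. version f (t, \<omega>) \<partial>Law X (Some x))"
  proof (rule integral_dominated_convergence[where w="\<lambda>_. c"])
    show "integrable (Law X (Some x)) (\<lambda>_. c)"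
      by (rule finite_measure.integrable_const[OF finite_measure_Law])
    show "AE \<omega> in Law X (Some x). (\<lambda>n. version f (S n, \<omega>)) \<longlonglongrightarrow> version f (t, \<omega>)"
      using good_AE
    proof eventually_elim
      case (elim \<omega>)
      have "filterlim S (at_right t) sequentially"
        unfolding filterlim_at_right_iff using S by simp
      from filterlim_compose[OF Pos_tau_tendsto[OF elim f t] this]
      show ?case by (simp add: version_good[OF f] t S0 elim)
    qed
  qed (auto intro!: version_section_Law f version_bound[OF f c])
  then show "(\<lambda>n. tc_semigroup X A (S n) f x) \<longlonglongrightarrow> tc_semigroup X A t f x"
    by (simp add: tc_semigroup_eq[OF f] t S0)
qed simp

lemma tc_semigroup_time_measurable:
  assumes f: "f \<in> C0"
  shows "(\<lambda>r. indicator {0..} r * tc_semigroup X A r f x) \<in> borel_measurable borel"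
proof -
  interpret P: prob_space "Law X (Some x)" by (rule prob_space_Law)
  have "(\<lambda>r. \<integral>\<omega>. version f (r, \<omega>) \<partial>Law X (Some x)) \<in> borel_measurable borel"
    by (rule P.borel_measurable_lebesgue_integral) (use version_measurable_Law[OF f] in simp)
  then have "(\<lambda>r. indicator {0..} r * (\<integral>\<omega>. version f (r, \<omega>) \<partial>Law X (Some x))) \<in> borel_measurable borel" by simp
  moreover have "(\<lambda>r. indicator {0..} r * (\<integral>\<omega>. version f (r, \<omega>) \<partial>Law X (Some x))) = (\<lambda>r. indicator {0..} r * tc_semigroup X A r f x)"
    by (auto simp: fun_eq_iff tc_semigroup_eq[OF f] split: split_indicator)
  ultimately show ?thesis by simp
qed

end

section \<open>Hitting times of the fine support\<close>

lemma (in std_process) strong_markov_indicator: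
  assumes T: "stopping_time (Filt X) T" and G: "G \<in> sets (aug_filt X \<infinity>)"
  shows "(AE \<omega> in Law X z. Shift X (T \<omega>) \<omega> \<notin> G) \<longleftrightarrow>
    (AE \<omega> in Law X z. AE \<omega>' in Law X (Pos X (T \<omega>) \<omega>). \<omega>' \<notin> G)"
  using strong_markov_null[OF T, of "indicator G" 1 z] G by (simp add: indicator_eq_0_iff)

lemma (in std_process) open_neighbourhood_right:
  assumes \<omega>: "\<omega> \<in> rc_paths" and t: "t < top" and U: "open U" "Pos X t \<omega> \<in> Some ` U"
  shows "\<exists>b>t. \<forall>s>t. s < b \<longrightarrow> Pos X s \<omega> \<in> Some ` U"
proof -
  have "limitin comp_top (\<lambda>s. Pos X s \<omega>) (Pos X t \<omega>) (at_right t)" using \<omega> t by (simp add: rc_paths_def)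
  moreover have "openin comp_top (Some ` U)" using U(1) by (auto simp: openin_comp_top)
  ultimately have "\<forall>\<^sub>F s in at_right t. Pos X s \<omega> \<in> Some ` U" using U(2) by (simp add: limitin_def)
  then show ?thesis unfolding eventually_at_right_ennreal[OF t] by blast
qed

context std_process
begin

text \<open>A visit time computed along rational times only. For open \<open>U\<close> and
  right-continuous paths no visit is overlooked, and being a countable infimum it is a stopping time
  without deeper measurability results on hitting times.\<close>

definition rat_hit :: "'a set \<Rightarrow> 'w \<Rightarrow> ennreal" where
  "rat_hit U \<omega> = (INF q\<in>{q\<in>\<rat>. 0 < q}. if Pos X (ennreal q) \<omega> \<in> Some ` U then ennreal q else top)"

lemma rat_hit_less_iff: "rat_hit U \<omega> < s \<longleftrightarrow> (\<exists>q\<in>{q\<in>\<rat>. 0 < q}. Pos X (ennreal q) \<omega> \<in> Some ` U \<and> ennreal q < s)"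
  unfolding rat_hit_def INF_less_iff by (auto split: if_splits)

lemma rat_hit_stopping:
  assumes U: "open U" shows "stopping_time (Filt X) (rat_hit U)"
proof (rule stopping_timeI_less)
  fix s :: ennreal
  have "{\<omega>\<in>Path X. rat_hit U \<omega> < s} = (\<Union>q\<in>{q\<in>\<rat>. 0 < q \<and> ennreal q < s}. {\<omega>\<in>Path X. Pos X (ennreal q) \<omega> \<in> Some ` U})"
    by (auto simp: rat_hit_less_iff)
  also have "\<dots> \<in> sets (Filt X s)"
  proof (rule sets.countable_UN'')
    show "countable {q \<in> \<rat>. 0 < (q::real) \<and> ennreal q < s}" by (rule countable_subset[OF _ countable_rat]) auto
    show "{\<omega>\<in>Path X. Pos X (ennreal q) \<omega> \<in> Some ` U} \<in> sets (Filt X s)" if q: "q \<in> {q \<in> \<rat>. 0 < q \<and> ennreal q < s}" for q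
    proof -
      have "Some ` U \<in> sets comp_borel" using U by (intro Some_image_sets) simp
      from measurable_sets[OF Pos_Filt[of "ennreal q"] this]
      show ?thesis using sets_F_mono[of "ennreal q" s] q by (auto simp: space_F vimage_def Int_def conj_commute intro: less_imp_le)
    qed
  qed
  finally show "{\<omega>\<in>Path X. rat_hit U \<omega> < s} \<in> sets (Filt X s)" .
qed

text \<open>Says that the position at this time lies in the closure of \<open>U\<close>: visits to
  \<open>U\<close> occur at or arbitrarily soon after it, and right continuity keeps them in
  \<open>V\<close>.\<close>

lemma rat_hit_approx:
  assumes \<omega>: "\<omega> \<in> rc_paths" and fin: "rat_hit U \<omega> < top" and V: "open V" "Pos X (rat_hit U \<omega>) \<omega> \<in> Some ` V"
  shows "U \<inter> V \<noteq> {}"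
proof -
  obtain b where b: "b > rat_hit U \<omega>" "\<And>s. s > rat_hit U \<omega> \<Longrightarrow> s < b \<Longrightarrow> Pos X s \<omega> \<in> Some ` V"
    using open_neighbourhood_right[OF \<omega> fin V] by blast
  obtain q where q: "Pos X (ennreal q) \<omega> \<in> Some ` U" "ennreal q < b" "q \<in> \<rat>" "0 < q"
    using b(1) unfolding rat_hit_less_iff by blast
  have "rat_hit U \<omega> \<le> ennreal q" unfolding rat_hit_def using q by (intro INF_lower2[of q]) auto
  then have "Pos X (ennreal q) \<omega> \<in> Some ` V" using b(2)[of "ennreal q"] q(2) V(2) by (cases "rat_hit U \<omega> = ennreal q") auto
  then show ?thesis using q(1) by auto
qed

text \<open>The path stays in the open set for a while after t, hence is there at rational times
  arbitrarily close to t.\<close>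

lemma rat_hit_le:
  assumes \<omega>: "\<omega> \<in> rc_paths" and t: "t < top" and U: "open U" "Pos X t \<omega> \<in> Some ` U"
  shows "rat_hit U \<omega> \<le> t"
proof (rule ccontr)
  assume "\<not> rat_hit U \<omega> \<le> t"
  then have lt: "t < rat_hit U \<omega>" by simp
  obtain b where b: "b > t" "\<And>s. s > t \<Longrightarrow> s < b \<Longrightarrow> Pos X s \<omega> \<in> Some ` U"
    using open_neighbourhood_right[OF \<omega> t U] by blast
  obtain r where r: "t < r" "r < min b (rat_hit U \<omega>)" using dense[of t "min b (rat_hit U \<omega>)"] b(1) lt by auto
  obtain t' r' where t': "0 \<le> t'" "t = ennreal t'" and r': "0 \<le> r'" "r = ennreal r'"
    using t r by (cases t; cases r) auto
  have "t' < r'" using r(1) t' r' by (simp add: ennreal_less_iff)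
  then obtain q where q: "q \<in> \<rat>" "t' < q" "q < r'" using Rats_dense_in_real by blast
  have "t < ennreal q" "ennreal q < r" using q t' r' by (auto intro!: ennreal_lessI)
  then have "Pos X (ennreal q) \<omega> \<in> Some ` U" using b(2)[of "ennreal q"] r(2) by auto
  then have "rat_hit U \<omega> \<le> ennreal q" unfolding rat_hit_def using q t'(1) by (intro INF_lower2[of q]) auto
  then show False using \<open>ennreal q < r\<close> r(2) by auto
qed

text \<open>Right continuity and closedness make the infimum attained. The cemetery is excluded
  because it is absorbing while visits to \<open>F\<close> occur at or after this time.\<close>

lemma hitting_time_closed:
  assumes \<omega>: "\<omega> \<in> rc_paths" and F: "closed F" and fin: "hitting_time X F \<omega> < top"
  shows "Pos X (hitting_time X F \<omega>) \<omega> \<in> Some ` F"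
proof -
  let ?h = "hitting_time X F \<omega>"
  have P: "\<omega> \<in> Path X" using \<omega> by (simp add: rc_paths_def)
  have near: "\<exists>t. 0 < t \<and> Pos X t \<omega> \<in> Some ` F \<and> ?h \<le> t \<and> t < b" if hb: "?h < b" for b
  proof -
    obtain t where "t \<in> {t. 0 < t \<and> Pos X t \<omega> \<in> Some ` F}" "t < b"
      using hb unfolding hitting_time_def Inf_less_iff by blast
    then show ?thesis unfolding hitting_time_def by (auto intro!: exI[of _ t] Inf_lower)
  qed
  have "Pos X ?h \<omega> \<noteq> None"
  proof
    assume N: "Pos X ?h \<omega> = None"
    obtain t where "Pos X t \<omega> \<in> Some ` F" "?h \<le> t" using near[OF fin] by blast
    then show False using Pos_absorb[OF P _ N, of t] by auto
  qed
  then obtain y where y: "Pos X ?h \<omega> = Some y" by auto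
  have "y \<in> F"
  proof (rule ccontr)
    assume "y \<notin> F"
    then obtain b where b: "b > ?h" "\<And>s. s > ?h \<Longrightarrow> s < b \<Longrightarrow> Pos X s \<omega> \<in> Some ` (- F)"
      using open_neighbourhood_right[OF \<omega> fin, of "- F"] F y by auto
    obtain t where t: "Pos X t \<omega> \<in> Some ` F" "?h \<le> t" "t < b" using near[OF b(1)] by blast
    show False
    proof (cases "t = ?h")
      case True then show ?thesis using t(1) y \<open>y \<notin> F\<close> by auto
    next
      case False
      then have "?h < t" using t(2) by simp
      then show ?thesis using b(2)[of t] t by auto
    qed
  qed
  then show ?thesis using y by simp
qed

text \<open>The space is open in the compactification, so a living path survives for a while by
  right continuity; a death at or before that would have been absorbing.\<close>

lemma less_lifetime:
  assumes \<omega>: "\<omega> \<in> rc_paths" and t: "t < top" "Pos X t \<omega> \<noteq> None"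
  shows "t < lifetime X \<omega>"
proof (rule ccontr)
  assume "\<not> t < lifetime X \<omega>"
  then have le: "lifetime X \<omega> \<le> t" by simp
  have P: "\<omega> \<in> Path X" using \<omega> by (simp add: rc_paths_def)
  obtain b where b: "b > t" "\<And>s. s > t \<Longrightarrow> s < b \<Longrightarrow> Pos X s \<omega> \<in> Some ` (UNIV :: 'a set)"
    using open_neighbourhood_right[OF \<omega> t(1), of UNIV] t(2) by (metis notin_range_Some open_UNIV)
  obtain s where s: "t < s" "s < b" using dense[OF b(1)] by blast
  then obtain r where "Pos X r \<omega> = None" "r < s" using le unfolding lifetime_def by (metis (mono_tags, lifting) Inf_less_iff le_less_trans mem_Collect_eq)
  then have "Pos X s \<omega> = None" using Pos_absorb[OF P, of r s] by simp
  then show False using b(2)[OF s] by auto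
qed

end

section \<open>Almost sure equality of the inverse at level zero and the hitting time of the fine
  support\<close>

locale regular_time_change = time_change X A L
  for X :: "('w, 'a::{metric_space, second_countable_topology}) process"
    and A :: "real \<Rightarrow> 'w \<Rightarrow> real" and L :: "'w set" +
  fixes F :: "'a set"
  assumes F_regular: "F = {x. AE \<omega> in Law X (Some x). inverse_pcaf A 0 \<omega> = 0}"
    and F_closed: "closed F"
begin

lemma rtau_positive_sets: "{\<omega>\<in>Path X. 0 < rtau 0 \<omega> \<and> Pos X 0 \<omega> \<in> Some ` B} \<in> sets (aug_filt X \<infinity>)" if "B \<in> sets borel" for B
proof -
  have [measurable]: "rtau 0 \<in> borel_measurable (aug_filt X \<infinity>)"
    using measurable_compose[OF measurable_Pair1' rtau_measurable, of 0] by simp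
  have [measurable]: "Pos X 0 \<in> aug_filt X \<infinity> \<rightarrow>\<^sub>M comp_borel" by (rule Pos_aug) simp
  have [measurable]: "Some ` B \<in> sets comp_borel" using that by blast
  have "{\<omega>\<in>space (aug_filt X \<infinity>). 0 < rtau 0 \<omega> \<and> Pos X 0 \<omega> \<in> Some ` B} \<in> sets (aug_filt X \<infinity>)" by measurable
  then show ?thesis by (simp add: space_aug)
qed

text \<open>\<open>G\<close> collects the paths that start alive but on which \<open>A\<close> does
  not increase at once. After tau t it does increase at once, so the shifted path avoids
  \<open>G\<close>; the strong Markov property turns this into regularity of the position at tau t,
  that is, membership in \<open>F\<close>.\<close>

lemma tau_in_F:
  assumes t: "0 \<le> t"
  shows "AE \<omega> in Law X z. Pos X (tau t \<omega>) \<omega> \<in> insert None (Some ` F)"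
proof -
  define G where "G = {\<omega>\<in>Path X. 0 < rtau 0 \<omega> \<and> Pos X 0 \<omega> \<in> Some ` (UNIV :: 'a set)}"
  have G: "G \<in> sets (aug_filt X \<infinity>)" unfolding G_def by (rule rtau_positive_sets) simp
  have nG: "Shift X (rtau t \<omega>) \<omega> \<notin> G" if \<omega>: "\<omega> \<in> good" for \<omega>
  proof
    assume "Shift X (rtau t \<omega>) \<omega> \<in> G"
    then have r: "0 < rtau 0 (Shift X (rtau t \<omega>) \<omega>)" "Pos X (rtau t \<omega>) \<omega> \<noteq> None"
      using good_Path[OF \<omega>] by (auto simp: G_def Pos_Shift)
    then have L: "\<omega> \<in> L" using \<omega> by (auto simp: good_def)
    then have eq: "rtau t \<omega> = tau t \<omega>" using t by (rule rtau_eq)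
    have "tau t \<omega> < top"
      using r(2) eq Pos_infinity[OF good_Path[OF \<omega>]] by (auto simp: less_top[symmetric])
    then obtain T where T: "0 \<le> T" "tau t \<omega> = ennreal T" by (rule tau_finite_E)
    have "ennreal T + tau 0 (Shift X (ennreal T) \<omega>) = ennreal T + 0"
      using tau_Shift[OF L t order_refl T] T by simp
    then have "tau 0 (Shift X (ennreal T) \<omega>) = 0" by (simp add: ennreal_add_left_cancel)
    then show False using r(1) eq T rtau_eq[OF L_Shift[OF L T(1)], of 0] by simp
  qed
  have "AE \<omega> in Law X z. Shift X (rtau t \<omega>) \<omega> \<notin> G" using good_AE by eventually_elim (rule nG)
  then have "AE \<omega> in Law X z. AE \<omega>' in Law X (Pos X (rtau t \<omega>) \<omega>). \<omega>' \<notin> G"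
    using strong_markov_indicator[OF rtau_stopping G] by simp
  then show ?thesis using good_AE
  proof eventually_elim
    case (elim \<omega>)
    show ?case
    proof (cases "Pos X (tau t \<omega>) \<omega>")
      case (Some y)
      then have eq: "Pos X (rtau t \<omega>) \<omega> = Some y" using rtau_Pos[OF elim(2) t] by simp
      have "AE \<omega>' in Law X (Some y). \<omega>' \<notin> G" using elim(1) unfolding eq .
      then have "AE \<omega>' in Law X (Some y). tau 0 \<omega>' = 0"
        using Pos_0_AE AE_space L_AE
      proof eventually_elim
        case (elim \<omega>')
        then show ?case using rtau_eq[of \<omega>' 0] by (auto simp: G_def space_Law)
      qed
      then have "y \<in> F" by (simp add: F_regular)
      then show ?thesis using Some by simp
    qed simp
  qed
qed

text \<open>The same device in the other direction: from a point of \<open>F\<close> a delayed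
  increase has probability zero, and the strong Markov property at \<open>T\<close> transfers this
  to the path after \<open>T\<close>.\<close>

lemma regular_after:
  assumes T: "stopping_time (Filt X) T"
  shows "AE \<omega> in Law X z. Pos X (T \<omega>) \<omega> \<in> Some ` F \<longrightarrow> rtau 0 (Shift X (T \<omega>) \<omega>) = 0"
proof -
  define G where "G = {\<omega>\<in>Path X. 0 < rtau 0 \<omega> \<and> Pos X 0 \<omega> \<in> Some ` F}"
  have G: "G \<in> sets (aug_filt X \<infinity>)" unfolding G_def by (rule rtau_positive_sets) (simp add: F_closed borel_closed)
  have "AE \<omega> in Law X y. \<omega> \<notin> G" for y
  proof (cases "y \<in> Some ` F")
    case True
    then obtain x where x: "y = Some x" "AE \<omega> in Law X (Some x). tau 0 \<omega> = 0" by (auto simp: F_regular)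
    show ?thesis unfolding x(1) using x(2) L_AE by eventually_elim (simp add: G_def rtau_eq)
  next
    case False
    show ?thesis using Pos_0_AE by eventually_elim (use False in \<open>auto simp: G_def\<close>)
  qed
  then have "AE \<omega> in Law X z. Shift X (T \<omega>) \<omega> \<notin> G"
    using strong_markov_indicator[OF T G] by simp
  then show ?thesis using AE_space
    by eventually_elim (auto simp: G_def space_Law Shift_Path Pos_Shift)
qed

text \<open>The hitting time counts only strictly positive times, while tau 0 may be 0. The times
  tau (1/n) are positive, lead into \<open>F\<close> whenever they are finite, and approach tau 0 by
  right continuity.\<close>

lemma hitting_le_tau: "AE \<omega> in Law X (Some x). hitting_time X F \<omega> \<le> tau 0 \<omega>"
proof -
  have "AE \<omega> in Law X (Some x). \<forall>n::nat. Pos X (tau (1 / real (Suc n)) \<omega>) \<omega> \<in> insert None (Some ` F)"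
    unfolding AE_all_countable by (intro allI tau_in_F) simp
  then show ?thesis using L_AE
  proof eventually_elim
    case (elim \<omega>)
    show ?case
    proof (rule ccontr)
      assume "\<not> hitting_time X F \<omega> \<le> tau 0 \<omega>"
      then have lt: "tau 0 \<omega> < hitting_time X F \<omega>" by simp
      obtain d where d: "d > 0" "\<And>s. s < d \<Longrightarrow> tau s \<omega> < hitting_time X F \<omega>"
        using tau_right_cont[OF elim(2) order_refl lt] by blast
      obtain n where n: "1 / real (Suc n) < d" using nat_approx_posE[OF d(1)] by blast
      let ?t = "tau (1 / real (Suc n)) \<omega>"
      have lt2: "?t < hitting_time X F \<omega>" by (rule d(2)[OF n])
      then have "?t < top" by (rule less_le_trans) simp
      moreover have "0 \<le> 1 / real (Suc n)" by simp
      ultimately have "Pos X ?t \<omega> \<noteq> None" by (intro tau_finite_alive[OF elim(2)])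
      then have "Pos X ?t \<omega> \<in> Some ` F" using spec[OF elim(1), of n] by (metis insertE)
      moreover have "0 < ?t" using tau_pos[OF elim(2), of "1 / real (Suc n)"] by simp
      ultimately have "hitting_time X F \<omega> \<le> ?t" unfolding hitting_time_def by (intro Inf_lower) auto
      then show False using lt2 by simp
    qed
  qed
qed

text \<open>By quasi-left-continuity the process has reached \<open>F\<close> at the limit of the hitting times of the
  shrinking open neighbourhoods of \<open>F\<close>; this limit is a stopping time not exceeding the hitting time of \<open>F\<close>.\<close>

lemma tau_le_hitting: "AE \<omega> in Law X (Some x). tau 0 \<omega> \<le> hitting_time X F \<omega>"
proof -
  \<comment> \<open>The radii tend to 0, so closedness of \<open>F\<close> forces limits of points
    taken from successive \<open>U n\<close> into \<open>F\<close>.\<close>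
  define U where "U n = (\<Union>y\<in>F. ball y (1 / real (Suc n)))" for n
  have U: "open (U n)" "F \<subseteq> U n" for n by (auto simp: U_def)
  define T where "T n = rat_hit (U n)" for n
  define S where "S \<omega> = (SUP n. T n \<omega>)" for \<omega>
  have T: "stopping_time (Filt X) (T n)" for n unfolding T_def by (rule rat_hit_stopping[OF U(1)])
  have S: "stopping_time (Filt X) S"
  proof
    fix t
    have "Measurable.pred (Filt X t) (\<lambda>\<omega>. \<forall>n. T n \<omega> \<le> t)"
      using stopping_timeD[OF T] by (intro pred_intros_countable)
    then show "Measurable.pred (Filt X t) (\<lambda>\<omega>. S \<omega> \<le> t)" by (simp add: S_def SUP_le_iff)
  qed
  have inc: "incseq (\<lambda>n. T n \<omega>)" for \<omega>
  proof (rule incseq_SucI)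
    fix n
    have "U (Suc n) \<subseteq> U n" unfolding U_def by (intro UN_mono order_refl subset_ball) (simp add: field_simps)
    then show "T n \<omega> \<le> T (Suc n) \<omega>" unfolding T_def rat_hit_def by (intro INF_mono) auto
  qed
  have "AE \<omega> in Law X (Some x). S \<omega> < lifetime X \<omega> \<longrightarrow>
      limitin comp_top (\<lambda>n. Pos X (T n \<omega>) \<omega>) (Pos X (S \<omega>) \<omega>) sequentially"
    using qlc[unfolded quasi_left_continuous_def, THEN spec, THEN mp, of T] T inc unfolding S_def by simp
  then show ?thesis using regular_after[OF S] good_L_AE
  proof eventually_elim
    case (elim \<omega>)
    then have rc: "\<omega> \<in> rc_paths" and P: "\<omega> \<in> Path X" and L: "\<omega> \<in> L" using good_rc good_Path by auto
    let ?h = "hitting_time X F \<omega>"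
    show "tau 0 \<omega> \<le> ?h"
    proof (cases "?h < top")
      case fin: True
      have hF: "Pos X ?h \<omega> \<in> Some ` F" by (rule hitting_time_closed[OF rc F_closed fin])
      have Th: "T n \<omega> \<le> ?h" for n unfolding T_def using hF U(2) by (intro rat_hit_le[OF rc fin U(1)]) auto
      then have Sh: "S \<omega> \<le> ?h" unfolding S_def by (intro SUP_least)
      \<comment> \<open>Quasi-left-continuity speaks only of limits before the lifetime; being in
        \<open>F\<close>, hence alive, at the hitting time provides this.\<close>
      have "?h < lifetime X \<omega>" using hF by (intro less_lifetime[OF rc fin]) auto
      then have Sl: "S \<omega> < lifetime X \<omega>" using Sh by (rule le_less_trans[rotated])
      have lim: "limitin comp_top (\<lambda>n. Pos X (T n \<omega>) \<omega>) (Pos X (S \<omega>) \<omega>) sequentially" using elim(1) Sl by simp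
      have "Pos X (S \<omega>) \<omega> \<noteq> None"
      proof
        assume "Pos X (S \<omega>) \<omega> = None"
        then have "lifetime X \<omega> \<le> S \<omega>" unfolding lifetime_def by (intro Inf_lower) simp
        then show False using Sl by simp
      qed
      then obtain w where w: "Pos X (S \<omega>) \<omega> = Some w" by auto
      have "w \<in> F"
      \<comment> \<open>Otherwise some ball of radius e around \<open>w\<close> misses
        \<open>F\<close>, while eventually \<open>U n\<close> has points within e/2 of
        \<open>w\<close>, and these are closer than 1/(n+1) < e/2 to \<open>F\<close>.\<close>
      proof (rule ccontr)
        assume "w \<notin> F"
        then obtain e where e: "e > 0" "ball w e \<subseteq> - F"
          using F_closed by (metis ComplI open_Compl open_contains_ball)
        have "openin comp_top (Some ` ball w (e / 2))" by (auto simp: openin_comp_top)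
        moreover have "Pos X (S \<omega>) \<omega> \<in> Some ` ball w (e / 2)" using w e(1) by simp
        ultimately have "\<forall>\<^sub>F n in sequentially. Pos X (T n \<omega>) \<omega> \<in> Some ` ball w (e / 2)"
          using lim by (simp add: limitin_def)
        moreover have "\<forall>\<^sub>F n in sequentially. 1 / real (Suc n) < e / 2"
          using LIMSEQ_inverse_real_of_nat[THEN order_tendstoD(2), of "e / 2"] e(1) by (simp add: inverse_eq_divide)
        ultimately have "\<forall>\<^sub>F n in sequentially. False"
        proof eventually_elim
          case (elim n)
          have "T n \<omega> < top" using Th[of n] fin by (rule le_less_trans)
          then have "U n \<inter> ball w (e / 2) \<noteq> {}"
            using rat_hit_approx[OF rc, of "U n" "ball w (e / 2)"] elim(1) unfolding T_def by simp
          then obtain z y where zy: "y \<in> F" "dist y z < 1 / real (Suc n)" "dist w z < e / 2" by (auto simp: U_def)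
          have "dist w y \<le> dist w z + dist y z" by (rule dist_triangle2)
          then have "dist w y < e" using zy elim(2) by linarith
          then show False using e(2) zy(1) by auto
        qed
        then show False by simp
      qed
      then have r0: "rtau 0 (Shift X (S \<omega>) \<omega>) = 0" using elim(2) w by simp
      have "S \<omega> < top" using Sh fin by (rule le_less_trans)
      then obtain s where s: "0 \<le> s" "S \<omega> = ennreal s" by (cases "S \<omega>") auto
      have sL: "Shift X (ennreal s) \<omega> \<in> L" by (rule L_Shift[OF L s(1)])
      have t0: "tau 0 (Shift X (ennreal s) \<omega>) = 0" using r0 s(2) rtau_eq[OF sL, of 0] by simp
      \<comment> \<open>From its position in \<open>F\<close> at time \<open>s\<close> the path
        makes the functional increase at once, so tau 0 is at most s plus any positive e.\<close>
      have "tau 0 \<omega> \<le> ennreal s"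
      proof (rule ennreal_le_epsilon)
        fix e :: real assume e: "e > 0"
        have "0 < A e (Shift X (ennreal s) \<omega>)" using tau_less_iff[OF sL, of 0 e] t0 e by simp
        then have "0 < A (s + e) \<omega>" using A_add[OF L s(1), of e] A_nonneg[OF L s(1)] e by simp
        then have "tau 0 \<omega> < ennreal (s + e)" using tau_less_iff[OF L, of 0 "s + e"] s(1) e by simp
        then show "tau 0 \<omega> \<le> ennreal s + ennreal e" using s(1) e by simp
      qed
      then show ?thesis using Sh s(2) by simp
    qed (simp add: less_top[symmetric])
  qed
qed

lemma hitting_op_eq: "u \<in> C0 \<Longrightarrow> hitting_op X F u x = tc_semigroup X A 0 u x"
proof -
  assume u: "u \<in> C0"
  have "hitting_op X F u x = (\<integral>\<omega>. version u (0, \<omega>) \<partial>Law X (Some x))"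
    unfolding hitting_op_def
  proof (rule expect_AE[OF version_section_Law[OF u]])
    show "AE \<omega> in Law X (Some x). ext0 u (Pos X (hitting_time X F \<omega>) \<omega>) = version u (0, \<omega>)"
      using hitting_le_tau tau_le_hitting good_AE
      by eventually_elim (simp add: version_good[OF u])
  qed
  then show ?thesis by (simp add: tc_semigroup_eq[OF u])
qed

lemma tc_semigroup_0_F:
  assumes u: "u \<in> C0" and x: "x \<in> F" shows "tc_semigroup X A 0 u x = u x"
proof -
  have "AE \<omega> in Law X (Some x). tau 0 \<omega> = 0" using x by (simp add: F_regular)
  then have "AE \<omega> in Law X (Some x). version u (0, \<omega>) = u x"
    using Pos_0_AE good_AE by eventually_elim (simp add: version_good[OF u])
  then have "(\<integral>\<omega>. version u (0, \<omega>) \<partial>Law X (Some x)) = (\<integral>\<omega>. u x \<partial>Law X (Some x))"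
    by (intro integral_cong_AE version_section_Law u) auto
  then show ?thesis using prob_space.prob_space[OF prob_space_Law] by (simp add: tc_semigroup_eq[OF u])
qed

text \<open>The time-changed path is in \<open>F\<close> or in the cemetery. The latter contributes
  the value 0, which is why 0 <= c is required separately.\<close>

lemma tc_semigroup_bound_F:
  assumes u: "u \<in> C0" and t: "0 \<le> t" and c: "0 \<le> c" "\<And>x. x \<in> F \<Longrightarrow> \<bar>u x\<bar> \<le> c"
  shows "\<bar>tc_semigroup X A t u x\<bar> \<le> c"
proof -
  have "\<bar>\<integral>\<omega>. version u (t, \<omega>) \<partial>Law X (Some x)\<bar> \<le> (\<integral>\<omega>. \<bar>version u (t, \<omega>)\<bar> \<partial>Law X (Some x))" by simp
  also have "\<dots> \<le> c"
  proof (rule prob_space.integral_le_const[OF prob_space_Law integrable_abs[OF version_integrable[OF u]]])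
    show "AE \<omega> in Law X (Some x). \<bar>version u (t, \<omega>)\<bar> \<le> c"
      using tau_in_F[OF t] good_AE by eventually_elim (use c in \<open>auto simp: version_good[OF u t]\<close>)
  qed
  finally show ?thesis by (simp add: tc_semigroup_eq[OF u t])
qed

end

section \<open>Potentials of the time-changed process\<close>

lemma (in time_change) tc_semigroup_nonneg:
  assumes f: "f \<in> C0" "\<And>x. 0 \<le> f x" and t: "0 \<le> t"
  shows "0 \<le> tc_semigroup X A t f x"
proof -
  have "AE \<omega> in Law X (Some x). 0 \<le> version f (t, \<omega>)"
    using good_AE
  proof eventually_elim
    case (elim \<omega>)
    then show ?case using f(2) by (cases "Pos X (tau t \<omega>) \<omega>") (simp_all add: version_good[OF f(1) t])
  qed
  then show ?thesis by (simp add: tc_semigroup_eq[OF f(1) t] integral_nonneg_AE)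
qed

lemma (in time_change) occ_integral:
  fixes h :: "'a \<Rightarrow> real"
  assumes h: "h \<in> borel_measurable borel" "\<And>y. 0 \<le> h y" "\<And>y. h y \<le> c"
  shows "(\<integral>\<^sup>+ \<omega>. ext0 (\<lambda>y. ennreal (h y)) (occ x t \<omega>) \<partial>Law X (Some x)) = ennreal (\<integral>\<omega>. ext0 h (occ x t \<omega>) \<partial>Law X (Some x))"
proof -
  have e: "ext0 (\<lambda>y. ennreal (h y)) z = ennreal (ext0 h z)" for z by (cases z) simp_all
  have c0: "0 \<le> c" using h(2,3) order_trans by blast
  have b: "0 \<le> ext0 h z" "\<bar>ext0 h z\<bar> \<le> c" for z using h c0 by (cases z; simp)+
  show ?thesis unfolding e
    by (rule nn_integral_eq_integral[OF integrable_bounded_Law[OF measurable_compose[OF occ_measurable ext0_measurable[OF h(1)]] b(2)]])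
       (simp add: b(1))
qed

locale kato_time_change = regular_time_change X A L F
  for X :: "('w, 'a::{metric_space, second_countable_topology}) process"
    and A :: "real \<Rightarrow> 'w \<Rightarrow> real" and L :: "'w set" and F :: "'a set" +
  fixes G :: "'a \<Rightarrow> 'a \<Rightarrow> ennreal" and \<mu> :: "'a measure"
  assumes G_lsc: "lower_semicont (\<lambda>(x, y). G x y)"
    and G_pos: "0 < G x y"
    and sets_mu: "sets \<mu> = sets borel"
    and G_finite: "(\<integral>\<^sup>+ y. G x y \<partial>\<mu>) < \<infinity>"
    and G_C0: "(\<lambda>x. enn2real (\<integral>\<^sup>+ y. G x y \<partial>\<mu>)) \<in> C0"
    and potential: "f \<in> borel_measurable borel \<Longrightarrow>
      (\<integral>\<^sup>+ \<omega>. (\<integral>\<^sup>+ s\<in>{0..}. ext0 f (Pos X (ennreal s) \<omega>) \<partial>stieltjes A \<omega>) \<partial>Law X (Some x)) = (\<integral>\<^sup>+ y. G x y * f y \<partial>\<mu>)"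
begin

lemma G_measurable [measurable]: "G x \<in> borel_measurable \<mu>"
  using lower_semicont_measurable[OF lower_semicont_section(2)[OF G_lsc]]
  by (simp add: measurable_cong_sets[OF sets_mu refl])

lemma occ_potential:
  fixes f :: "'a \<Rightarrow> ennreal"
  assumes "f \<in> borel_measurable borel"
  shows "(\<integral>\<^sup>+ t\<in>{0..}. (\<integral>\<^sup>+ \<omega>. ext0 f (occ x t \<omega>) \<partial>Law X (Some x)) \<partial>lborel) = (\<integral>\<^sup>+ y. G x y * f y \<partial>\<mu>)"
  unfolding occupation[OF assms] by (rule potential[OF assms])

lemma potential_C0:
  assumes f: "f \<in> C0" "\<And>x. 0 \<le> f x"
  shows "(\<integral>\<^sup>+ t\<in>{0..}. ennreal (tc_semigroup X A t f x) \<partial>lborel) = (\<integral>\<^sup>+ y. G x y * ennreal (f y) \<partial>\<mu>)"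
proof -
  obtain c where c: "\<And>x. \<bar>f x\<bar> \<le> c" using C0_bounded[OF f(1)] by blast
  have c': "f x \<le> c" for x using c[of x] by simp
  have fm: "(\<lambda>y. ennreal (f y)) \<in> borel_measurable borel" using C0_measurable[OF f(1)] by measurable
  have "ennreal (tc_semigroup X A t f x) * indicator {0..} t
      = (\<integral>\<^sup>+ \<omega>. ext0 (\<lambda>y. ennreal (f y)) (occ x t \<omega>) \<partial>Law X (Some x)) * indicator {0..} t" for t
  proof (cases "0 \<le> t")
    case True
    have "(\<integral>\<omega>. version f (t, \<omega>) \<partial>Law X (Some x)) = (\<integral>\<omega>. ext0 f (occ x t \<omega>) \<partial>Law X (Some x))"
    proof (rule integral_cong_AE)
      show "AE \<omega> in Law X (Some x). version f (t, \<omega>) = ext0 f (occ x t \<omega>)"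
        using good_AE occ_props(2) by eventually_elim (simp add: version_good[OF f(1) True] True)
      show "(\<lambda>\<omega>. ext0 f (occ x t \<omega>)) \<in> borel_measurable (Law X (Some x))"
        by (rule measurable_compose[OF occ_measurable ext0_measurable[OF C0_measurable[OF f(1)]]])
    qed (rule version_section_Law[OF f(1)])
    then show ?thesis
      unfolding tc_semigroup_eq[OF f(1) True] occ_integral[OF C0_measurable[OF f(1)] f(2) c'] by simp
  qed simp
  then show ?thesis using occ_potential[OF fm, of x] by simp
qed

text \<open>Strict positivity of \<open>G\<close> leaves no other way for the potential of an
  indicator to vanish.\<close>

lemma measure_mu_null:
  assumes "(\<integral>\<^sup>+ y. G x y * indicator N y \<partial>\<mu>) = 0" "N \<in> sets borel"
  shows "N \<in> null_sets \<mu>"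
proof -
  have N [measurable]: "N \<in> sets \<mu>" using assms(2) sets_mu by simp
  have "AE y in \<mu>. G x y * indicator N y = 0"
    using assms(1) by (subst (asm) nn_integral_0_iff_AE) simp_all
  then have "AE y in \<mu>. y \<notin> N"
    by eventually_elim (use G_pos[of x] in \<open>auto split: split_indicator_asm simp: zero_less_iff_neq_zero\<close>)
  then show ?thesis using N by (simp add: AE_iff_null_sets)
qed

text \<open>A priori \<open>P\<^sub>s f\<close> is only universally measurable, whereas \<open>V\<close> acts on Borel functions; the finite measure
  \<open>G x0 \<mu>\<close>, which has the same null sets as \<open>\<mu>\<close>, serves as initial law to produce a Borel version.\<close>

lemma semigroup_borel_version:
  assumes f: "f \<in> C0" "\<And>x. 0 \<le> f x" "\<And>x. f x \<le> c" and s: "0 \<le> s"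
  shows "\<exists>h\<in>borel_measurable borel. \<exists>N\<in>null_sets \<mu>. (\<forall>y. 0 \<le> h y \<and> h y \<le> c) \<and> (\<forall>y. y \<notin> N \<longrightarrow> tc_semigroup X A s f y = h y)"
proof -
  have c0: "0 \<le> c" using f(2,3) order_trans by blast
  have fc: "\<bar>f x\<bar> \<le> c" for x using f(2,3)[of x] by simp
  obtain x0 :: 'a where True by blast
  define \<kappa> where "\<kappa> = (\<integral>\<^sup>+ y. G x0 y \<partial>\<mu>)"
  have \<kappa>fin: "\<kappa> < top" using G_finite[of x0] by (simp add: \<kappa>_def)
  show ?thesis
  \<comment> \<open>For \<kappa> = 0 the measure \<mu> is zero and any bounded Borel function is a
    version; otherwise \<kappa> normalises the measure to an initial law.\<close>
  proof (cases "\<kappa> = 0")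
    case True
    have null: "UNIV \<in> null_sets \<mu>" by (rule measure_mu_null[of x0]) (use True in \<open>simp_all add: \<kappa>_def\<close>)
    show ?thesis using c0 by (intro bexI[of _ "\<lambda>_. 0"] bexI[OF _ null]) auto
  next
    case False
    define \<nu> where "\<nu> = distr (density \<mu> (\<lambda>y. G x0 y / \<kappa>)) comp_borel Some"
    have sp: "space \<mu> = UNIV" using sets_eq_imp_space_eq[OF sets_mu] by simp
    have Sm: "Some \<in> density \<mu> (\<lambda>y. G x0 y / \<kappa>) \<rightarrow>\<^sub>M comp_borel"
      using Some_measurable by (simp add: measurable_cong_sets[OF sets_mu refl])
    have "emeasure (density \<mu> (\<lambda>y. G x0 y / \<kappa>)) (space \<mu>) = (\<integral>\<^sup>+ y. G x0 y / \<kappa> \<partial>\<mu>)"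
      using sp sets.top[of \<mu>] by (subst emeasure_density) (auto intro!: nn_integral_cong)
    also have "\<dots> = \<kappa> / \<kappa>" by (simp add: nn_integral_divide \<kappa>_def)
    also have "\<dots> = 1" using False \<kappa>fin by (intro ennreal_divide_self) (auto simp: less_top)
    finally have "prob_space (density \<mu> (\<lambda>y. G x0 y / \<kappa>))" by (intro prob_spaceI) simp
    then have "prob_space \<nu>" unfolding \<nu>_def by (rule prob_space.prob_space_distr[OF _ Sm])
    then have \<nu>: "initial_law \<nu>" by (simp add: initial_law_def \<nu>_def)
    obtain h0 M where h0: "h0 \<in> borel_measurable comp_borel" and M: "M \<in> null_sets \<nu>"
      and eq: "\<And>z. z \<notin> M \<Longrightarrow> (\<integral>\<omega>. version f (s, \<omega>) \<partial>Law X z) = h0 z"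
      using expectation_version[OF \<nu> version_section[OF f(1)] version_bound[OF f(1) fc], of s] by blast
    define N where "N = Some -` M"
    have MN: "M \<in> sets comp_borel" using M by (auto simp: \<nu>_def)
    have N: "N \<in> sets borel" using measurable_sets[OF Some_measurable MN] by (simp add: N_def)
    have "N \<in> null_sets \<mu>"
    proof (rule measure_mu_null[OF _ N, of x0])
      have "0 = emeasure (density \<mu> (\<lambda>y. G x0 y / \<kappa>)) N"
        using M emeasure_distr[OF Sm MN] by (simp add: \<nu>_def N_def sp null_sets_def)
      also have "\<dots> = (\<integral>\<^sup>+ y. G x0 y / \<kappa> * indicator N y \<partial>\<mu>)"
        using N sets_mu by (intro emeasure_density) simp_all
      also have "\<dots> = (\<integral>\<^sup>+ y. G x0 y * indicator N y / \<kappa> \<partial>\<mu>)"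
        by (intro nn_integral_cong) (auto split: split_indicator)
      also have "\<dots> = (\<integral>\<^sup>+ y. G x0 y * indicator N y \<partial>\<mu>) / \<kappa>"
        using N sets_mu by (intro nn_integral_divide) simp
      finally show "(\<integral>\<^sup>+ y. G x0 y * indicator N y \<partial>\<mu>) = 0" using \<kappa>fin by (simp add: ennreal_divide_eq_0_iff less_top[symmetric])
    qed
    \<comment> \<open>Truncation to [0, c] restores the bounds on the exceptional set.\<close>
    moreover define h where "h y = max 0 (min c (h0 (Some y)))" for y
    have "h \<in> borel_measurable borel"
      unfolding h_def using measurable_compose[OF Some_measurable h0] by measurable
    moreover have "tc_semigroup X A s f y = h y" if "y \<notin> N" for y
    proof -
      have "tc_semigroup X A s f y = h0 (Some y)"
        using eq[of "Some y"] that unfolding N_def tc_semigroup_eq[OF f(1) s] by simp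
      moreover have "0 \<le> tc_semigroup X A s f y" by (rule tc_semigroup_nonneg[OF f(1,2) s])
      moreover have "tc_semigroup X A s f y \<le> c" using tc_semigroup_bound[OF f(1) s fc, of y] by simp
      ultimately show ?thesis by (simp add: h_def)
    qed
    moreover have "0 \<le> h y \<and> h y \<le> c" for y using c0 by (simp add: h_def)
    ultimately show ?thesis by blast
  qed
qed

text \<open>The \<mu>-null set \<open>N\<close> has potential zero, so the time-changed process
  avoids it almost surely at almost every time t. At such t the Borel version \<open>h\<close> may
  replace P_s f, and the semigroup law applies: V h is the integral of P_r f over r >= s.\<close>

lemma potential_shift:
  assumes f: "f \<in> C0" "\<And>x. 0 \<le> f x" and s: "0 \<le> s"
    and h: "h \<in> borel_measurable borel" "\<And>y. 0 \<le> h y" "\<And>y. h y \<le> c"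
    and N: "N \<in> null_sets \<mu>" "\<And>y. y \<notin> N \<Longrightarrow> tc_semigroup X A s f y = h y"
  shows "(\<integral>\<^sup>+ t\<in>{0..}. ennreal (tc_semigroup X A (t + s) f x) \<partial>lborel) = (\<integral>\<^sup>+ y. G x y * ennreal (h y) \<partial>\<mu>)"
proof -
  have Ns: "N \<in> sets borel" using N(1) sets_mu by auto
  have SN: "Some ` N \<in> sets comp_borel" using Ns by blast
  have ind: "ext0 (indicator N :: _ \<Rightarrow> ennreal) z = indicator (Some ` N) z" for z
    by (cases z) (auto split: split_indicator)
  have meas: "(\<lambda>t. \<integral>\<^sup>+ \<omega>. ext0 g (occ x t \<omega>) \<partial>Law X (Some x)) \<in> borel_measurable lborel"
    if "g \<in> borel_measurable borel" for g :: "'a \<Rightarrow> ennreal"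
  proof -
    interpret P: prob_space "Law X (Some x)" by (rule prob_space_Law)
    have "(\<lambda>p. ext0 g (case p of (t, \<omega>) \<Rightarrow> occ x t \<omega>)) \<in> borel_measurable (borel \<Otimes>\<^sub>M Law X (Some x))"
      by (rule measurable_compose[OF occ_props(1) ext0_measurable[OF that]])
    then have "(\<lambda>t. \<integral>\<^sup>+ \<omega>. ext0 g (occ x t \<omega>) \<partial>Law X (Some x)) \<in> borel_measurable borel"
      by (intro P.borel_measurable_nn_integral) (simp add: split_beta')
    then show ?thesis by simp
  qed
  have "(\<integral>\<^sup>+ t\<in>{0..}. (\<integral>\<^sup>+ \<omega>. ext0 (indicator N) (occ x t \<omega>) \<partial>Law X (Some x)) \<partial>lborel) = (\<integral>\<^sup>+ y. G x y * indicator N y \<partial>\<mu>)"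
    using Ns by (intro occ_potential) simp
  also have "\<dots> = 0"
  proof -
    have "AE y in \<mu>. G x y * indicator N y = 0" using AE_not_in[OF N(1)] by eventually_elim simp
    then have "(\<integral>\<^sup>+ y. G x y * indicator N y \<partial>\<mu>) = (\<integral>\<^sup>+ y. 0 \<partial>\<mu>)" by (rule nn_integral_cong_AE)
    then show ?thesis by simp
  qed
  finally have "AE t in lborel. (\<integral>\<^sup>+ \<omega>. ext0 (indicator N) (occ x t \<omega>) \<partial>Law X (Some x)) * indicator {0..} t = 0"
    using meas[of "indicator N"] Ns by (subst (asm) nn_integral_0_iff_AE) simp_all
  then have "AE t in lborel. ennreal (tc_semigroup X A (t + s) f x) * indicator {0..} t
      = (\<integral>\<^sup>+ \<omega>. ext0 (\<lambda>y. ennreal (h y)) (occ x t \<omega>) \<partial>Law X (Some x)) * indicator {0..} t"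
  proof eventually_elim
    case (elim t)
    show ?case
    proof (cases "0 \<le> t")
      case True
      then have "(\<integral>\<^sup>+ \<omega>. indicator (Some ` N) (occ x t \<omega>) \<partial>Law X (Some x)) = 0" using elim by (simp add: ind)
      then have "AE \<omega> in Law X (Some x). indicator (Some ` N) (occ x t \<omega>) = (0 :: ennreal)"
        using SN by (subst (asm) nn_integral_0_iff_AE) (auto intro!: measurable_compose[OF occ_measurable])
      then have ae: "AE \<omega> in Law X (Some x). ext0 (tc_semigroup X A s f) (Pos X (tau t \<omega>) \<omega>) = ext0 h (occ x t \<omega>)"
        using occ_props(2)
      proof eventually_elim
        case (elim \<omega>)
        then have "Pos X (tau t \<omega>) \<omega> = occ x t \<omega>" "occ x t \<omega> \<notin> Some ` N" using True by (auto split: split_indicator_asm)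
        then show ?case using N(2) by (cases "occ x t \<omega>") auto
      qed
      have "tc_semigroup X A (t + s) f x = tc_semigroup X A t (tc_semigroup X A s f) x"
        using tc_semigroup_add[OF f(1) True s] by simp
      also have "\<dots> = (\<integral>\<omega>. ext0 h (occ x t \<omega>) \<partial>Law X (Some x))"
        unfolding tc_semigroup_def[of X A t]
        by (rule expect_AE[OF measurable_compose[OF occ_measurable ext0_measurable[OF h(1)]] ae])
      finally show ?thesis unfolding occ_integral[OF h] by simp
    qed simp
  qed
  then have "(\<integral>\<^sup>+ t\<in>{0..}. ennreal (tc_semigroup X A (t + s) f x) \<partial>lborel)
     = (\<integral>\<^sup>+ t\<in>{0..}. (\<integral>\<^sup>+ \<omega>. ext0 (\<lambda>y. ennreal (h y)) (occ x t \<omega>) \<partial>Law X (Some x)) \<partial>lborel)"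
    by (rule nn_integral_cong_AE)
  also have "\<dots> = (\<integral>\<^sup>+ y. G x y * ennreal (h y) \<partial>\<mu>)"
    using h(1) by (intro occ_potential) measurable
  finally show ?thesis .
qed

section \<open>Time integrals of the semigroup and their continuity\<close>

lemma integrable_tc:
  assumes f: "f \<in> C0" and w: "integrable lborel w" and w0: "\<And>r. r < 0 \<Longrightarrow> w r = 0" and t: "0 \<le> t"
  shows "integrable lborel (\<lambda>r. w r * tc_semigroup X A (t + r) f x)"
proof -
  obtain c where c: "\<And>x. \<bar>f x\<bar> \<le> c" using C0_bounded[OF f] by blast
  have eq: "w r * tc_semigroup X A (t + r) f x = w r * (indicator {0..} (t + r) * tc_semigroup X A (t + r) f x)" for r
    using w0[of r] t by (cases "r < 0") (auto split: split_indicator)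
  have [measurable]: "w \<in> borel_measurable borel" using w by (simp add: borel_measurable_integrable[OF w, simplified])
  have [measurable]: "(\<lambda>r. indicator {0..} (t + r) * tc_semigroup X A (t + r) f x) \<in> borel_measurable borel"
    using measurable_compose[OF _ tc_semigroup_time_measurable[OF f], of "\<lambda>r. t + r" borel x] by simp
  show ?thesis
  proof (rule Bochner_Integration.integrable_bound[of _ "\<lambda>r. w r * c"])
    show "integrable lborel (\<lambda>r. w r * c)" using w by simp
    show "(\<lambda>r. w r * tc_semigroup X A (t + r) f x) \<in> borel_measurable lborel" unfolding eq by measurable
    have "\<bar>w r\<bar> * \<bar>tc_semigroup X A (t + r) f x\<bar> \<le> \<bar>w r\<bar> * \<bar>c\<bar>" for r
      using tc_semigroup_bound[OF f _ c, of "t + r" x] w0[of r] t by (cases "r < 0") (auto intro!: mult_left_mono)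
    then show "AE r in lborel. norm (w r * tc_semigroup X A (t + r) f x) \<le> norm (w r * c)"
      by (simp add: abs_mult)
  qed
qed

lemma tc_integral_bound:
  assumes f: "f \<in> C0" and w: "integrable lborel w" and w0: "\<And>r. r < 0 \<Longrightarrow> w r = 0" and t: "0 \<le> t"
    and c: "\<And>r. 0 \<le> r \<Longrightarrow> w r \<noteq> 0 \<Longrightarrow> \<bar>tc_semigroup X A (t + r) f x - a\<bar> \<le> c"
  shows "\<bar>(\<integral>r. w r * tc_semigroup X A (t + r) f x \<partial>lborel) - (\<integral>r. w r \<partial>lborel) * a\<bar> \<le> (\<integral>r. \<bar>w r\<bar> \<partial>lborel) * c"
proof -
  note i = integrable_tc[OF f w w0 t, of x]
  have "(\<integral>r. w r * tc_semigroup X A (t + r) f x \<partial>lborel) - (\<integral>r. w r \<partial>lborel) * a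
      = (\<integral>r. w r * tc_semigroup X A (t + r) f x - w r * a \<partial>lborel)"
    using i w by simp
  also have "\<bar>\<dots>\<bar> \<le> (\<integral>r. \<bar>w r * tc_semigroup X A (t + r) f x - w r * a\<bar> \<partial>lborel)" by (rule integral_abs_bound)
  also have "\<dots> \<le> (\<integral>r. \<bar>w r\<bar> * c \<partial>lborel)"
  proof (rule integral_mono)
    show "integrable lborel (\<lambda>r. \<bar>w r * tc_semigroup X A (t + r) f x - w r * a\<bar>)" using i w by simp
    show "integrable lborel (\<lambda>r. \<bar>w r\<bar> * c)" using w by simp
    show "\<bar>w r * tc_semigroup X A (t + r) f x - w r * a\<bar> \<le> \<bar>w r\<bar> * c" for r
      using c[of r] w0[of r] by (cases "w r = 0"; cases "r < 0") (auto simp: abs_mult right_diff_distrib[symmetric] intro!: mult_left_mono)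
  qed
  finally show ?thesis using w by simp
qed

abbreviation tc_avg :: "real \<Rightarrow> ('a \<Rightarrow> real) \<Rightarrow> 'a \<Rightarrow> real" where
  "tc_avg s \<equiv> tc_integral (indicator {0..s})"

lemma indicator_weight:
  assumes "0 \<le> s"
  shows "integrable lborel (indicator {0..s} :: real \<Rightarrow> real)" "\<And>r. r < 0 \<Longrightarrow> indicator {0..s} r = (0 :: real)"
    "(\<integral>r. indicator {0..s} r \<partial>lborel) = (s :: real)"
  using assms by (auto intro!: integrable_real_indicator)

text \<open>Splitting the potential at time s gives V f = K_s f + V h with \<open>h\<close> a Borel
  version of P_s f. Nonnegativity allows the splitting in \<open>ennreal\<close>; finiteness of V h
  allows the subtraction.\<close>

lemma tc_avg_C0_nonneg:
  assumes f: "f \<in> C0" "\<And>x. 0 \<le> f x" and s: "0 \<le> s"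
  shows "tc_avg s f \<in> C0"
proof -
  obtain c where c: "\<And>x. \<bar>f x\<bar> \<le> c" using C0_bounded[OF f(1)] by blast
  have fc: "f x \<le> c" for x using c[of x] by simp
  obtain h N where h: "h \<in> borel_measurable borel" "\<And>y. 0 \<le> h y" "\<And>y. h y \<le> c"
    and N: "N \<in> null_sets \<mu>" "\<And>y. y \<notin> N \<Longrightarrow> tc_semigroup X A s f y = h y"
    using semigroup_borel_version[OF f fc s] by blast
  define V where "V g x = (\<integral>\<^sup>+ y. G x y * ennreal (g y) \<partial>\<mu>)" for g x
  note VC = lower_semicont_potential_C0[OF G_lsc sets_mu G_finite G_C0]
  have Vf: "V f x < \<infinity>" "(\<lambda>x. enn2real (V f x)) \<in> C0" and Vh: "V h x < \<infinity>" "(\<lambda>x. enn2real (V h x)) \<in> C0" for x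
    unfolding V_def using VC[OF C0_measurable[OF f(1)] f(2) fc] VC[OF h] by auto
  let ?w = "indicator {0..s} :: real \<Rightarrow> real"
  note w = indicator_weight[OF s]
  have "V f x = ennreal (tc_avg s f x) + V h x" for x
  proof -
    let ?p = "\<lambda>t. ennreal (indicator {0..} t * tc_semigroup X A t f x)"
    have [measurable]: "?p \<in> borel_measurable borel" using tc_semigroup_time_measurable[OF f(1), of x] by measurable
    have "V f x = (\<integral>\<^sup>+ t. ?p t \<partial>lborel)"
      unfolding V_def potential_C0[OF f, symmetric] by (intro nn_integral_cong) (auto split: split_indicator)
    also have "\<dots> = (\<integral>\<^sup>+ t. ?p t * indicator {..<s} t + ?p t * indicator {s..} t \<partial>lborel)"
      by (intro nn_integral_cong) (auto split: split_indicator)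
    also have "\<dots> = (\<integral>\<^sup>+ t. ?p t * indicator {..<s} t \<partial>lborel) + (\<integral>\<^sup>+ t. ?p t * indicator {s..} t \<partial>lborel)"
      by (rule nn_integral_add) measurable
    \<comment> \<open>The intervals [0, s) and [0, s] differ by one point, a Lebesgue null
      set.\<close>
    also have "(\<integral>\<^sup>+ t. ?p t * indicator {..<s} t \<partial>lborel) = (\<integral>\<^sup>+ t. ennreal (?w t * tc_semigroup X A (0 + t) f x) \<partial>lborel)"
      using AE_lborel_singleton[of s] by (intro nn_integral_cong_AE) (auto split: split_indicator)
    also have "\<dots> = ennreal (tc_avg s f x)"
      unfolding tc_integral_def
      using integrable_tc[OF f(1) w(1,2) order_refl, of x] tc_semigroup_nonneg[OF f]
      by (subst nn_integral_eq_integral) (auto split: split_indicator)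
    also have "(\<integral>\<^sup>+ t. ?p t * indicator {s..} t \<partial>lborel) = (\<integral>\<^sup>+ t. ?p (s + 1 * t) * indicator {s..} (s + 1 * t) \<partial>lborel)"
      by (subst nn_integral_real_affine[where c=1 and t=s]) simp_all
    also have "\<dots> = (\<integral>\<^sup>+ t\<in>{0..}. ennreal (tc_semigroup X A (t + s) f x) \<partial>lborel)"
      using s by (intro nn_integral_cong) (auto simp: add.commute split: split_indicator)
    also have "\<dots> = V h x" unfolding V_def by (rule potential_shift[OF f s h N])
    finally show ?thesis .
  qed
  moreover have "0 \<le> tc_avg s f x" for x
    unfolding tc_integral_def using tc_semigroup_nonneg[OF f] by (intro integral_nonneg_AE) (auto split: split_indicator)
  ultimately have "enn2real (V f x) = tc_avg s f x + enn2real (V h x)" for x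
    using Vh(1)[of x] by (simp add: enn2real_plus)
  then have "tc_avg s f = (\<lambda>x. enn2real (V f x) - enn2real (V h x))" by (auto simp: fun_eq_iff)
  then show ?thesis using C0_diff[OF Vf(2) Vh(2)] by simp
qed

end

section \<open>Strong continuity\<close>

lemma sup_norm_le: "(\<And>x. \<bar>v x\<bar> \<le> e) \<Longrightarrow> sup_norm v \<le> ennreal e"
  unfolding sup_norm_def by (intro SUP_least ennreal_leI)

lemma sup_dist_le: "0 \<le> e \<Longrightarrow> (\<And>x. \<bar>u x - v x\<bar> \<le> e) \<Longrightarrow> sup_dist u v \<le> e"
  unfolding sup_dist_def using sup_norm_le[of "\<lambda>x. u x - v x" e] by (metis enn2real_leI)

lemma le_sup_dist:
  assumes "u \<in> C0" "v \<in> C0" shows "\<bar>u x - v x\<bar> \<le> sup_dist u v"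
proof -
  have "ennreal \<bar>u x - v x\<bar> \<le> sup_norm (\<lambda>x. u x - v x)" unfolding sup_norm_def by (rule SUP_upper) simp
  then have "enn2real (ennreal \<bar>u x - v x\<bar>) \<le> enn2real (sup_norm (\<lambda>x. u x - v x))"
    using sup_norm_C0_diff_finite[OF assms] by (intro enn2real_mono) simp_all
  then show ?thesis by (simp add: sup_dist_def)
qed

lemma tendsto_0_ennrealI:
  fixes f :: "'b \<Rightarrow> ennreal"
  assumes "\<And>e. e > 0 \<Longrightarrow> \<forall>\<^sub>F x in S. f x \<le> ennreal e"
  shows "(f \<longlongrightarrow> 0) S"
proof (rule order_tendstoI)
  fix a :: ennreal assume "0 < a"
  then obtain b where b: "0 < b" "b < a" using dense by blast
  then obtain e where e: "b = ennreal e" "0 < e" by (cases b) (auto simp: top_unique)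
  show "\<forall>\<^sub>F x in S. f x < a" using assms[OF e(2)] by eventually_elim (use b e in auto)
qed simp

context kato_time_change
begin

abbreviation P :: "real \<Rightarrow> ('a \<Rightarrow> real) \<Rightarrow> 'a \<Rightarrow> real" where
  "P \<equiv> tc_semigroup X A"

text \<open>Strong continuity is described without reference to \<open>F\<close>. The time t = 0 is
  deliberately included in the estimate, which forces P_0 g = g.\<close>

definition cont_space :: "('a \<Rightarrow> real) set" where
  "cont_space = {g \<in> C0. (\<forall>t\<ge>0. P t g \<in> C0) \<and> (\<forall>e>0. \<exists>d>0. \<forall>t. 0 \<le> t \<longrightarrow> t < d \<longrightarrow> (\<forall>x. \<bar>P t g x - g x\<bar> \<le> e))}"

lemma cont_space_C0: "g \<in> cont_space \<Longrightarrow> g \<in> C0" and cont_space_P_C0: "g \<in> cont_space \<Longrightarrow> 0 \<le> t \<Longrightarrow> P t g \<in> C0"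
  by (simp_all add: cont_space_def)

lemma cont_space_cont: "g \<in> cont_space \<Longrightarrow> e > 0 \<Longrightarrow> \<exists>d>0. \<forall>t. 0 \<le> t \<longrightarrow> t < d \<longrightarrow> (\<forall>x. \<bar>P t g x - g x\<bar> \<le> e)"
  by (simp add: cont_space_def)

lemma cont_space_P_0: "g \<in> cont_space \<Longrightarrow> P 0 g = g"
proof
  fix x assume g: "g \<in> cont_space"
  have "\<bar>P 0 g x - g x\<bar> \<le> 0"
  proof (rule field_le_epsilon)
    fix e :: real assume "0 < e"
    from cont_space_cont[OF g this] obtain d where d: "d > 0" "\<forall>t. 0 \<le> t \<longrightarrow> t < d \<longrightarrow> (\<forall>x. \<bar>P t g x - g x\<bar> \<le> e)"
      by blast
    show "\<bar>P 0 g x - g x\<bar> \<le> 0 + e" using d(2)[rule_format, OF order_refl d(1), of x] by simp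
  qed
  then show "P 0 g x = g x" by simp
qed

lemma P_diff_le:
  assumes "f \<in> C0" "g \<in> C0" "0 \<le> t" "\<And>x. \<bar>f x - g x\<bar> \<le> e"
  shows "\<bar>P t f x - P t g x\<bar> \<le> e"
  using tc_semigroup_lincomb[OF assms(1,2,3), of 1 "-1" x] tc_semigroup_bound[OF C0_diff[OF assms(1,2)] assms(3,4), of x] by simp

lemma P_diff_le_F:
  assumes "f \<in> C0" "g \<in> C0" "0 \<le> t" "0 \<le> e" "\<And>x. x \<in> F \<Longrightarrow> \<bar>f x - g x\<bar> \<le> e"
  shows "\<bar>P t f x - P t g x\<bar> \<le> e"
  using tc_semigroup_lincomb[OF assms(1,2,3), of 1 "-1" x] tc_semigroup_bound_F[OF C0_diff[OF assms(1,2)] assms(3,4,5), of x] by simp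

lemma cont_space_lincomb:
  assumes f: "f \<in> cont_space" and g: "g \<in> cont_space"
  shows "(\<lambda>x. a * f x + b * g x) \<in> cont_space"
  unfolding cont_space_def
proof (intro CollectI conjI allI impI)
  show "(\<lambda>x. a * f x + b * g x) \<in> C0" by (intro C0_lincomb cont_space_C0 f g)
  have eq: "P t (\<lambda>x. a * f x + b * g x) = (\<lambda>x. a * P t f x + b * P t g x)" if "0 \<le> t" for t
    by (rule ext) (rule tc_semigroup_lincomb[OF cont_space_C0[OF f] cont_space_C0[OF g] that])
  show "P t (\<lambda>x. a * f x + b * g x) \<in> C0" if "0 \<le> t" for t
    unfolding eq[OF that] by (intro C0_lincomb cont_space_P_C0 f g that)
  fix e :: real assume e: "e > 0"
  define e' where "e' = e / (\<bar>a\<bar> + \<bar>b\<bar> + 1)"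
  have e': "e' > 0" using e by (auto simp: e'_def intro!: divide_pos_pos add_nonneg_pos)
  have "(\<bar>a\<bar> + \<bar>b\<bar> + 1) * e' = e" unfolding e'_def by (simp add: add_nonneg_eq_0_iff)
  then have le: "\<bar>a\<bar> * e' + \<bar>b\<bar> * e' \<le> e" using e' by (simp add: algebra_simps)
  obtain d1 d2 where d1: "d1 > 0" "\<And>t x. 0 \<le> t \<Longrightarrow> t < d1 \<Longrightarrow> \<bar>P t f x - f x\<bar> \<le> e'"
    and d2: "d2 > 0" "\<And>t x. 0 \<le> t \<Longrightarrow> t < d2 \<Longrightarrow> \<bar>P t g x - g x\<bar> \<le> e'"
    using cont_space_cont[OF f e'] cont_space_cont[OF g e'] by blast
  have "\<bar>P t (\<lambda>x. a * f x + b * g x) x - (a * f x + b * g x)\<bar> \<le> e" if t: "0 \<le> t" "t < min d1 d2" for t x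
  proof -
    have "P t (\<lambda>x. a * f x + b * g x) x - (a * f x + b * g x) = a * (P t f x - f x) + b * (P t g x - g x)"
      unfolding eq[OF t(1)] by (simp add: algebra_simps)
    also have "\<bar>\<dots>\<bar> \<le> \<bar>a\<bar> * \<bar>P t f x - f x\<bar> + \<bar>b\<bar> * \<bar>P t g x - g x\<bar>"
      using abs_triangle_ineq[of "a * (P t f x - f x)" "b * (P t g x - g x)"] by (simp only: abs_mult)
    also have "\<dots> \<le> \<bar>a\<bar> * e' + \<bar>b\<bar> * e'" using d1(2) d2(2) t by (intro add_mono mult_left_mono) auto
    finally show ?thesis using le by simp
  qed
  then show "\<exists>d>0. \<forall>t. 0 \<le> t \<longrightarrow> t < d \<longrightarrow> (\<forall>x. \<bar>P t (\<lambda>x. a * f x + b * g x) x - (a * f x + b * g x)\<bar> \<le> e)"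
    using d1(1) d2(1) by (intro exI[of _ "min d1 d2"] conjI allI impI) simp_all
qed

text \<open>Every P_t is a contraction, so an approximation passes through it with the same error;
  an e/3 argument does the rest.\<close>

lemma cont_space_closed:
  assumes appr: "\<And>e. e > 0 \<Longrightarrow> \<exists>g\<in>cont_space. \<forall>x. \<bar>g x - f x\<bar> \<le> e"
  shows "f \<in> cont_space"
  unfolding cont_space_def
proof (intro CollectI conjI allI impI)
  show f: "f \<in> C0"
  proof (rule C0_uniform_limit)
    fix e :: real assume e: "e > 0"
    obtain g where "g \<in> cont_space" "\<forall>x. \<bar>g x - f x\<bar> \<le> e" using appr[OF e] by blast
    then show "\<exists>g\<in>C0. \<forall>x. \<bar>g x - f x\<bar> \<le> e" by (intro bexI[of _ g] cont_space_C0)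
  qed
  show "P t f \<in> C0" if t: "0 \<le> t" for t
  proof (rule C0_uniform_limit)
    fix e :: real assume e: "e > 0"
    obtain g where g: "g \<in> cont_space" "\<And>x. \<bar>g x - f x\<bar> \<le> e" using appr[OF e] by blast
    show "\<exists>h\<in>C0. \<forall>x. \<bar>h x - P t f x\<bar> \<le> e"
      using P_diff_le[OF cont_space_C0[OF g(1)] f t g(2)] cont_space_P_C0[OF g(1) t] by (intro bexI[of _ "P t g"]) auto
  qed
  fix e :: real assume e: "e > 0"
  obtain g where g: "g \<in> cont_space" "\<And>x. \<bar>g x - f x\<bar> \<le> e / 3" using appr[of "e / 3"] e by auto
  obtain d where d: "d > 0" "\<And>t x. 0 \<le> t \<Longrightarrow> t < d \<Longrightarrow> \<bar>P t g x - g x\<bar> \<le> e / 3"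
    using cont_space_cont[OF g(1), of "e / 3"] e by auto
  have "\<bar>P t f x - f x\<bar> \<le> e" if t: "0 \<le> t" "t < d" for t x
    using P_diff_le[OF cont_space_C0[OF g(1)] f t(1) g(2), of x] d(2)[OF t, of x] g(2)[of x] by linarith
  then show "\<exists>d>0. \<forall>t. 0 \<le> t \<longrightarrow> t < d \<longrightarrow> (\<forall>x. \<bar>P t f x - f x\<bar> \<le> e)" using d(1) by blast
qed

lemma integral_shift:
  assumes f: "f \<in> C0" and a: "0 \<le> a" and b: "0 \<le> b"
  shows "tc_avg (a + b) f x = tc_avg a f x + (\<integral>r. indicator {0..b} r * P (a + r) f x \<partial>lborel)"
proof -
  have i: "integrable lborel (\<lambda>r. indicator {0..a + b} r * P r f x)"
    using integrable_tc[OF f indicator_weight(1,2) order_refl, of "a + b" x] a b by simp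
  have "integrable lborel (\<lambda>r. indicator S r * (indicator {0..a + b} r * P r f x))" if "S \<in> sets borel" for S
    using integrable_mult_indicator[OF _ i, of S] that by simp
  then have i2: "integrable lborel (\<lambda>r. indicator {..a} r * (indicator {0..a + b} r * P r f x))"
    "integrable lborel (\<lambda>r. indicator {a<..} r * (indicator {0..a + b} r * P r f x))" by simp_all
  have "tc_avg (a + b) f x = (\<integral>r. indicator {..a} r * (indicator {0..a + b} r * P r f x) + indicator {a<..} r * (indicator {0..a + b} r * P r f x) \<partial>lborel)"
    unfolding tc_integral_def by (intro Bochner_Integration.integral_cong) (auto split: split_indicator)
  also have "\<dots> = (\<integral>r. indicator {..a} r * (indicator {0..a + b} r * P r f x) \<partial>lborel)
      + (\<integral>r. indicator {a<..} r * (indicator {0..a + b} r * P r f x) \<partial>lborel)"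
    by (rule Bochner_Integration.integral_add[OF i2])
  also have "(\<integral>r. indicator {..a} r * (indicator {0..a + b} r * P r f x) \<partial>lborel) = tc_avg a f x"
    unfolding tc_integral_def using b by (intro Bochner_Integration.integral_cong) (auto split: split_indicator)
  also have "(\<integral>r. indicator {a<..} r * (indicator {0..a + b} r * P r f x) \<partial>lborel)
      = (\<integral>r. indicator {a<..} (a + 1 * r) * (indicator {0..a + b} (a + 1 * r) * P (a + 1 * r) f x) \<partial>lborel)"
    by (subst lborel_integral_real_affine[where c=1 and t=a]) simp_all
  also have "\<dots> = (\<integral>r. indicator {0..b} r * P (a + r) f x \<partial>lborel)"
  \<comment> \<open>The translated integrand omits r = 0, which corresponds to the common end point
    \<open>a\<close>.\<close>
  proof (rule integral_cong_AE)
    have m: "(\<lambda>r. indicator {0..b} r * P (a + r) f x) \<in> borel_measurable lborel"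
      using integrable_tc[OF f indicator_weight(1,2) a, of b x] b by (intro borel_measurable_integrable) simp
    then show "(\<lambda>r. indicator {0..b} r * P (a + r) f x) \<in> borel_measurable lborel" .
    have "(\<lambda>r. indicator {0<..} r * (indicator {0..b} r * P (a + r) f x)) \<in> borel_measurable lborel"
      by (rule borel_measurable_times[OF _ m]) simp
    moreover have "(\<lambda>r. indicator {a<..} (a + 1 * r) * (indicator {0..a + b} (a + 1 * r) * P (a + 1 * r) f x))
       = (\<lambda>r. indicator {0<..} r * (indicator {0..b} r * P (a + r) f x))"
      using a by (auto simp: fun_eq_iff split: split_indicator)
    ultimately show "(\<lambda>r. indicator {a<..} (a + 1 * r) * (indicator {0..a + b} (a + 1 * r) * P (a + 1 * r) f x)) \<in> borel_measurable lborel"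
      by simp
    show "AE r in lborel. indicator {a<..} (a + 1 * r) * (indicator {0..a + b} (a + 1 * r) * P (a + 1 * r) f x) = indicator {0..b} r * P (a + r) f x"
      using AE_lborel_singleton[of 0] by eventually_elim (use a in \<open>auto split: split_indicator\<close>)
  qed
  finally show ?thesis .
qed

lemma tc_avg_bound:
  assumes f: "f \<in> C0" and s: "0 \<le> s" and t: "0 \<le> t" and c: "\<And>r. 0 \<le> r \<Longrightarrow> r \<le> s \<Longrightarrow> \<bar>P (t + r) f x - a\<bar> \<le> c"
  shows "\<bar>(\<integral>r. indicator {0..s} r * P (t + r) f x \<partial>lborel) - s * a\<bar> \<le> s * c"
proof -
  have "\<bar>(\<integral>r. indicator {0..s} r * P (t + r) f x \<partial>lborel) - (\<integral>r. indicator {0..s} r \<partial>lborel) * a\<bar> \<le> (\<integral>r. \<bar>indicator {0..s} r\<bar> \<partial>lborel) * c"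
    by (rule tc_integral_bound[OF f indicator_weight(1,2)[OF s] t]) (auto intro!: c split: split_indicator_asm)
  then show ?thesis using s by simp
qed

lemma P_avg:
  assumes f: "f \<in> C0" and s: "0 \<le> s" and t: "0 \<le> t"
  shows "P t (tc_avg s f) x = tc_avg (t + s) f x - tc_avg t f x"
  using tc_semigroup_integral[OF f indicator_weight(1,2) t, of s x] integral_shift[OF f t s, of x] s by simp

text \<open>P_t K_s f - K_s f is the integral of P_r f over [s, s + t] minus that over [0, t], hence
  at most 2 c t in absolute value; P_t K_s f itself is a difference of two integrals already known
  to lie in \<open>C0\<close>.\<close>

lemma tc_avg_cont_space:
  assumes f: "f \<in> C0" "\<And>x. 0 \<le> f x" and s: "0 \<le> s"
  shows "tc_avg s f \<in> cont_space"
  unfolding cont_space_def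
proof (intro CollectI conjI allI impI)
  show "tc_avg s f \<in> C0" by (rule tc_avg_C0_nonneg[OF f s])
  show "P t (tc_avg s f) \<in> C0" if t: "0 \<le> t" for t
  proof -
    have "P t (tc_avg s f) = (\<lambda>x. tc_avg (t + s) f x - tc_avg t f x)" by (rule ext) (rule P_avg[OF f(1) s t])
    then show ?thesis using C0_diff[OF tc_avg_C0_nonneg[OF f] tc_avg_C0_nonneg[OF f], of "t + s" t] s t by simp
  qed
  obtain c where c: "\<And>x. \<bar>f x\<bar> \<le> c" using C0_bounded[OF f(1)] by blast
  have c0: "0 \<le> c" using order_trans[OF abs_ge_zero c] .
  fix e :: real assume e: "e > 0"
  \<comment> \<open>The summand 1 covers the case c = 0.\<close>
  define d where "d = e / (2 * c + 1)"
  have d: "d > 0" using e c0 by (simp add: d_def)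
  have "\<bar>P t (tc_avg s f) x - tc_avg s f x\<bar> \<le> e" if t: "0 \<le> t" "t < d" for t x
  proof -
    have b: "\<bar>\<integral>r. indicator {0..t} r * P (a + r) f x \<partial>lborel\<bar> \<le> t * c" if "0 \<le> a" for a
      using tc_avg_bound[OF f(1) t(1) that, of x 0 c] tc_semigroup_bound[OF f(1) _ c] that t(1) by simp
    have "P t (tc_avg s f) x - tc_avg s f x = (\<integral>r. indicator {0..t} r * P (s + r) f x \<partial>lborel) - (\<integral>r. indicator {0..t} r * P (0 + r) f x \<partial>lborel)"
      using P_avg[OF f(1) s t(1), of x] integral_shift[OF f(1) s t(1), of x]
      by (simp add: add.commute tc_integral_def)
    then have "\<bar>P t (tc_avg s f) x - tc_avg s f x\<bar> \<le> t * (2 * c)"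
      using b[OF s] b[OF order_refl] by (simp add: abs_le_iff)
    also have "\<dots> \<le> d * (2 * c)" using t c0 by (intro mult_right_mono) auto
    also have "\<dots> \<le> d * (2 * c + 1)" using d by (intro mult_left_mono) auto
    also have "\<dots> = e" using c0 by (simp add: d_def)
    finally show ?thesis .
  qed
  then show "\<exists>d>0. \<forall>t. 0 \<le> t \<longrightarrow> t < d \<longrightarrow> (\<forall>x. \<bar>P t (tc_avg s f) x - tc_avg s f x\<bar> \<le> e)" using d by blast
qed

lemma P_0_cont_space_nonneg:
  assumes f: "f \<in> C0" "\<And>x. 0 \<le> f x"
  shows "P 0 f \<in> cont_space"
proof -
  define h where "h n x = real (Suc n) * tc_avg (1 / real (Suc n)) f x" for n :: nat and x
  obtain c where c: "\<And>x. \<bar>f x\<bar> \<le> c" using C0_bounded[OF f(1)] by blast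
  have scale: "real (Suc n) * ((1 / real (Suc n)) * y) = y" for n y by simp
  have hb: "\<bar>h n x - a\<bar> \<le> e" if "\<And>r. 0 \<le> r \<Longrightarrow> r \<le> 1 / real (Suc n) \<Longrightarrow> \<bar>P r f x - a\<bar> \<le> e" for n x a e
  proof -
    have "\<bar>tc_avg (1 / real (Suc n)) f x - (1 / real (Suc n)) * a\<bar> \<le> (1 / real (Suc n)) * e"
      using tc_avg_bound[OF f(1) _ order_refl, of "1 / real (Suc n)" x a e] that by (simp add: tc_integral_def)
    then have "real (Suc n) * \<bar>tc_avg (1 / real (Suc n)) f x - (1 / real (Suc n)) * a\<bar> \<le> real (Suc n) * ((1 / real (Suc n)) * e)"
      by (rule mult_left_mono) simp
    moreover have "h n x - a = real (Suc n) * (tc_avg (1 / real (Suc n)) f x - (1 / real (Suc n)) * a)"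
      unfolding h_def right_diff_distrib scale ..
    ultimately show ?thesis unfolding scale by (simp only: abs_mult abs_of_nat)
  qed
  have appr: "\<exists>g\<in>cont_space. \<forall>x\<in>F. \<bar>g x - f x\<bar> \<le> e" if e: "e > 0" for e
  proof (rule convex_combination_uniform_approx[OF cont_space_lincomb cont_space_closed _ f(1) F_closed _ _ _ e])
    show "cont_space \<subseteq> C0" using cont_space_C0 by blast
    \<comment> \<open>Only closure under linear combinations is available; the second summand, with
      coefficient 0, turns it into scalar multiplication.\<close>
    show "h n \<in> cont_space" for n
      using cont_space_lincomb[OF tc_avg_cont_space[OF f, of "1 / real (Suc n)"] tc_avg_cont_space[OF f, of 0], of "real (Suc n)" 0]
      by (simp add: h_def[abs_def])
    show "\<bar>h n x\<bar> \<le> c" for n x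
      using hb[of n x 0 c] tc_semigroup_bound[OF f(1) _ c] by simp
    fix x assume x: "x \<in> F"
    show "(\<lambda>n. h n x) \<longlonglongrightarrow> f x"
    proof (rule LIMSEQ_I)
      fix r :: real assume r: "r > 0"
      have "((\<lambda>s. P s f x) \<longlongrightarrow> f x) (at_right 0)"
        using tc_semigroup_tendsto[OF f(1) order_refl, of x] tc_semigroup_0_F[OF f(1) x] by simp
      then have "\<forall>\<^sub>F s in at_right 0. dist (P s f x) (f x) < r / 2" using r by (intro tendstoD) auto
      then obtain b where b: "b > 0" "\<And>s. s > 0 \<Longrightarrow> s < b \<Longrightarrow> dist (P s f x) (f x) < r / 2"
        by (auto simp: eventually_at_right_field)
      obtain N where N: "1 / real (Suc N) < b" using nat_approx_posE[OF b(1)] by blast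
      have "norm (h n x - f x) < r" if n: "n \<ge> N" for n
      proof -
        have "1 / real (Suc n) \<le> 1 / real (Suc N)" using n by (simp add: frac_le)
        then have "\<bar>P s f x - f x\<bar> \<le> r / 2" if "0 \<le> s" "s \<le> 1 / real (Suc n)" for s
          using b(2)[of s] N that r tc_semigroup_0_F[OF f(1) x] by (cases "s = 0") (auto simp: dist_real_def)
        then have "\<bar>h n x - f x\<bar> \<le> r / 2" by (rule hb)
        then show ?thesis using r by simp
      qed
      then show "\<exists>no. \<forall>n\<ge>no. norm (h n x - f x) < r" by blast
    qed
  qed
  show ?thesis
  proof (rule cont_space_closed)
    fix e :: real assume e: "e > 0"
    obtain g where g: "g \<in> cont_space" "\<And>x. x \<in> F \<Longrightarrow> \<bar>g x - f x\<bar> \<le> e" using appr[OF e] by blast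
    \<comment> \<open>Since g = P_0 g and P_0 is controlled by the supremum over \<open>F\<close>,
      an approximation of \<open>f\<close> on \<open>F\<close> becomes one of P_0 f on the whole
      space.\<close>
    have "\<bar>g x - P 0 f x\<bar> \<le> e" for x
      using P_diff_le_F[OF cont_space_C0[OF g(1)] f(1) order_refl _ g(2), of x] cont_space_P_0[OF g(1)] e by simp
    then show "\<exists>g\<in>cont_space. \<forall>x. \<bar>g x - P 0 f x\<bar> \<le> e" using g(1) by blast
  qed
qed

text \<open>The potential argument requires nonnegative functions, hence the split into positive and
  negative part.\<close>

lemma P_0_cont_space:
  assumes u: "u \<in> C0" shows "P 0 u \<in> cont_space"
proof -
  define v w where "v x = 1/2 * \<bar>u x\<bar> + 1/2 * u x" and "w x = 1/2 * \<bar>u x\<bar> + (-1/2) * u x" for x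
  have vw: "v \<in> C0" "w \<in> C0" unfolding v_def[abs_def] w_def[abs_def] by (intro C0_lincomb C0_abs u)+
  have nn: "0 \<le> v x" "0 \<le> w x" for x unfolding v_def w_def by linarith+
  have "u = (\<lambda>x. 1 * v x + (-1) * w x)" by (auto simp: v_def w_def fun_eq_iff)
  then have "P 0 u = (\<lambda>x. 1 * P 0 v x + (-1) * P 0 w x)"
    using tc_semigroup_lincomb[OF vw order_refl, of 1 "-1"] by auto
  then show ?thesis using cont_space_lincomb[OF P_0_cont_space_nonneg[OF vw(1) nn(1)] P_0_cont_space_nonneg[OF vw(2) nn(2)], of 1 "-1"] by simp
qed

text \<open>P_0 maps \<open>C0\<close> into the space and is the identity on it, so the space is
  exactly the range of this projection.\<close>

lemma hitting_op_image: "hitting_op X F ` C0 = cont_space"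
proof
  have eq: "hitting_op X F u = P 0 u" if "u \<in> C0" for u by (rule ext) (rule hitting_op_eq[OF that])
  show "hitting_op X F ` C0 \<subseteq> cont_space" using P_0_cont_space eq by auto
  show "cont_space \<subseteq> hitting_op X F ` C0"
  proof
    fix g assume g: "g \<in> cont_space"
    then show "g \<in> hitting_op X F ` C0" using cont_space_P_0[OF g] eq[OF cont_space_C0[OF g]] cont_space_C0[OF g] by (intro image_eqI[of _ _ g]) auto
  qed
qed

lemma P_add: "f \<in> C0 \<Longrightarrow> 0 \<le> t \<Longrightarrow> 0 \<le> s \<Longrightarrow> P t (P s f) = P (t + s) f"
  by (rule ext) (rule tc_semigroup_add)

text \<open>The operators commute, so P_s P_t g - P_t g is the contraction P_t applied to P_s g -
  g.\<close>

lemma P_cont_space: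
  assumes g: "g \<in> cont_space" and t: "0 \<le> t" shows "P t g \<in> cont_space"
  unfolding cont_space_def
proof (intro CollectI conjI allI impI)
  note gC = cont_space_C0[OF g]
  show "P t g \<in> C0" by (rule cont_space_P_C0[OF g t])
  show "P s (P t g) \<in> C0" if "0 \<le> s" for s
    unfolding P_add[OF gC that t] using that t by (intro cont_space_P_C0[OF g]) simp
  fix e :: real assume e: "e > 0"
  obtain d where d: "d > 0" "\<And>s x. 0 \<le> s \<Longrightarrow> s < d \<Longrightarrow> \<bar>P s g x - g x\<bar> \<le> e"
    using cont_space_cont[OF g e] by blast
  have "\<bar>P s (P t g) x - P t g x\<bar> \<le> e" if s: "0 \<le> s" "s < d" for s x
  proof -
    have "P s (P t g) = P t (P s g)" using P_add[OF gC s(1) t] P_add[OF gC t s(1)] by (simp add: add.commute)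
    then show ?thesis using P_diff_le[OF cont_space_P_C0[OF g s(1)] gC t d(2)[OF s], of x] by simp
  qed
  then show "\<exists>d>0. \<forall>s. 0 \<le> s \<longrightarrow> s < d \<longrightarrow> (\<forall>x. \<bar>P s (P t g) x - P t g x\<bar> \<le> e)" using d(1) by blast
qed

text \<open>P_t u = P_t (P_0 u): the semigroup absorbs the projection, so a function outside the
  space is moved into it at every time, t = 0 included.\<close>

lemma P_C0_cont_space:
  assumes u: "u \<in> C0" and t: "0 \<le> t" shows "P t u \<in> cont_space"
  using P_cont_space[OF P_0_cont_space[OF u] t] P_add[OF u t order_refl] by simp

lemma tc_integral_C0:
  assumes g: "g \<in> cont_space" and w: "integrable lborel w" and w0: "\<And>r. r < 0 \<Longrightarrow> w r = 0" and t: "0 \<le> t"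
  shows "(\<lambda>x. \<integral>r. w r * P (t + r) g x \<partial>lborel) \<in> C0"
proof -
  obtain c where c: "\<And>x. \<bar>g x\<bar> \<le> c" using C0_bounded[OF cont_space_C0[OF g]] by blast
  show ?thesis
  proof (rule C0_integral[OF lc, where w="\<lambda>r. \<bar>w r\<bar> * c"])
    show "(\<lambda>x. w r * P (t + r) g x) \<in> C0" for r
    proof (cases "r < 0")
      case True then show ?thesis using C0_zero w0 by simp
    next
      case False then show ?thesis using t by (intro C0_scale cont_space_P_C0[OF g]) simp
    qed
    show "\<bar>w r * P (t + r) g x\<bar> \<le> \<bar>w r\<bar> * c" for r x
      using tc_semigroup_bound[OF cont_space_C0[OF g] _ c, of "t + r" x] w0[of r] t
      by (cases "r < 0") (auto simp: abs_mult intro!: mult_left_mono)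
    show "integrable lborel (\<lambda>r. \<bar>w r\<bar> * c)" using w by simp
    show "(\<lambda>r. w r * P (t + r) g x) \<in> borel_measurable lborel" for x
      using integrable_tc[OF cont_space_C0[OF g] w w0 t] by (rule borel_measurable_integrable)
  qed
qed

text \<open>Applying P_t replaces P_r g by P_(t+r) g = P_r (P_t g), which differs from P_r g by at
  most the distance of P_t g from g, uniformly in r. The weight contributes only its total absolute
  mass.\<close>

lemma tc_integral_cont_space:
  assumes g: "g \<in> cont_space" and w: "integrable lborel w" and w0: "\<And>r. r < 0 \<Longrightarrow> w r = 0"
  shows "tc_integral w g \<in> cont_space"
  unfolding cont_space_def
proof (intro CollectI conjI allI impI)
  note gC = cont_space_C0[OF g]
  show "tc_integral w g \<in> C0"
    using tc_integral_C0[OF g w w0 order_refl] by (simp add: tc_integral_def[abs_def])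
  have eq: "P t (tc_integral w g) = (\<lambda>x. \<integral>r. w r * P (t + r) g x \<partial>lborel)" if "0 \<le> t" for t
    by (rule ext) (rule tc_semigroup_integral[OF gC w w0 that])
  show "P t (tc_integral w g) \<in> C0" if "0 \<le> t" for t
    unfolding eq[OF that] by (rule tc_integral_C0[OF g w w0 that])
  fix e :: real assume e: "e > 0"
  define K where "K = (\<integral>r. \<bar>w r\<bar> \<partial>lborel)"
  have K: "0 \<le> K" unfolding K_def by simp
  define e' where "e' = e / (K + 1)"
  have e': "e' > 0" using e K by (simp add: e'_def)
  obtain d where d: "d > 0" "\<And>s x. 0 \<le> s \<Longrightarrow> s < d \<Longrightarrow> \<bar>P s g x - g x\<bar> \<le> e'"
    using cont_space_cont[OF g e'] by blast
  have "\<bar>P t (tc_integral w g) x - tc_integral w g x\<bar> \<le> e" if t: "0 \<le> t" "t < d" for t x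
  proof -
    have b: "\<bar>w r * P (t + r) g x - w r * P (0 + r) g x\<bar> \<le> \<bar>w r\<bar> * e'" for r
    proof (cases "r < 0")
      case False
      then have "P (t + r) g = P r (P t g)" using P_add[OF gC _ t(1), of r] by (simp add: add.commute)
      then have "\<bar>P (t + r) g x - P (0 + r) g x\<bar> \<le> e'"
        using P_diff_le[OF cont_space_P_C0[OF g t(1)] gC _ d(2)[OF t], of r x] False by simp
      then show ?thesis unfolding right_diff_distrib[symmetric] abs_mult by (intro mult_left_mono) auto
    qed (simp add: w0)
    have i1: "integrable lborel (\<lambda>r. w r * P (t + r) g x)" by (rule integrable_tc[OF gC w w0 t(1)])
    have i2: "integrable lborel (\<lambda>r. w r * P (0 + r) g x)" by (rule integrable_tc[OF gC w w0 order_refl])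
    note i = i1 i2
    have "P t (tc_integral w g) x - tc_integral w g x = (\<integral>r. w r * P (t + r) g x \<partial>lborel) - (\<integral>r. w r * P (0 + r) g x \<partial>lborel)"
      unfolding eq[OF t(1)] by (simp add: tc_integral_def)
    also have "\<dots> = (\<integral>r. w r * P (t + r) g x - w r * P (0 + r) g x \<partial>lborel)"
      by (rule Bochner_Integration.integral_diff[OF i, symmetric])
    finally have "\<bar>P t (tc_integral w g) x - tc_integral w g x\<bar> \<le> (\<integral>r. \<bar>w r * P (t + r) g x - w r * P (0 + r) g x\<bar> \<partial>lborel)"
      by (simp only: integral_abs_bound)
    also have "\<dots> \<le> (\<integral>r. \<bar>w r\<bar> * e' \<partial>lborel)"
    proof (rule integral_mono[OF integrable_abs[OF Bochner_Integration.integrable_diff[OF i]]])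
      show "integrable lborel (\<lambda>r. \<bar>w r\<bar> * e')" using w by simp
    qed (rule b)
    also have "\<dots> = K * e'" by (simp add: K_def)
    also have "\<dots> \<le> (K + 1) * e'" using e' by (intro mult_right_mono) auto
    also have "\<dots> = e" using K by (simp add: e'_def)
    finally show ?thesis .
  qed
  then show "\<exists>d>0. \<forall>t. 0 \<le> t \<longrightarrow> t < d \<longrightarrow> (\<forall>x. \<bar>P t (tc_integral w g) x - tc_integral w g x\<bar> \<le> e)" using d(1) by blast
qed

lemma resolvent_cont_space:
  assumes u: "u \<in> cont_space" and \<alpha>: "\<alpha> > 0" shows "tc_resolvent X A \<alpha> u \<in> cont_space"
proof -
  have "tc_resolvent X A \<alpha> u = tc_integral (\<lambda>t. indicator {0..} t * exp (- \<alpha> * t)) u"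
    by (rule ext) (rule tc_resolvent_eq(3)[OF cont_space_C0[OF u] \<alpha>])
  then show ?thesis using tc_integral_cont_space[OF u tc_resolvent_eq(1)[OF cont_space_C0[OF u] \<alpha>]] by simp
qed

text \<open>The probability weight \<alpha> exp(-\<alpha> t) concentrates at 0: on [0, d) the
  deviation of P_t u from u is at most e/2, while [d, \<infinity>) has mass exp(-\<alpha> d) and
  there the crude bound 2 c suffices.\<close>

lemma resolvent_limit:
  assumes u: "u \<in> cont_space"
  shows "((\<lambda>\<alpha>. sup_norm (\<lambda>x. \<alpha> * tc_resolvent X A \<alpha> u x - u x)) \<longlongrightarrow> 0) at_top"
proof (rule tendsto_0_ennrealI)
  note uC = cont_space_C0[OF u]
  fix e :: real assume e: "e > 0"
  obtain c where c: "\<And>x. \<bar>u x\<bar> \<le> c" using C0_bounded[OF uC] by blast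
  have c0: "0 \<le> c" using order_trans[OF abs_ge_zero c] .
  obtain d where d: "d > 0" "\<And>s x. 0 \<le> s \<Longrightarrow> s < d \<Longrightarrow> \<bar>P s u x - u x\<bar> \<le> e / 2"
    using cont_space_cont[OF u, of "e / 2"] e by auto
  have "((\<lambda>\<alpha>. 2 * c * exp (- \<alpha> * d)) \<longlongrightarrow> 0) at_top" using d(1) by real_asymp
  then have "\<forall>\<^sub>F \<alpha> in at_top. 2 * c * exp (- \<alpha> * d) < e / 2" using e by (intro order_tendstoD) auto
  then show "\<forall>\<^sub>F \<alpha> in at_top. sup_norm (\<lambda>x. \<alpha> * tc_resolvent X A \<alpha> u x - u x) \<le> ennreal e"
    using eventually_gt_at_top[of 0]
  proof eventually_elim
    case (elim \<alpha>)
    then have \<alpha>: "\<alpha> > 0" by simp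
    let ?w = "\<lambda>t::real. indicator {0..} t * exp (- \<alpha> * t)" and ?v = "\<lambda>t::real. indicator {d..} t * exp (- \<alpha> * t)"
    note w = tc_resolvent_eq(1,2)[OF uC \<alpha>]
    have v: "integrable lborel ?v" "(\<integral>t. ?v t \<partial>lborel) = exp (- \<alpha> * d) / \<alpha>"
      using exp_tail_integral[OF \<alpha>, of d] by (simp_all add: has_bochner_integral_iff)
    show ?case
    proof (rule sup_norm_le)
      fix x
      have i: "integrable lborel (\<lambda>r. ?w r * P r u x)"
        using integrable_tc[OF uC w(1) _ order_refl, of x] by simp
      have iu: "integrable lborel (\<lambda>r. ?w r * u x)" by (rule integrable_mult_left) (rule w(1))
      have "(\<integral>r. ?w r * u x \<partial>lborel) = (1 / \<alpha>) * u x" unfolding w(2)[symmetric] by (rule integral_mult_left_zero)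
      then have "tc_resolvent X A \<alpha> u x - u x / \<alpha> = (\<integral>r. ?w r * P r u x \<partial>lborel) - (\<integral>r. ?w r * u x \<partial>lborel)"
        unfolding tc_resolvent_eq(3)[OF uC \<alpha>] tc_integral_def by simp
      also have "\<dots> = (\<integral>r. ?w r * P r u x - ?w r * u x \<partial>lborel)"
        by (rule Bochner_Integration.integral_diff[OF i iu, symmetric])
      finally have "\<bar>tc_resolvent X A \<alpha> u x - u x / \<alpha>\<bar> \<le> (\<integral>r. \<bar>?w r * P r u x - ?w r * u x\<bar> \<partial>lborel)"
        by (simp only: integral_abs_bound)
      also have "\<dots> \<le> (\<integral>r. ?w r * (e / 2) + ?v r * (2 * c) \<partial>lborel)"
      proof (rule integral_mono)
        show "integrable lborel (\<lambda>r. \<bar>?w r * P r u x - ?w r * u x\<bar>)"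
          by (rule integrable_abs[OF Bochner_Integration.integrable_diff[OF i iu]])
        show "integrable lborel (\<lambda>r. ?w r * (e / 2) + ?v r * (2 * c))"
          by (rule Bochner_Integration.integrable_add[OF integrable_mult_left integrable_mult_left]) (rule w(1), rule v(1))
        show "\<bar>?w r * P r u x - ?w r * u x\<bar> \<le> ?w r * (e / 2) + ?v r * (2 * c)" for r
        proof (cases "0 \<le> r")
          case True
          have "\<bar>P r u x - u x\<bar> \<le> e / 2 + indicator {d..} r * (2 * c)"
          proof (cases "r < d")
            case True
            then show ?thesis using d(2)[OF \<open>0 \<le> r\<close> True, of x] c0 by simp
          next
            case False
            then show ?thesis using tc_semigroup_bound[OF uC \<open>0 \<le> r\<close> c, of x] c[of x] e by simp
          qed
          then have "?w r * \<bar>P r u x - u x\<bar> \<le> ?w r * (e / 2 + indicator {d..} r * (2 * c))"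
            by (intro mult_left_mono) auto
          moreover have "\<bar>?w r * P r u x - ?w r * u x\<bar> = ?w r * \<bar>P r u x - u x\<bar>"
            by (simp add: right_diff_distrib[symmetric] abs_mult)
          moreover have "?w r * (e / 2 + indicator {d..} r * (2 * c)) = ?w r * (e / 2) + ?v r * (2 * c)"
            using True by (simp add: algebra_simps)
          ultimately show ?thesis by simp
        next
          case False
          then show ?thesis using d(1) by simp
        qed
      qed
      also have "\<dots> = (1 / \<alpha>) * (e / 2) + exp (- \<alpha> * d) / \<alpha> * (2 * c)"
      proof -
        have "(\<integral>r. ?w r * (e / 2) + ?v r * (2 * c) \<partial>lborel) = (\<integral>r. ?w r * (e / 2) \<partial>lborel) + (\<integral>r. ?v r * (2 * c) \<partial>lborel)"
          by (rule Bochner_Integration.integral_add[OF integrable_mult_left integrable_mult_left]) (rule w(1), rule v(1))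
        also have "(\<integral>r. ?w r * (e / 2) \<partial>lborel) = (\<integral>r. ?w r \<partial>lborel) * (e / 2)" by (rule integral_mult_left_zero)
        also have "(\<integral>r. ?v r * (2 * c) \<partial>lborel) = (\<integral>r. ?v r \<partial>lborel) * (2 * c)" by (rule integral_mult_left_zero)
        finally show ?thesis unfolding w(2) v(2) .
      qed
      finally have "\<alpha> * \<bar>tc_resolvent X A \<alpha> u x - u x / \<alpha>\<bar> \<le> \<alpha> * ((1 / \<alpha>) * (e / 2) + exp (- \<alpha> * d) / \<alpha> * (2 * c))"
        using \<alpha> by (intro mult_left_mono) auto
      also have "\<dots> = e / 2 + 2 * c * exp (- \<alpha> * d)" using \<alpha> by (simp add: field_simps)
      also have "\<alpha> * \<bar>tc_resolvent X A \<alpha> u x - u x / \<alpha>\<bar> = \<bar>\<alpha> * tc_resolvent X A \<alpha> u x - u x\<bar>"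
      proof -
        have "\<alpha> * tc_resolvent X A \<alpha> u x - u x = \<alpha> * (tc_resolvent X A \<alpha> u x - u x / \<alpha>)"
          using \<alpha> by (simp add: right_diff_distrib)
        then show ?thesis using \<alpha> by (simp only: abs_mult abs_of_pos)
      qed
      finally show "\<bar>\<alpha> * tc_resolvent X A \<alpha> u x - u x\<bar> \<le> e" using elim(1) by simp
    qed
  qed
qed

lemma semigroup_limit:
  assumes u: "u \<in> cont_space"
  shows "((\<lambda>t. sup_norm (\<lambda>x. P t u x - u x)) \<longlongrightarrow> 0) (at_right 0)"
proof (rule tendsto_0_ennrealI)
  fix e :: real assume e: "e > 0"
  obtain d where d: "d > 0" "\<And>s x. 0 \<le> s \<Longrightarrow> s < d \<Longrightarrow> \<bar>P s u x - u x\<bar> \<le> e"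
    using cont_space_cont[OF u e] by blast
  then show "\<forall>\<^sub>F t in at_right 0. sup_norm (\<lambda>x. P t u x - u x) \<le> ennreal e"
    by (auto simp: eventually_at_right_field intro!: exI[of _ d] sup_norm_le)
qed

lemma semigroup_continuous_map:
  assumes t: "0 \<le> t" shows "continuous_map C0_topology C0_topology (P t)"
  unfolding C0_topology_def Metric_space.metric_continuous_map[OF Metric_space_C0 Metric_space_C0]
proof (intro conjI ballI allI impI)
  show "P t ` C0 \<subseteq> C0" using cont_space_C0[OF P_C0_cont_space[OF _ t]] by blast
  fix u :: "'a \<Rightarrow> real" and e :: real assume u: "u \<in> C0" and e: "0 < e"
  have "sup_dist (P t u) (P t v) < e" if v: "v \<in> C0" "sup_dist u v < e" for v
  proof -
    have "sup_dist (P t u) (P t v) \<le> sup_dist u v"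
      using P_diff_le[OF u v(1) t le_sup_dist[OF u v(1)]]
      by (intro sup_dist_le) (auto intro: Metric_space.nonneg[OF Metric_space_C0])
    then show ?thesis using v(2) by simp
  qed
  then show "\<exists>d>0. \<forall>v. v \<in> C0 \<and> sup_dist u v < d \<longrightarrow> sup_dist (P t u) (P t v) < e" using e by blast
qed

text \<open>P_r u = P_r v for v = P_0 u, and v is strongly continuous. For a <= b the difference P_b
  u - P_a u is the contraction P_a applied to P_(b-a) v - v, so the estimate depends on b - a alone
  and gives continuity from both sides.\<close>

lemma trajectory_continuous_map:
  assumes u: "u \<in> C0" shows "continuous_map (top_of_set {0..}) C0_topology (\<lambda>t. P t u)"
  unfolding C0_topology_def Metric_space.continuous_map_to_metric[OF Metric_space_C0]
proof (intro ballI allI impI)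
  fix t e :: real assume "t \<in> topspace (top_of_set {0..})" and e: "0 < e"
  then have t: "0 \<le> t" by simp
  define v where "v = P 0 u"
  have v: "v \<in> cont_space" unfolding v_def by (rule P_0_cont_space[OF u])
  obtain d where d: "d > 0" "\<And>s x. 0 \<le> s \<Longrightarrow> s < d \<Longrightarrow> \<bar>P s v x - v x\<bar> \<le> e / 2"
    using cont_space_cont[OF v, of "e / 2"] e by auto
  have Pv: "P r u = P r v" if "0 \<le> r" for r unfolding v_def using P_add[OF u that order_refl] by simp
  have close: "\<bar>P a u x - P b u x\<bar> \<le> e / 2" if ab: "0 \<le> a" "a \<le> b" "b < a + d" for a b x
  proof -
    have b0: "0 \<le> b" using ab by simp
    have "P b u = P a (P (b - a) v)" unfolding Pv[OF b0] using P_add[OF cont_space_C0[OF v] ab(1), of "b - a"] ab by simp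
    moreover have "\<bar>v y - P (b - a) v y\<bar> \<le> e / 2" for y using d(2)[of "b - a" y] ab by (simp add: abs_minus_commute)
    ultimately show ?thesis
      unfolding Pv[OF ab(1)] using P_diff_le[OF cont_space_C0[OF v] cont_space_P_C0[OF v] ab(1), of "b - a" "e / 2" x] ab by simp
  qed
  have "P s u \<in> Metric_space.mball C0 sup_dist (P t u) e" if s: "0 \<le> s" "\<bar>s - t\<bar> < d" for s
  proof -
    have "\<bar>P t u x - P s u x\<bar> \<le> e / 2" for x
      using close[of t s x] close[of s t x] s t by (cases "t \<le> s") (auto simp: abs_minus_commute)
    then have "sup_dist (P t u) (P s u) \<le> e / 2" using e by (intro sup_dist_le) auto
    then show ?thesis using e cont_space_C0[OF P_C0_cont_space[OF u t]] cont_space_C0[OF P_C0_cont_space[OF u s(1)]]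
      by (simp add: Metric_space.in_mball[OF Metric_space_C0])
  qed
  then show "\<exists>U. openin (top_of_set {0..}) U \<and> t \<in> U \<and> (\<forall>s\<in>U. P s u \<in> Metric_space.mball C0 sup_dist (P t u) e)"
    using t d(1) by (intro exI[of _ "{0..} \<inter> ball t d"]) (auto simp: dist_real_def abs_minus_commute openin_open_Int)
qed

end

text \<open>A vanishing integral would force the measurable integrand to vanish almost everywhere,
  in particular on (0, 1), where it is strictly positive.\<close>

lemma green_positive:
  assumes "(\<lambda>(t, x, y). p t x y) \<in> borel_measurable (restrict_space borel {0<..} \<Otimes>\<^sub>M borel \<Otimes>\<^sub>M borel)"
    and pos: "\<forall>t>0. \<forall>x y. 0 < p t x y"
  shows "0 < green p \<alpha> x y"
proof -
  have "(\<lambda>t. (t, x, y)) \<in> restrict_space borel {0<..} \<rightarrow>\<^sub>M restrict_space borel {0<..} \<Otimes>\<^sub>M borel \<Otimes>\<^sub>M borel"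
    by (intro measurable_Pair measurable_const) simp_all
  from measurable_compose[OF this assms(1)]
  have "(\<lambda>t. p t x y) \<in> borel_measurable (restrict_space borel {0<..})" by simp
  then have [measurable]: "(\<lambda>t. p t x y * indicator {0<..} t) \<in> borel_measurable borel"
    by (subst (asm) borel_measurable_restrict_space_iff_ennreal) auto
  have m: "(\<lambda>t. ennreal (exp (- \<alpha> * t)) * (p t x y * indicator {0<..} t)) \<in> borel_measurable lborel" by measurable
  have "green p \<alpha> x y \<noteq> 0"
  proof
    assume "green p \<alpha> x y = 0"
    then have "AE t in lborel. ennreal (exp (- \<alpha> * t)) * (p t x y * indicator {0<..} t) = 0"
      unfolding green_def using nn_integral_0_iff_AE[OF m] by (simp add: mult.assoc)
    then have "AE t in lborel. t \<notin> {0<..<1::real}"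
    proof eventually_elim
      case (elim t)
      then show ?case using pos[rule_format, of t x y] by (auto simp: ennreal_eq_0_iff not_le split: split_indicator_asm)
    qed
    then have "{0<..<1::real} \<in> null_sets lborel" by (subst AE_iff_null_sets) simp_all
    then have "emeasure lborel {0<..<1::real} = 0" by (rule null_setsD1)
    then show False by simp
  qed
  then show ?thesis by (simp add: zero_less_iff_neq_zero)
qed

theorem theorem2p2:
  fixes X :: "('w, 'a::{metric_space, second_countable_topology}) process"
    and Y :: "('v, 'a) process"
    and m \<mu> :: "'a measure"
    and p q :: "real \<Rightarrow> 'a \<Rightarrow> 'a \<Rightarrow> ennreal"
    and A :: "real \<Rightarrow> 'w \<Rightarrow> real"
    and F :: "'a set"
  assumes space: "locally_compact_space (euclidean :: 'a topology)"
    and m: "radon_measure m" "full_support m"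
    and X: "transient_green_process X m p"
    and dual: "transient_green_process Y m q" "in_duality m X Y"
    and Kato: "G_Kato p \<mu>"
    and A: "pcaf X A" "revuz_measure X m A \<mu>"
    and potential_formula: "\<And>\<alpha> f x. 0 \<le> \<alpha> \<Longrightarrow> f \<in> borel_measurable borel \<Longrightarrow>
      (\<integral>\<^sup>+ \<omega>. (\<integral>\<^sup>+ t\<in>{0..}. ennreal (exp (- \<alpha> * t)) * ext0 f (Pos X (ennreal t) \<omega>)
         \<partial>stieltjes A \<omega>) \<partial>Law X (Some x)) = (\<integral>\<^sup>+ y. green p \<alpha> x y * f y \<partial>\<mu>)"
    and F: "is_fine_support X \<mu> F"
    and F_regular: "F = {x. AE \<omega> in Law X (Some x). inverse_pcaf A 0 \<omega> = 0}"
    and F_closed: "closed F"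
  shows
    "(\<forall>\<alpha>>0. \<forall>u\<in>hitting_op X F ` C0. tc_resolvent X A \<alpha> u \<in> hitting_op X F ` C0) \<and>
     (\<forall>u\<in>hitting_op X F ` C0.
        ((\<lambda>\<alpha>. sup_norm (\<lambda>x. \<alpha> * tc_resolvent X A \<alpha> u x - u x)) \<longlongrightarrow> 0) at_top) \<and>
     (\<forall>t>0. \<forall>u\<in>hitting_op X F ` C0. tc_semigroup X A t u \<in> hitting_op X F ` C0) \<and>
     (\<forall>u\<in>hitting_op X F ` C0.
        ((\<lambda>t. sup_norm (\<lambda>x. tc_semigroup X A t u x - u x)) \<longlongrightarrow> 0) (at_right 0)) \<and>
     (\<forall>t\<ge>0. continuous_map C0_topology C0_topology (tc_semigroup X A t)) \<and>
     (\<forall>u\<in>C0. continuous_map (top_of_set {0..}) C0_topology (\<lambda>t. tc_semigroup X A t u))"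
proof -
  have std: "standard_process X" and lsc: "lower_semicont (\<lambda>(x, y). green p 0 x y)"
    and dens: "transition_density X m p" and pos: "\<forall>t>0. \<forall>x y. 0 < p t x y"
    using X by (simp_all add: transient_green_process_def)
  note A_aug = A(1)[unfolded pcaf_def, THEN conjunct1]
  obtain L where L: "L \<in> sets (aug_filt X \<infinity>)" and L': "(\<forall>x. AE \<omega> in Law X (Some x). \<omega> \<in> L) \<and>
        (\<forall>\<omega>\<in>L. \<forall>t\<ge>0. Shift X (ennreal t) \<omega> \<in> L) \<and>
        (\<forall>\<omega>\<in>L. A 0 \<omega> = 0 \<and> (\<forall>t\<ge>0. 0 \<le> A t \<omega>) \<and> continuous_on {0..} (\<lambda>t. A t \<omega>) \<and>
           (\<forall>s\<ge>0. \<forall>t\<ge>s. lifetime X \<omega> \<le> ennreal s \<longrightarrow> A t \<omega> = A s \<omega>) \<and>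
           (\<forall>s\<ge>0. \<forall>t\<ge>0. A (s + t) \<omega> = A s \<omega> + A t (Shift X (ennreal s) \<omega>)))"
    using A(1)[unfolded pcaf_def, THEN conjunct2] by (rule bexE)
  note L1 = L'[THEN conjunct1] and L2 = L'[THEN conjunct2, THEN conjunct1]
    and L3 = L'[THEN conjunct2, THEN conjunct2, THEN bspec]
  interpret kato_time_change X A L F "green p 0" \<mu>
  proof unfold_locales
    show "locally_compact_space (euclidean :: 'a topology)" by (rule space)
    show "standard_process X" by (rule std)
    show "A t \<in> borel_measurable (aug_filt X (ennreal t))" if "0 \<le> t" for t using A_aug that by simp
    show "L \<in> sets (aug_filt X \<infinity>)" by (rule L)
    show "AE \<omega> in Law X (Some x). \<omega> \<in> L" for x using L1 by simp
    show "Shift X (ennreal t) \<omega> \<in> L" if "\<omega> \<in> L" "0 \<le> t" for \<omega> t using L2 that by simp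
    show "A 0 \<omega> = 0" "continuous_on {0..} (\<lambda>t. A t \<omega>)" if "\<omega> \<in> L" for \<omega> using L3[OF that] by simp_all
    show "0 \<le> A t \<omega>" if "\<omega> \<in> L" "0 \<le> t" for \<omega> t using L3[OF that(1)] that(2) by simp
    show "A t \<omega> = A s \<omega>" if "\<omega> \<in> L" "0 \<le> s" "s \<le> t" "lifetime X \<omega> \<le> ennreal s" for \<omega> s t
      using L3[OF that(1)] that(2-4) by blast
    show "A (s + t) \<omega> = A s \<omega> + A t (Shift X (ennreal s) \<omega>)" if "\<omega> \<in> L" "0 \<le> s" "0 \<le> t" for \<omega> s t
      using L3[OF that(1)] that(2,3) by simp
    show "F = {x. AE \<omega> in Law X (Some x). inverse_pcaf A 0 \<omega> = 0}" by (rule F_regular)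
    show "closed F" by (rule F_closed)
    show "lower_semicont (\<lambda>(x, y). green p 0 x y)" by (rule lsc)
    show "0 < green p 0 x y" for x y
      using dens by (intro green_positive[OF _ pos]) (simp add: transition_density_def)
    show "sets \<mu> = sets borel" "(\<integral>\<^sup>+ y. green p 0 x y \<partial>\<mu>) < \<infinity>" "(\<lambda>x. enn2real (\<integral>\<^sup>+ y. green p 0 x y \<partial>\<mu>)) \<in> C0" for x
      using Kato by (simp_all add: G_Kato_def radon_measure_def)
    show "(\<integral>\<^sup>+ \<omega>. (\<integral>\<^sup>+ s\<in>{0..}. ext0 f (Pos X (ennreal s) \<omega>) \<partial>stieltjes A \<omega>) \<partial>Law X (Some x)) = (\<integral>\<^sup>+ y. green p 0 x y * f y \<partial>\<mu>)"
      if "f \<in> borel_measurable borel" for f x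
      using potential_formula[OF order_refl that, of x] by simp
  qed
  \<comment> \<open>Once the range of P_F is replaced by \<open>cont_space\<close>, every conjunct
    is an invariance or continuity statement about that space or about \<open>C0\<close>.\<close>
  show ?thesis
    unfolding hitting_op_image
    by (intro conjI ballI allI impI resolvent_cont_space resolvent_limit P_cont_space semigroup_limit
      semigroup_continuous_map trajectory_continuous_map) simp_all
qed

end
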